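(* Let $p:\mathbb E\to\mathbb B$ be a fibration, $\mathcal T$ a monad on $\mathbb B$, $R:\mathbb A\to\mathbb B_{\mathcal T}$, $S:\mathbb A\to\mathbb E$ a lifting parameter, and $A$ a set. Suppose $(p,S)$ satisfies the codensity condition, and $\mathbb E$ has and $p$ preserves powers by $A$. Then for any $\alpha\in\mathbf{Alg}(\mathcal T,A)$ the map $\phi$ (defined in the context) is a bijection $$\phi:[\mathbb A,\mathbb E]_{\alpha R}(A\pitchfork S,S)\to\mathbf{Alg}_\alpha(\mathcal T^{\top\top},A).$$
   Context: Juxtaposition denotes whiskering, $\bullet$ vertical composition. $\mathcal T=(T,\eta,\mu)$ has Kleisli resolution $J\dashv K$, $K:\mathbb B_{\mathcal T}\to\mathbb B$, counit $\epsilon$. A lifting parameter is $R:\mathbb A\to\mathbb B_{\mathcal T}$, $S:\mathbb A\to\mathbb E$ with $KR=pS$; codensity condition: a right Kan extension $(\mathrm{Ran}_SS,c)$ of $S$ along $S$ exists and $p$ preserves it. Codensity monad: unit $u$, multiplication $m$ with $c\bullet uS=\mathrm{id}$, $c\bullet mS=c\bullet(\mathrm{Ran}_SS)c$. Write $\overline{(-)}$ for the inverse of the bijection $\beta\mapsto pc\bullet\beta S$ (natural transformations $H\to p\,\mathrm{Ran}_SS$ vs. $HS\to pS$, $H:\mathbb E\to\mathbb B$), and also, for $F:\mathbb E\to\mathbb E$, for the inverse of $\beta\mapsto c\bullet\beta S$ (natural transformations $F\to\mathrm{Ran}_SS$ vs. $FS\to S$). Codensity lifting $\mathcal T^{\top\top}$: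 $\sigma:T^{\top\top}\to\mathrm{Ran}_SS$ cartesian lifting of $\overline{K\epsilon R}:Tp\to p\,\mathrm{Ran}_SS$ in $[\mathbb E,p]:[\mathbb E,\mathbb E]\to[\mathbb E,\mathbb B]$; $\eta^{\top\top}$ unique above $\eta p$ with $\sigma\bullet\eta^{\top\top}=u$; $\mu^{\top\top}$ unique above $\mu p$ with $\sigma\bullet\mu^{\top\top}=m\bullet\sigma(\mathrm{Ran}_SS)\bullet T^{\top\top}\sigma$. It is a lifting of $\mathcal T$ (monad on $\mathbb E$ with $pT^{\top\top}=Tp$ etc.); let $\dot J\dashv\dot K$ be its Kleisli resolution with counit $\dot\epsilon$, and $p_k:\mathbb E_{\mathcal T^{\top\top}}\to\mathbb B_{\mathcal T}$ the canonical extension of $p$. For a category $\mathbb C$ with powers by $A$ and monad $\mathcal T$ on it, an $A$-ary algebraic operation is a natural transformation $\alpha:A\pitchfork K\to K$ (pointwise power); $\mathbf{Alg}(\mathcal T,A)$ is the class of these; for a lifting $\dot{\mathcal T}$, $\mathbf{Alg}_\alpha(\dot{\mathcal T},A)=\{\dot\alpha\in\mathbf{Alg}(\dot{\mathcal T},A)\mid p\dot\alpha=\alpha p_k\}$. $[\mathbb A,\mathbb E]_{\alpha R}(A\pitchfork S,S)$ is the set of natural transformations $\alpha_0:A\pitchfork S\to S$ with $p\alpha_0=\alpha R$. Definition of $\phi$: given $\alpha_0$, since $A\pitchfork S=(A\pitchfork\mathrm{Id}_{\mathbb E})S$ take $\overline{\alpha_0}:A\pitchfork\mathrm{Id}_{\mathbb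 E}\to\mathrm{Ran}_SS$; let $\beta:A\pitchfork\mathrm{Id}_{\mathbb E}\to T^{\top\top}$ be the unique natural transformation above $\alpha Jp\bullet A\pitchfork\eta p$ with $\sigma\bullet\beta=\overline{\alpha_0}$; set $\phi(\alpha_0)=\dot K\dot\epsilon\bullet\beta\dot K:A\pitchfork\dot K\to\dot K$. *)

theory Defs
  imports "HOL-Library.FuncSet"
begin

section \<open>Categories, functors, natural transformations\<close>

record ('o, 'm) cat =
  Obj :: "'o set"
  Arr :: "'m set"
  Dom :: "'m \<Rightarrow> 'o"
  Cod :: "'m \<Rightarrow> 'o"
  Ident :: "'o \<Rightarrow> 'm"
  Comp :: "'m \<Rightarrow> 'm \<Rightarrow> 'm"  (infixr \<open>\<cdot>\<index>\<close> 70)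

definition Hom :: "('o, 'm) cat \<Rightarrow> 'o \<Rightarrow> 'o \<Rightarrow> 'm set" where
  "Hom C X Y = {f \<in> Arr C. Dom C f = X \<and> Cod C f = Y}"

locale category =
  fixes C :: "('o, 'm) cat"
  assumes Dom_Obj: "f \<in> Arr C \<Longrightarrow> Dom C f \<in> Obj C"
    and Cod_Obj: "f \<in> Arr C \<Longrightarrow> Cod C f \<in> Obj C"
    and Ident_Hom: "X \<in> Obj C \<Longrightarrow> Ident C X \<in> Hom C X X"
    and Comp_Hom: "f \<in> Hom C X Y \<Longrightarrow> g \<in> Hom C Y Z \<Longrightarrow> g \<cdot>\<^bsub>C\<^esub> f \<in> Hom C X Z"
    and Comp_Ident_left: "f \<in> Hom C X Y \<Longrightarrow> Ident C Y \<cdot>\<^bsub>C\<^esub> f = f"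
    and Comp_Ident_right: "f \<in> Hom C X Y \<Longrightarrow> f \<cdot>\<^bsub>C\<^esub> Ident C X = f"
    and Comp_assoc: "f \<in> Hom C W X \<Longrightarrow> g \<in> Hom C X Y \<Longrightarrow> h \<in> Hom C Y Z \<Longrightarrow>
      (h \<cdot>\<^bsub>C\<^esub> g) \<cdot>\<^bsub>C\<^esub> f = h \<cdot>\<^bsub>C\<^esub> (g \<cdot>\<^bsub>C\<^esub> f)"

text \<open>Functors and natural transformations carry their source and target, and their
  underlying maps are \<open>undefined\<close> outside the objects (arrows) of the source category.  Hence
  equality in HOL is equality of functors and of natural transformations, functors and natural
  transformations form sets, and composition and whiskering need no category annotations.\<close>

record ('o1, 'm1, 'o2, 'm2) func =
  Src :: "('o1, 'm1) cat"
  Tgt :: "('o2, 'm2) cat"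
  fobj :: "'o1 \<Rightarrow> 'o2"
  farr :: "'m1 \<Rightarrow> 'm2"

definition Fun :: "('o1, 'm1) cat \<Rightarrow> ('o2, 'm2) cat \<Rightarrow> ('o1, 'm1, 'o2, 'm2) func set" where
  "Fun C D = {F. Src F = C \<and> Tgt F = D \<and>
     fobj F \<in> extensional (Obj C) \<and> farr F \<in> extensional (Arr C) \<and>
     (\<forall>X\<in>Obj C. fobj F X \<in> Obj D) \<and>
     (\<forall>f\<in>Arr C. farr F f \<in> Hom D (fobj F (Dom C f)) (fobj F (Cod C f))) \<and>
     (\<forall>X\<in>Obj C. farr F (Ident C X) = Ident D (fobj F X)) \<and>
     (\<forall>f\<in>Arr C. \<forall>g\<in>Arr C. Cod C f = Dom C g \<longrightarrow>
        farr F (g \<cdot>\<^bsub>C\<^esub> f) = farr F g \<cdot>\<^bsub>D\<^esub> farr F f)}"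

definition IdF :: "('o, 'm) cat \<Rightarrow> ('o, 'm, 'o, 'm) func" where
  "IdF C = \<lparr>Src = C, Tgt = C, fobj = (\<lambda>X\<in>Obj C. X), farr = (\<lambda>f\<in>Arr C. f)\<rparr>"

definition compF :: "('o2, 'm2, 'o3, 'm3) func \<Rightarrow> ('o1, 'm1, 'o2, 'm2) func
    \<Rightarrow> ('o1, 'm1, 'o3, 'm3) func"  (infixr \<open>\<circ>\<^sub>F\<close> 75) where
  "G \<circ>\<^sub>F F = \<lparr>Src = Src F, Tgt = Tgt G,
     fobj = (\<lambda>X\<in>Obj (Src F). fobj G (fobj F X)),
     farr = (\<lambda>f\<in>Arr (Src F). farr G (farr F f))\<rparr>"

record ('o1, 'm1, 'o2, 'm2) ntrans =
  NDom :: "('o1, 'm1, 'o2, 'm2) func"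
  NCod :: "('o1, 'm1, 'o2, 'm2) func"
  comp_at :: "'o1 \<Rightarrow> 'm2"

definition Nat :: "('o1, 'm1, 'o2, 'm2) func \<Rightarrow> ('o1, 'm1, 'o2, 'm2) func
    \<Rightarrow> ('o1, 'm1, 'o2, 'm2) ntrans set" where
  "Nat F G = {\<alpha>. NDom \<alpha> = F \<and> NCod \<alpha> = G \<and>
     F \<in> Fun (Src F) (Tgt F) \<and> G \<in> Fun (Src F) (Tgt F) \<and>
     comp_at \<alpha> \<in> extensional (Obj (Src F)) \<and>
     (\<forall>X\<in>Obj (Src F). comp_at \<alpha> X \<in> Hom (Tgt F) (fobj F X) (fobj G X)) \<and>
     (\<forall>f\<in>Arr (Src F).
        farr G f \<cdot>\<^bsub>Tgt F\<^esub> comp_at \<alpha> (Dom (Src F) f)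
          = comp_at \<alpha> (Cod (Src F) f) \<cdot>\<^bsub>Tgt F\<^esub> farr F f)}"

definition idN :: "('o1, 'm1, 'o2, 'm2) func \<Rightarrow> ('o1, 'm1, 'o2, 'm2) ntrans" where
  "idN F = \<lparr>NDom = F, NCod = F, comp_at = (\<lambda>X\<in>Obj (Src F). Ident (Tgt F) (fobj F X))\<rparr>"

definition vcomp :: "('o1, 'm1, 'o2, 'm2) ntrans \<Rightarrow> ('o1, 'm1, 'o2, 'm2) ntrans
    \<Rightarrow> ('o1, 'm1, 'o2, 'm2) ntrans"  (infixr \<open>\<bullet>\<^sub>N\<close> 65) where
  "\<beta> \<bullet>\<^sub>N \<alpha> = \<lparr>NDom = NDom \<alpha>, NCod = NCod \<beta>,
     comp_at = (\<lambda>X\<in>Obj (Src (NDom \<alpha>)). comp_at \<beta> X \<cdot>\<^bsub>Tgt (NDom \<alpha>)\<^esub> comp_at \<alpha> X)\<rparr>"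

text \<open>Whiskering: \<open>F \<rhd>\<^sub>N \<alpha>\<close> is \<open>F\<alpha>\<close> and \<open>\<alpha> \<lhd>\<^sub>N F\<close> is \<open>\<alpha>F\<close>.\<close>

definition whiskerL :: "('o2, 'm2, 'o3, 'm3) func \<Rightarrow> ('o1, 'm1, 'o2, 'm2) ntrans
    \<Rightarrow> ('o1, 'm1, 'o3, 'm3) ntrans"  (infixr \<open>\<rhd>\<^sub>N\<close> 72) where
  "F \<rhd>\<^sub>N \<alpha> = \<lparr>NDom = F \<circ>\<^sub>F NDom \<alpha>, NCod = F \<circ>\<^sub>F NCod \<alpha>,
     comp_at = (\<lambda>X\<in>Obj (Src (NDom \<alpha>)). farr F (comp_at \<alpha> X))\<rparr>"

definition whiskerR :: "('o2, 'm2, 'o3, 'm3) ntrans \<Rightarrow> ('o1, 'm1, 'o2, 'm2) func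
    \<Rightarrow> ('o1, 'm1, 'o3, 'm3) ntrans"  (infixl \<open>\<lhd>\<^sub>N\<close> 73) where
  "\<alpha> \<lhd>\<^sub>N F = \<lparr>NDom = NDom \<alpha> \<circ>\<^sub>F F, NCod = NCod \<alpha> \<circ>\<^sub>F F,
     comp_at = (\<lambda>X\<in>Obj (Src F). comp_at \<alpha> (fobj F X))\<rparr>"

definition functor_cat :: "('o1, 'm1) cat \<Rightarrow> ('o2, 'm2) cat
    \<Rightarrow> (('o1, 'm1, 'o2, 'm2) func, ('o1, 'm1, 'o2, 'm2) ntrans) cat" where
  "functor_cat C D = \<lparr>Obj = Fun C D, Arr = (\<Union>F\<in>Fun C D. \<Union>G\<in>Fun C D. Nat F G),
     Dom = NDom, Cod = NCod, Ident = idN, Comp = vcomp\<rparr>"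

text \<open>The functor \<open>[C, p] : [C, E] \<rightarrow> [C, B]\<close>.\<close>

definition postcomp :: "('o, 'm) cat \<Rightarrow> ('oe, 'me, 'ob, 'mb) func
    \<Rightarrow> (('o, 'm, 'oe, 'me) func, ('o, 'm, 'oe, 'me) ntrans,
        ('o, 'm, 'ob, 'mb) func, ('o, 'm, 'ob, 'mb) ntrans) func" where
  "postcomp C p = \<lparr>Src = functor_cat C (Src p), Tgt = functor_cat C (Tgt p),
     fobj = (\<lambda>F\<in>Obj (functor_cat C (Src p)). p \<circ>\<^sub>F F),
     farr = (\<lambda>\<alpha>\<in>Arr (functor_cat C (Src p)). p \<rhd>\<^sub>N \<alpha>)\<rparr>"

section \<open>Fibrations\<close>

definition cartesian :: "('oe, 'me, 'ob, 'mb) func \<Rightarrow> 'me \<Rightarrow> bool" where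
  "cartesian p f \<longleftrightarrow> f \<in> Arr (Src p) \<and>
     (\<forall>g\<in>Arr (Src p). Cod (Src p) g = Cod (Src p) f \<longrightarrow>
       (\<forall>w\<in>Hom (Tgt p) (fobj p (Dom (Src p) g)) (fobj p (Dom (Src p) f)).
          farr p f \<cdot>\<^bsub>Tgt p\<^esub> w = farr p g \<longrightarrow>
          (\<exists>!h. h \<in> Hom (Src p) (Dom (Src p) g) (Dom (Src p) f) \<and>
                farr p h = w \<and> f \<cdot>\<^bsub>Src p\<^esub> h = g)))"

definition cartesian_lifting :: "('oe, 'me, 'ob, 'mb) func \<Rightarrow> 'mb \<Rightarrow> 'oe \<Rightarrow> 'me \<Rightarrow> bool" where
  "cartesian_lifting p v X f \<longleftrightarrow> cartesian p f \<and> Cod (Src p) f = X \<and> farr p f = v"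

definition fibration :: "('oe, 'me) cat \<Rightarrow> ('ob, 'mb) cat \<Rightarrow> ('oe, 'me, 'ob, 'mb) func \<Rightarrow> bool" where
  "fibration E B p \<longleftrightarrow> p \<in> Fun E B \<and>
     (\<forall>X\<in>Obj E. \<forall>I\<in>Obj B. \<forall>v\<in>Hom B I (fobj p X). \<exists>f. cartesian_lifting p v X f)"

section \<open>Monads and Kleisli resolutions\<close>

record ('o, 'm) monad =
  mfun :: "('o, 'm, 'o, 'm) func"
  munit :: "('o, 'm, 'o, 'm) ntrans"
  mmult :: "('o, 'm, 'o, 'm) ntrans"

definition is_monad :: "('o, 'm) cat \<Rightarrow> ('o, 'm) monad \<Rightarrow> bool" where
  "is_monad C T \<longleftrightarrow> mfun T \<in> Fun C C \<and>
     munit T \<in> Nat (IdF C) (mfun T) \<and> mmult T \<in> Nat (mfun T \<circ>\<^sub>F mfun T) (mfun T) \<and>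
     mmult T \<bullet>\<^sub>N (munit T \<lhd>\<^sub>N mfun T) = idN (mfun T) \<and>
     mmult T \<bullet>\<^sub>N (mfun T \<rhd>\<^sub>N munit T) = idN (mfun T) \<and>
     mmult T \<bullet>\<^sub>N (mmult T \<lhd>\<^sub>N mfun T) = mmult T \<bullet>\<^sub>N (mfun T \<rhd>\<^sub>N mmult T)"

abbreviation base :: "('o, 'm) monad \<Rightarrow> ('o, 'm) cat" where
  "base T \<equiv> Src (mfun T)"

text \<open>A Kleisli arrow \<open>X \<rightarrow> Y\<close> is a triple \<open>(X, f, Y)\<close> with \<open>f : X \<rightarrow> T Y\<close>; \<open>f\<close> alone does not
  determine \<open>Y\<close>.\<close>

definition kleisli :: "('o, 'm) monad \<Rightarrow> ('o, 'o \<times> 'm \<times> 'o) cat" where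
  "kleisli T = \<lparr>Obj = Obj (base T),
     Arr = {(X, f, Y). X \<in> Obj (base T) \<and> Y \<in> Obj (base T) \<and>
                       f \<in> Hom (base T) X (fobj (mfun T) Y)},
     Dom = (\<lambda>(X, f, Y). X), Cod = (\<lambda>(X, f, Y). Y),
     Ident = (\<lambda>X. (X, comp_at (munit T) X, X)),
     Comp = (\<lambda>(Y', g, Z) (X, f, Y).
        (X, comp_at (mmult T) Z \<cdot>\<^bsub>base T\<^esub> (farr (mfun T) g \<cdot>\<^bsub>base T\<^esub> f), Z))\<rparr>"

definition kleisliJ :: "('o, 'm) monad \<Rightarrow> ('o, 'm, 'o, 'o \<times> 'm \<times> 'o) func" where
  "kleisliJ T = \<lparr>Src = base T, Tgt = kleisli T,
     fobj = (\<lambda>X\<in>Obj (base T). X),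
     farr = (\<lambda>f\<in>Arr (base T). (Dom (base T) f,
        comp_at (munit T) (Cod (base T) f) \<cdot>\<^bsub>base T\<^esub> f, Cod (base T) f))\<rparr>"

definition kleisliK :: "('o, 'm) monad \<Rightarrow> ('o, 'o \<times> 'm \<times> 'o, 'o, 'm) func" where
  "kleisliK T = \<lparr>Src = kleisli T, Tgt = base T,
     fobj = (\<lambda>X\<in>Obj (kleisli T). fobj (mfun T) X),
     farr = (\<lambda>(X, f, Y)\<in>Arr (kleisli T).
        comp_at (mmult T) Y \<cdot>\<^bsub>base T\<^esub> farr (mfun T) f)\<rparr>"

definition kleisli_counit :: "('o, 'm) monad
    \<Rightarrow> ('o, 'o \<times> 'm \<times> 'o, 'o, 'o \<times> 'm \<times> 'o) ntrans" where
  "kleisli_counit T = \<lparr>NDom = kleisliJ T \<circ>\<^sub>F kleisliK T, NCod = IdF (kleisli T),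
     comp_at = (\<lambda>X\<in>Obj (kleisli T).
        (fobj (mfun T) X, Ident (base T) (fobj (mfun T) X), X))\<rparr>"

text \<open>The canonical extension \<open>p\<^sub>k\<close> of \<open>p\<close> to Kleisli categories, for a lifting \<open>T'\<close> of \<open>T\<close>
  along \<open>p\<close>.\<close>

definition kleisli_ext :: "('oe, 'me, 'ob, 'mb) func \<Rightarrow> ('oe, 'me) monad \<Rightarrow> ('ob, 'mb) monad
    \<Rightarrow> ('oe, 'oe \<times> 'me \<times> 'oe, 'ob, 'ob \<times> 'mb \<times> 'ob) func" where
  "kleisli_ext p T' T = \<lparr>Src = kleisli T', Tgt = kleisli T,
     fobj = (\<lambda>X\<in>Obj (kleisli T'). fobj p X),
     farr = (\<lambda>(X, f, Y)\<in>Arr (kleisli T'). (fobj p X, farr p f, fobj p Y))\<rparr>"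

section \<open>Right Kan extensions\<close>

text \<open>\<open>is_ran K F G c\<close>: \<open>(G, c : G K \<rightarrow> F)\<close> is a right Kan extension of \<open>F\<close> along \<open>K\<close>.\<close>

definition is_ran :: "('o1, 'm1, 'o2, 'm2) func \<Rightarrow> ('o1, 'm1, 'o3, 'm3) func
    \<Rightarrow> ('o2, 'm2, 'o3, 'm3) func \<Rightarrow> ('o1, 'm1, 'o3, 'm3) ntrans \<Rightarrow> bool" where
  "is_ran K F G c \<longleftrightarrow> G \<in> Fun (Tgt K) (Tgt F) \<and> c \<in> Nat (G \<circ>\<^sub>F K) F \<and>
     (\<forall>H\<in>Fun (Tgt K) (Tgt F). \<forall>\<beta>\<in>Nat (H \<circ>\<^sub>F K) F.
        \<exists>!\<gamma>. \<gamma> \<in> Nat H G \<and> c \<bullet>\<^sub>N (\<gamma> \<lhd>\<^sub>N K) = \<beta>)"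

definition ran_transpose :: "('o1, 'm1, 'o2, 'm2) func \<Rightarrow> ('o2, 'm2, 'o3, 'm3) func
    \<Rightarrow> ('o1, 'm1, 'o3, 'm3) ntrans \<Rightarrow> ('o2, 'm2, 'o3, 'm3) func
    \<Rightarrow> ('o1, 'm1, 'o3, 'm3) ntrans \<Rightarrow> ('o2, 'm2, 'o3, 'm3) ntrans" where
  "ran_transpose K G c H \<beta> = (THE \<gamma>. \<gamma> \<in> Nat H G \<and> c \<bullet>\<^sub>N (\<gamma> \<lhd>\<^sub>N K) = \<beta>)"

section \<open>Codensity lifting\<close>

definition lifting_parameter :: "('oa, 'ma) cat \<Rightarrow> ('oe, 'me) cat \<Rightarrow> ('oe, 'me, 'ob, 'mb) func
    \<Rightarrow> ('ob, 'mb) monad \<Rightarrow> ('oa, 'ma, 'ob, 'ob \<times> 'mb \<times> 'ob) func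
    \<Rightarrow> ('oa, 'ma, 'oe, 'me) func \<Rightarrow> bool" where
  "lifting_parameter A E p T R S \<longleftrightarrow>
     R \<in> Fun A (kleisli T) \<and> S \<in> Fun A E \<and> kleisliK T \<circ>\<^sub>F R = p \<circ>\<^sub>F S"

text \<open>In the following, \<open>(G, c)\<close> plays the role of \<open>(Ran\<^sub>S S, c)\<close>.\<close>

definition codensity_condition :: "('oe, 'me, 'ob, 'mb) func \<Rightarrow> ('oa, 'ma, 'oe, 'me) func
    \<Rightarrow> ('oe, 'me, 'oe, 'me) func \<Rightarrow> ('oa, 'ma, 'oe, 'me) ntrans \<Rightarrow> bool" where
  "codensity_condition p S G c \<longleftrightarrow>
     is_ran S S G c \<and> is_ran S (p \<circ>\<^sub>F S) (p \<circ>\<^sub>F G) (p \<rhd>\<^sub>N c)"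

definition codensity_unit :: "('oa, 'ma, 'oe, 'me) func \<Rightarrow> ('oe, 'me, 'oe, 'me) func
    \<Rightarrow> ('oa, 'ma, 'oe, 'me) ntrans \<Rightarrow> ('oe, 'me, 'oe, 'me) ntrans" where
  "codensity_unit S G c = ran_transpose S G c (IdF (Tgt S)) (idN S)"

definition codensity_mult :: "('oa, 'ma, 'oe, 'me) func \<Rightarrow> ('oe, 'me, 'oe, 'me) func
    \<Rightarrow> ('oa, 'ma, 'oe, 'me) ntrans \<Rightarrow> ('oe, 'me, 'oe, 'me) ntrans" where
  "codensity_mult S G c = ran_transpose S G c (G \<circ>\<^sub>F G) (c \<bullet>\<^sub>N (G \<rhd>\<^sub>N c))"

text \<open>\<open>\<sigma>\<close> (whose domain is the endofunctor \<open>T\<^sup>\<top>\<^sup>\<top>\<close>) is a cartesian lifting of the transpose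
  \<open>T p \<rightarrow> p Ran\<^sub>S S\<close> of \<open>K \<epsilon> R\<close>.\<close>

definition codensity_cartesian :: "('oe, 'me, 'ob, 'mb) func \<Rightarrow> ('ob, 'mb) monad
    \<Rightarrow> ('oa, 'ma, 'ob, 'ob \<times> 'mb \<times> 'ob) func \<Rightarrow> ('oa, 'ma, 'oe, 'me) func
    \<Rightarrow> ('oe, 'me, 'oe, 'me) func \<Rightarrow> ('oa, 'ma, 'oe, 'me) ntrans
    \<Rightarrow> ('oe, 'me, 'oe, 'me) ntrans \<Rightarrow> bool" where
  "codensity_cartesian p T R S G c \<sigma> \<longleftrightarrow>
     cartesian_lifting (postcomp (Src p) p)
       (ran_transpose S (p \<circ>\<^sub>F G) (p \<rhd>\<^sub>N c) (mfun T \<circ>\<^sub>F p)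
          (kleisliK T \<rhd>\<^sub>N (kleisli_counit T \<lhd>\<^sub>N R)))
       G \<sigma>"

definition codensity_lifting :: "('oe, 'me, 'ob, 'mb) func \<Rightarrow> ('ob, 'mb) monad
    \<Rightarrow> ('oa, 'ma, 'oe, 'me) func \<Rightarrow> ('oe, 'me, 'oe, 'me) func
    \<Rightarrow> ('oa, 'ma, 'oe, 'me) ntrans \<Rightarrow> ('oe, 'me, 'oe, 'me) ntrans \<Rightarrow> ('oe, 'me) monad" where
  "codensity_lifting p T S G c \<sigma> = (let T' = NDom \<sigma> in
     \<lparr>mfun = T',
      munit = (THE \<eta>'. \<eta>' \<in> Nat (IdF (Src p)) T' \<and>
         p \<rhd>\<^sub>N \<eta>' = munit T \<lhd>\<^sub>N p \<and> \<sigma> \<bullet>\<^sub>N \<eta>' = codensity_unit S G c),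
      mmult = (THE \<mu>'. \<mu>' \<in> Nat (T' \<circ>\<^sub>F T') T' \<and>
         p \<rhd>\<^sub>N \<mu>' = mmult T \<lhd>\<^sub>N p \<and>
         \<sigma> \<bullet>\<^sub>N \<mu>' = codensity_mult S G c \<bullet>\<^sub>N (\<sigma> \<lhd>\<^sub>N G) \<bullet>\<^sub>N (T' \<rhd>\<^sub>N \<sigma>))\<rparr>)"

section \<open>Powers and algebraic operations\<close>

definition is_power :: "('o, 'm) cat \<Rightarrow> 'i set \<Rightarrow> 'o \<Rightarrow> 'o \<Rightarrow> ('i \<Rightarrow> 'm) \<Rightarrow> bool" where
  "is_power C A X P \<pi> \<longleftrightarrow> P \<in> Obj C \<and> (\<forall>a\<in>A. \<pi> a \<in> Hom C P X) \<and>
     (\<forall>Y\<in>Obj C. \<forall>f\<in>A \<rightarrow> Hom C Y X. \<exists>!h. h \<in> Hom C Y P \<and> (\<forall>a\<in>A. \<pi> a \<cdot>\<^bsub>C\<^esub> h = f a))"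

record ('o, 'i, 'm) powers =
  pobj :: "'o \<Rightarrow> 'o"
  pproj :: "'o \<Rightarrow> 'i \<Rightarrow> 'm"

definition has_powers :: "('o, 'm) cat \<Rightarrow> 'i set \<Rightarrow> ('o, 'i, 'm) powers \<Rightarrow> bool" where
  "has_powers C A P \<longleftrightarrow> (\<forall>X\<in>Obj C. is_power C A X (pobj P X) (pproj P X))"

definition preserves_powers :: "('o1, 'm1, 'o2, 'm2) func \<Rightarrow> 'i set \<Rightarrow> bool" where
  "preserves_powers F A \<longleftrightarrow> (\<forall>X\<in>Obj (Src F). \<forall>P \<pi>. is_power (Src F) A X P \<pi> \<longrightarrow>
     is_power (Tgt F) A (fobj F X) (fobj F P) (\<lambda>a. farr F (\<pi> a)))"

definition ptuple :: "('o, 'm) cat \<Rightarrow> 'i set \<Rightarrow> ('o, 'i, 'm) powers \<Rightarrow> 'o \<Rightarrow> 'o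
    \<Rightarrow> ('i \<Rightarrow> 'm) \<Rightarrow> 'm" where
  "ptuple C A P Y X f = (THE h. h \<in> Hom C Y (pobj P X) \<and> (\<forall>a\<in>A. pproj P X a \<cdot>\<^bsub>C\<^esub> h = f a))"

definition power_functor :: "('o, 'm) cat \<Rightarrow> 'i set \<Rightarrow> ('o, 'i, 'm) powers
    \<Rightarrow> ('o, 'm, 'o, 'm) func" where
  "power_functor C A P = \<lparr>Src = C, Tgt = C,
     fobj = (\<lambda>X\<in>Obj C. pobj P X),
     farr = (\<lambda>f\<in>Arr C. ptuple C A P (pobj P (Dom C f)) (Cod C f)
                         (\<lambda>a. f \<cdot>\<^bsub>C\<^esub> pproj P (Dom C f) a))\<rparr>"

definition fpower :: "'i set \<Rightarrow> ('o2, 'i, 'm2) powers \<Rightarrow> ('o1, 'm1, 'o2, 'm2) func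
    \<Rightarrow> ('o1, 'm1, 'o2, 'm2) func" where
  "fpower A P F = power_functor (Tgt F) A P \<circ>\<^sub>F F"

text \<open>Write \<open>A \<pitchfork> F\<close> for the pointwise power \<open>fpower A P F\<close>.  The canonical comparison \<open>\<kappa> : p (A \<pitchfork> Id) \<rightarrow> (A \<pitchfork> Id) p\<close>, with components
  \<open>p (A \<pitchfork> X) \<rightarrow> A \<pitchfork> p X\<close>.  It is invertible when \<open>p\<close> preserves powers, and the identity when \<open>p\<close>
  preserves the chosen powers on the nose.  It is written out wherever \<open>p (A \<pitchfork> X)\<close> and
  \<open>A \<pitchfork> p X\<close> are tacitly identified in informal notation.\<close>

definition power_comparison :: "('oe, 'me, 'ob, 'mb) func \<Rightarrow> 'i set \<Rightarrow> ('oe, 'i, 'me) powers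
    \<Rightarrow> ('ob, 'i, 'mb) powers \<Rightarrow> ('oe, 'me, 'ob, 'mb) ntrans" where
  "power_comparison p A PE PB = \<lparr>
     NDom = p \<circ>\<^sub>F fpower A PE (IdF (Src p)), NCod = fpower A PB (IdF (Tgt p)) \<circ>\<^sub>F p,
     comp_at = (\<lambda>X\<in>Obj (Src p). ptuple (Tgt p) A PB (fobj p (pobj PE X)) (fobj p X)
        (\<lambda>a. farr p (pproj PE X a)))\<rparr>"

definition Alg :: "('o, 'm) monad \<Rightarrow> 'i set \<Rightarrow> ('o, 'i, 'm) powers
    \<Rightarrow> ('o, 'o \<times> 'm \<times> 'o, 'o, 'm) ntrans set" where
  "Alg T A P = Nat (fpower A P (kleisliK T)) (kleisliK T)"

text \<open>Liftings of \<open>\<alpha> \<in> Alg T A PB\<close> to a lifting \<open>T'\<close> of \<open>T\<close> along \<open>p\<close>: up to \<open>\<kappa>\<close>, the condition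
  reads \<open>p \<alpha>' = \<alpha> p\<^sub>k\<close>.\<close>

definition Alg_over :: "('oe, 'me, 'ob, 'mb) func \<Rightarrow> ('ob, 'mb) monad \<Rightarrow> 'i set
    \<Rightarrow> ('oe, 'i, 'me) powers \<Rightarrow> ('ob, 'i, 'mb) powers
    \<Rightarrow> ('ob, 'ob \<times> 'mb \<times> 'ob, 'ob, 'mb) ntrans \<Rightarrow> ('oe, 'me) monad
    \<Rightarrow> ('oe, 'oe \<times> 'me \<times> 'oe, 'oe, 'me) ntrans set" where
  "Alg_over p T A PE PB \<alpha> T' = {\<alpha>' \<in> Alg T' A PE.
     p \<rhd>\<^sub>N \<alpha>' = (\<alpha> \<lhd>\<^sub>N kleisli_ext p T' T) \<bullet>\<^sub>N (power_comparison p A PE PB \<lhd>\<^sub>N kleisliK T')}"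

text \<open>The set of \<open>\<alpha>\<^sub>0 : A \<pitchfork> S \<rightarrow> S\<close> with \<open>p \<alpha>\<^sub>0 = \<alpha> R\<close> up to \<open>\<kappa>\<close>.\<close>

definition Nat_over :: "('oe, 'me, 'ob, 'mb) func \<Rightarrow> 'i set
    \<Rightarrow> ('oe, 'i, 'me) powers \<Rightarrow> ('ob, 'i, 'mb) powers
    \<Rightarrow> ('ob, 'ob \<times> 'mb \<times> 'ob, 'ob, 'mb) ntrans
    \<Rightarrow> ('oa, 'ma, 'ob, 'ob \<times> 'mb \<times> 'ob) func \<Rightarrow> ('oa, 'ma, 'oe, 'me) func
    \<Rightarrow> ('oa, 'ma, 'oe, 'me) ntrans set" where
  "Nat_over p A PE PB \<alpha> R S = {\<alpha>\<^sub>0 \<in> Nat (fpower A PE S) S.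
     p \<rhd>\<^sub>N \<alpha>\<^sub>0 = (\<alpha> \<lhd>\<^sub>N R) \<bullet>\<^sub>N (power_comparison p A PE PB \<lhd>\<^sub>N S)}"

text \<open>The natural transformation \<open>\<beta> : A \<pitchfork> Id \<rightarrow> T\<^sup>\<top>\<^sup>\<top>\<close> above \<open>\<alpha> J p \<bullet> A \<pitchfork> \<eta> p\<close> (precomposed with
  \<open>\<kappa>\<close>) such that \<open>\<sigma> \<bullet> \<beta>\<close> is the transpose of \<open>\<alpha>\<^sub>0\<close>.\<close>

definition phi_beta :: "('oe, 'me, 'ob, 'mb) func \<Rightarrow> ('ob, 'mb) monad
    \<Rightarrow> ('oa, 'ma, 'oe, 'me) func \<Rightarrow> ('oe, 'me, 'oe, 'me) func
    \<Rightarrow> ('oa, 'ma, 'oe, 'me) ntrans \<Rightarrow> ('oe, 'me, 'oe, 'me) ntrans \<Rightarrow> 'i set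
    \<Rightarrow> ('oe, 'i, 'me) powers \<Rightarrow> ('ob, 'i, 'mb) powers
    \<Rightarrow> ('ob, 'ob \<times> 'mb \<times> 'ob, 'ob, 'mb) ntrans
    \<Rightarrow> ('oa, 'ma, 'oe, 'me) ntrans \<Rightarrow> ('oe, 'me, 'oe, 'me) ntrans" where
  "phi_beta p T S G c \<sigma> A PE PB \<alpha> \<alpha>\<^sub>0 = (let AId = fpower A PE (IdF (Src p)) in
     THE \<beta>. \<beta> \<in> Nat AId (NDom \<sigma>) \<and>
       p \<rhd>\<^sub>N \<beta> = (\<alpha> \<lhd>\<^sub>N (kleisliJ T \<circ>\<^sub>F p))
              \<bullet>\<^sub>N (power_functor (Tgt p) A PB \<rhd>\<^sub>N (munit T \<lhd>\<^sub>N p))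
              \<bullet>\<^sub>N power_comparison p A PE PB \<and>
       \<sigma> \<bullet>\<^sub>N \<beta> = ran_transpose S G c AId \<alpha>\<^sub>0)"

definition phi :: "('oe, 'me, 'ob, 'mb) func \<Rightarrow> ('ob, 'mb) monad
    \<Rightarrow> ('oa, 'ma, 'oe, 'me) func \<Rightarrow> ('oe, 'me, 'oe, 'me) func
    \<Rightarrow> ('oa, 'ma, 'oe, 'me) ntrans \<Rightarrow> ('oe, 'me, 'oe, 'me) ntrans \<Rightarrow> 'i set
    \<Rightarrow> ('oe, 'i, 'me) powers \<Rightarrow> ('ob, 'i, 'mb) powers
    \<Rightarrow> ('ob, 'ob \<times> 'mb \<times> 'ob, 'ob, 'mb) ntrans
    \<Rightarrow> ('oa, 'ma, 'oe, 'me) ntrans \<Rightarrow> ('oe, 'oe \<times> 'me \<times> 'oe, 'oe, 'me) ntrans" where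
  "phi p T S G c \<sigma> A PE PB \<alpha> \<alpha>\<^sub>0 = (let T' = codensity_lifting p T S G c \<sigma> in
     (kleisliK T' \<rhd>\<^sub>N kleisli_counit T') \<bullet>\<^sub>N
     (phi_beta p T S G c \<sigma> A PE PB \<alpha> \<alpha>\<^sub>0 \<lhd>\<^sub>N kleisliK T'))"

end

theory Submission
  imports Defs
begin

text \<open>The map \<open>\<phi>\<close> is a composite of two bijections.  First, universality of \<open>Ran\<^sub>S S\<close> turns
  \<open>\<alpha>\<^sub>0 : A \<pitchfork> S \<rightarrow> S\<close> into a transformation \<open>A \<pitchfork> Id \<rightarrow> Ran\<^sub>S S\<close>, which factors uniquely through the
  cartesian \<open>\<sigma>\<close> over the prescribed transformation below; preservation of the Kan extension by \<open>p\<close>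
  makes the condition \<open>p \<alpha>\<^sub>0 = \<alpha> R\<close> equivalent to the factorisation condition in the base.
  Secondly, algebraic operations of a monad \<open>T'\<close> correspond to their generic effects
  \<open>A \<pitchfork> Id \<rightarrow> T'\<close>, compatibly with \<open>p\<close> since the comparison \<open>\<kappa>\<close> is natural.  That \<open>T\<^sup>\<top>\<^sup>\<top>\<close> is a
  monad follows from the laws of \<open>T\<close> and of the codensity monad, because a transformation into
  \<open>T\<^sup>\<top>\<^sup>\<top>\<close> is determined by its image under \<open>p\<close> together with its composite with \<open>\<sigma>\<close>.\<close>

section \<open>Functors and natural transformations\<close>

text \<open>The arrow \<sigma> is cartesian over a functor category, so lifting a transformation
  along it requires an equation between transformations into \<open>p Ran\<close> at every object of
  \<open>E\<close>, whereas the lifting parameter gives information only at objects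
  \<open>S a\<close>. Preservation of the Kan extension closes this gap: transformations into
  \<open>p Ran\<close> may be compared at \<open>S a\<close> after composition with
  \<open>p c\<close>. There the arrow \<tau> underlying \<sigma> becomes \<open>\<mu> (R a)\<close>,
  because \<tau> transposes \<open>K \<epsilon> R\<close>, and the object \<open>p (S a)\<close> is
  \<open>T (R a)\<close>, because \<open>K R = p S\<close>. Computations below \<sigma> thereby turn
  into calculations with the monad laws of \<open>T\<close>. For operations the decisive law is
  \<open>\<mu> X \<cdot> \<alpha> (T X) \<cdot> W (\<eta> (T X)) = \<alpha> X\<close>, with
  \<open>W\<close> the power functor: at \<open>X = R a\<close> it recovers the condition on
  \<open>\<alpha>\<^sub>0\<close>, at \<open>X = p Y\<close> the condition on an operation over
  \<alpha>. The powers in \<open>E\<close> and \<open>B\<close> are chosen independently, so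
  \<kappa> stands at the right end of the equations in \<open>B\<close> and is moved past arrows by
  naturality.\<close>

lemma HomI: "f \<in> Arr C \<Longrightarrow> Dom C f = X \<Longrightarrow> Cod C f = Y \<Longrightarrow> f \<in> Hom C X Y"
  by (simp add: Hom_def)

lemma HomD:
  assumes "f \<in> Hom C X Y"
  shows "f \<in> Arr C" "Dom C f = X" "Cod C f = Y"
  using assms by (auto simp: Hom_def)

context category
begin

text \<open>Composability is expressed by \<open>Dom\<close> and \<open>Cod\<close> instead of
  \<open>Hom\<close>, so that the side conditions of associativity and naturality are equations
  between objects that the simplifier can discharge.\<close>

lemma comp_props:
  assumes "f \<in> Arr C" "g \<in> Arr C" "Cod C f = Dom C g"
  shows comp_arr [simp]: "g \<cdot>\<^bsub>C\<^esub> f \<in> Arr C"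
    and dom_comp [simp]: "Dom C (g \<cdot>\<^bsub>C\<^esub> f) = Dom C f"
    and cod_comp [simp]: "Cod C (g \<cdot>\<^bsub>C\<^esub> f) = Cod C g"
  using Comp_Hom[of f "Dom C f" "Dom C g" g "Cod C g"] assms by (auto simp: Hom_def)

lemma ident_props [simp]:
  assumes "X \<in> Obj C"
  shows "Ident C X \<in> Arr C" "Dom C (Ident C X) = X" "Cod C (Ident C X) = X"
  using Ident_Hom[OF assms] by (auto simp: Hom_def)

lemma comp_ident [simp]:
  assumes "f \<in> Arr C"
  shows "Cod C f = Y \<Longrightarrow> Ident C Y \<cdot>\<^bsub>C\<^esub> f = f" "Dom C f = X \<Longrightarrow> f \<cdot>\<^bsub>C\<^esub> Ident C X = f"
  using assms Comp_Ident_left Comp_Ident_right by (auto simp: Hom_def)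

text \<open>Oriented to the right. Later calculations bracket a composite by hand where a law is to
  fire, and rely on this rule to identify the bracketings.\<close>

lemma assoc [simp]:
  assumes "f \<in> Arr C" "g \<in> Arr C" "h \<in> Arr C" "Cod C f = Dom C g" "Cod C g = Dom C h"
  shows "(h \<cdot>\<^bsub>C\<^esub> g) \<cdot>\<^bsub>C\<^esub> f = h \<cdot>\<^bsub>C\<^esub> (g \<cdot>\<^bsub>C\<^esub> f)"
  using Comp_assoc[of f "Dom C f" "Dom C g" g "Dom C h" h "Cod C h"] assms by (auto simp: Hom_def)

declare Dom_Obj [simp] Cod_Obj [simp]

end

lemma FunD:
  assumes "F \<in> Fun C D"
  shows Fun_Src: "Src F = C" and Fun_Tgt: "Tgt F = D"
    and Fun_fobj_ext: "fobj F \<in> extensional (Obj C)"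
    and Fun_farr_ext: "farr F \<in> extensional (Arr C)"
    and Fun_fobj: "X \<in> Obj C \<Longrightarrow> fobj F X \<in> Obj D"
    and Fun_arr: "f \<in> Arr C \<Longrightarrow> farr F f \<in> Arr D"
    and Fun_dom: "f \<in> Arr C \<Longrightarrow> Dom D (farr F f) = fobj F (Dom C f)"
    and Fun_cod: "f \<in> Arr C \<Longrightarrow> Cod D (farr F f) = fobj F (Cod C f)"
    and Fun_ident: "X \<in> Obj C \<Longrightarrow> farr F (Ident C X) = Ident D (fobj F X)"
    and Fun_comp: "f \<in> Arr C \<Longrightarrow> g \<in> Arr C \<Longrightarrow> Cod C f = Dom C g \<Longrightarrow>
      farr F (g \<cdot>\<^bsub>C\<^esub> f) = farr F g \<cdot>\<^bsub>D\<^esub> farr F f"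
  using assms by (auto simp: Fun_def Hom_def)

lemmas FunD_simps = Fun_Src Fun_Tgt Fun_fobj Fun_arr Fun_dom Fun_cod Fun_ident Fun_comp

lemma FunI:
  assumes "Src F = C" "Tgt F = D"
    "fobj F \<in> extensional (Obj C)" "farr F \<in> extensional (Arr C)"
    "\<And>X. X \<in> Obj C \<Longrightarrow> fobj F X \<in> Obj D"
    "\<And>f. f \<in> Arr C \<Longrightarrow> farr F f \<in> Arr D"
    "\<And>f. f \<in> Arr C \<Longrightarrow> Dom D (farr F f) = fobj F (Dom C f)"
    "\<And>f. f \<in> Arr C \<Longrightarrow> Cod D (farr F f) = fobj F (Cod C f)"
    "\<And>X. X \<in> Obj C \<Longrightarrow> farr F (Ident C X) = Ident D (fobj F X)"
    "\<And>f g. f \<in> Arr C \<Longrightarrow> g \<in> Arr C \<Longrightarrow> Cod C f = Dom C g \<Longrightarrow>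
      farr F (g \<cdot>\<^bsub>C\<^esub> f) = farr F g \<cdot>\<^bsub>D\<^esub> farr F f"
  shows "F \<in> Fun C D"
  using assms by (auto simp: Fun_def Hom_def)

lemma Fun_eqI:
  assumes "F \<in> Fun C D" "F' \<in> Fun C D"
    and "\<And>X. X \<in> Obj C \<Longrightarrow> fobj F X = fobj F' X"
    and "\<And>f. f \<in> Arr C \<Longrightarrow> farr F f = farr F' f"
  shows "F = F'"
proof (rule func.equality)
  show "fobj F = fobj F'"
    by (rule extensionalityI[OF Fun_fobj_ext[OF assms(1)] Fun_fobj_ext[OF assms(2)] assms(3)])
  show "farr F = farr F'"
    by (rule extensionalityI[OF Fun_farr_ext[OF assms(1)] Fun_farr_ext[OF assms(2)] assms(4)])
qed (use assms(1,2) in \<open>auto simp: FunD_simps\<close>)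

lemma compF_sel [simp]:
  "Src (G \<circ>\<^sub>F F) = Src F" "Tgt (G \<circ>\<^sub>F F) = Tgt G"
  "X \<in> Obj (Src F) \<Longrightarrow> fobj (G \<circ>\<^sub>F F) X = fobj G (fobj F X)"
  "f \<in> Arr (Src F) \<Longrightarrow> farr (G \<circ>\<^sub>F F) f = farr G (farr F f)"
  by (auto simp: compF_def)

lemma compF_Fun:
  assumes "category C" "F \<in> Fun C D" "G \<in> Fun D E"
  shows "G \<circ>\<^sub>F F \<in> Fun C E"
proof -
  interpret category C by fact
  show ?thesis
    by (rule FunI)
      (auto simp: compF_def FunD_simps[OF assms(2)] FunD_simps[OF assms(3)])
qed

lemma IdF_sel [simp]:
  "Src (IdF C) = C" "Tgt (IdF C) = C"
  "X \<in> Obj C \<Longrightarrow> fobj (IdF C) X = X" "f \<in> Arr C \<Longrightarrow> farr (IdF C) f = f"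
  by (auto simp: IdF_def)

lemma IdF_Fun: "category C \<Longrightarrow> IdF C \<in> Fun C C"
  by (rule FunI) (auto simp: IdF_def category.ident_props category.comp_props category.Dom_Obj
      category.Cod_Obj)

lemma compF_IdF: "F \<in> Fun C D \<Longrightarrow> F \<circ>\<^sub>F IdF C = F"
  by (rule func.equality)
    (auto simp: compF_def IdF_def FunD_simps intro!: extensionalityI[OF _ Fun_fobj_ext]
      extensionalityI[OF _ Fun_farr_ext])

lemma IdF_compF: "F \<in> Fun C D \<Longrightarrow> IdF D \<circ>\<^sub>F F = F"
  by (rule func.equality)
    (auto simp: compF_def IdF_def FunD_simps intro!: extensionalityI[OF _ Fun_fobj_ext]
      extensionalityI[OF _ Fun_farr_ext])

text \<open>The inner restriction is invisible because \<open>F\<close> lands in the source of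
  \<open>G\<close>. Nothing is evaluated in \<open>H\<close>, which stays arbitrary.\<close>

lemma compF_assoc:
  assumes "F \<in> Fun C D" "G \<in> Fun D E"
  shows "(H \<circ>\<^sub>F G) \<circ>\<^sub>F F = H \<circ>\<^sub>F (G \<circ>\<^sub>F F)"
  by (rule func.equality)
    (auto simp: compF_def FunD_simps[OF assms(1)] FunD_simps[OF assms(2)] intro!: restrict_ext)

lemma NatD:
  assumes "\<alpha> \<in> Nat F G" "F \<in> Fun C D"
  shows Nat_NDom: "NDom \<alpha> = F" and Nat_NCod: "NCod \<alpha> = G"
    and Nat_Tgt_Fun: "G \<in> Fun C D"
    and Nat_ext: "comp_at \<alpha> \<in> extensional (Obj C)"
    and Nat_arr: "X \<in> Obj C \<Longrightarrow> comp_at \<alpha> X \<in> Arr D"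
    and Nat_dom: "X \<in> Obj C \<Longrightarrow> Dom D (comp_at \<alpha> X) = fobj F X"
    and Nat_cod: "X \<in> Obj C \<Longrightarrow> Cod D (comp_at \<alpha> X) = fobj G X"
    and Nat_natural: "f \<in> Arr C \<Longrightarrow>
      farr G f \<cdot>\<^bsub>D\<^esub> comp_at \<alpha> (Dom C f) = comp_at \<alpha> (Cod C f) \<cdot>\<^bsub>D\<^esub> farr F f"
  using assms FunD(1,2)[OF assms(2)] by (auto simp: Nat_def Hom_def)

lemmas NatD_simps = Nat_NDom Nat_NCod Nat_arr Nat_dom Nat_cod

lemma NatI:
  assumes "NDom \<alpha> = F" "NCod \<alpha> = G" "F \<in> Fun C D" "G \<in> Fun C D"
    "comp_at \<alpha> \<in> extensional (Obj C)"
    "\<And>X. X \<in> Obj C \<Longrightarrow> comp_at \<alpha> X \<in> Arr D"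
    "\<And>X. X \<in> Obj C \<Longrightarrow> Dom D (comp_at \<alpha> X) = fobj F X"
    "\<And>X. X \<in> Obj C \<Longrightarrow> Cod D (comp_at \<alpha> X) = fobj G X"
    "\<And>f. f \<in> Arr C \<Longrightarrow>
      farr G f \<cdot>\<^bsub>D\<^esub> comp_at \<alpha> (Dom C f) = comp_at \<alpha> (Cod C f) \<cdot>\<^bsub>D\<^esub> farr F f"
  shows "\<alpha> \<in> Nat F G"
  using assms FunD(1,2)[OF assms(3)] by (auto simp: Nat_def Hom_def)

lemma Nat_eqI:
  assumes "\<alpha> \<in> Nat F G" "\<alpha>' \<in> Nat F G" "F \<in> Fun C D"
    and "\<And>X. X \<in> Obj C \<Longrightarrow> comp_at \<alpha> X = comp_at \<alpha>' X"
  shows "\<alpha> = \<alpha>'"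
proof (rule ntrans.equality)
  show "comp_at \<alpha> = comp_at \<alpha>'"
    by (rule extensionalityI[OF Nat_ext[OF assms(1,3)] Nat_ext[OF assms(2,3)] assms(4)])
qed (use NatD[OF assms(1,3)] NatD[OF assms(2,3)] in auto)

lemma ntrans_sel [simp]:
  "NDom (\<beta> \<bullet>\<^sub>N \<alpha>) = NDom \<alpha>" "NCod (\<beta> \<bullet>\<^sub>N \<alpha>) = NCod \<beta>"
  "NDom (F \<rhd>\<^sub>N \<alpha>) = F \<circ>\<^sub>F NDom \<alpha>" "NCod (F \<rhd>\<^sub>N \<alpha>) = F \<circ>\<^sub>F NCod \<alpha>"
  "NDom (\<alpha> \<lhd>\<^sub>N H) = NDom \<alpha> \<circ>\<^sub>F H" "NCod (\<alpha> \<lhd>\<^sub>N H) = NCod \<alpha> \<circ>\<^sub>F H"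
  "NDom (idN H) = H" "NCod (idN H) = H"
  by (auto simp: vcomp_def whiskerL_def whiskerR_def idN_def)

lemma ntrans_ext:
  "comp_at (\<beta> \<bullet>\<^sub>N \<alpha>) \<in> extensional (Obj (Src (NDom \<alpha>)))"
  "comp_at (F \<rhd>\<^sub>N \<alpha>) \<in> extensional (Obj (Src (NDom \<alpha>)))"
  "comp_at (\<alpha> \<lhd>\<^sub>N H) \<in> extensional (Obj (Src H))"
  "comp_at (idN H) \<in> extensional (Obj (Src H))"
  by (auto simp: vcomp_def whiskerL_def whiskerR_def idN_def)

lemma comp_at_vcomp [simp]:
  "X \<in> Obj (Src (NDom \<alpha>)) \<Longrightarrow>
    comp_at (\<beta> \<bullet>\<^sub>N \<alpha>) X = comp_at \<beta> X \<cdot>\<^bsub>Tgt (NDom \<alpha>)\<^esub> comp_at \<alpha> X"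
  by (simp add: vcomp_def)

lemma comp_at_whiskerL [simp]:
  "X \<in> Obj (Src (NDom \<alpha>)) \<Longrightarrow> comp_at (F \<rhd>\<^sub>N \<alpha>) X = farr F (comp_at \<alpha> X)"
  by (simp add: whiskerL_def)

lemma comp_at_whiskerR [simp]:
  "X \<in> Obj (Src F) \<Longrightarrow> comp_at (\<alpha> \<lhd>\<^sub>N F) X = comp_at \<alpha> (fobj F X)"
  by (simp add: whiskerR_def)

lemma comp_at_idN [simp]:
  "X \<in> Obj (Src F) \<Longrightarrow> comp_at (idN F) X = Ident (Tgt F) (fobj F X)"
  by (simp add: idN_def)

lemma idN_Nat:
  assumes "category C" "category D" "F \<in> Fun C D"
  shows "idN F \<in> Nat F F"
proof -
  interpret C: category C by fact
  interpret D: category D by fact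
  show ?thesis
    by (rule NatI[OF _ _ assms(3,3)]) (auto simp: FunD_simps[OF assms(3)] idN_def)
qed

lemma vcomp_Nat:
  assumes "category C" "category D" "F \<in> Fun C D" "\<alpha> \<in> Nat F G" "\<beta> \<in> Nat G H"
  shows "\<beta> \<bullet>\<^sub>N \<alpha> \<in> Nat F H"
proof -
  interpret C: category C by fact
  interpret D: category D by fact
  note G = Nat_Tgt_Fun[OF assms(4,3)]
  note H = Nat_Tgt_Fun[OF assms(5) G]
  note [simp] = FunD_simps[OF assms(3)] FunD_simps[OF G] FunD_simps[OF H]
     NatD_simps[OF assms(4,3)] NatD_simps[OF assms(5) G]
  show ?thesis
  proof (rule NatI[OF _ _ assms(3) H])
    show "comp_at (\<beta> \<bullet>\<^sub>N \<alpha>) \<in> extensional (Obj C)"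
      using ntrans_ext(1)[of \<beta> \<alpha>] by simp
    fix f assume f: "f \<in> Arr C"
    have "farr H f \<cdot>\<^bsub>D\<^esub> (comp_at \<beta> (Dom C f) \<cdot>\<^bsub>D\<^esub> comp_at \<alpha> (Dom C f))
        = (farr H f \<cdot>\<^bsub>D\<^esub> comp_at \<beta> (Dom C f)) \<cdot>\<^bsub>D\<^esub> comp_at \<alpha> (Dom C f)"
      using f by simp
    also have "\<dots> = comp_at \<beta> (Cod C f) \<cdot>\<^bsub>D\<^esub> (farr G f \<cdot>\<^bsub>D\<^esub> comp_at \<alpha> (Dom C f))"
      using f by (simp add: Nat_natural[OF assms(5) G])
    also have "\<dots> = (comp_at \<beta> (Cod C f) \<cdot>\<^bsub>D\<^esub> comp_at \<alpha> (Cod C f)) \<cdot>\<^bsub>D\<^esub> farr F f"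
      using f by (simp add: Nat_natural[OF assms(4,3)])
    finally show "farr H f \<cdot>\<^bsub>D\<^esub> comp_at (\<beta> \<bullet>\<^sub>N \<alpha>) (Dom C f)
        = comp_at (\<beta> \<bullet>\<^sub>N \<alpha>) (Cod C f) \<cdot>\<^bsub>D\<^esub> farr F f"
      using f by simp
  qed auto
qed

lemma whiskerL_Nat:
  assumes "category C" "F \<in> Fun C D" "\<alpha> \<in> Nat F G" "H \<in> Fun D E"
  shows "H \<rhd>\<^sub>N \<alpha> \<in> Nat (H \<circ>\<^sub>F F) (H \<circ>\<^sub>F G)"
proof -
  interpret C: category C by fact
  note G = Nat_Tgt_Fun[OF assms(3,2)]
  note [simp] = FunD_simps[OF assms(2)] FunD_simps[OF G] FunD_simps[OF assms(4)]
     NatD_simps[OF assms(3,2)]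
  show ?thesis
  proof (rule NatI[OF _ _ compF_Fun[OF assms(1,2,4)] compF_Fun[OF assms(1) G assms(4)]])
    show "comp_at (H \<rhd>\<^sub>N \<alpha>) \<in> extensional (Obj C)"
      using ntrans_ext(2)[of H \<alpha>] by simp
    fix f assume f: "f \<in> Arr C"
    show "farr (H \<circ>\<^sub>F G) f \<cdot>\<^bsub>E\<^esub> comp_at (H \<rhd>\<^sub>N \<alpha>) (Dom C f)
        = comp_at (H \<rhd>\<^sub>N \<alpha>) (Cod C f) \<cdot>\<^bsub>E\<^esub> farr (H \<circ>\<^sub>F F) f"
      using f Nat_natural[OF assms(3,2) f, THEN arg_cong[where f = "farr H"]] by simp
  qed auto
qed

lemma whiskerR_Nat:
  assumes "category C" "H \<in> Fun C D" "F \<in> Fun D E" "\<alpha> \<in> Nat F G"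
  shows "\<alpha> \<lhd>\<^sub>N H \<in> Nat (F \<circ>\<^sub>F H) (G \<circ>\<^sub>F H)"
proof -
  interpret C: category C by fact
  note G = Nat_Tgt_Fun[OF assms(4,3)]
  note [simp] = FunD_simps[OF assms(2)] FunD_simps[OF G] FunD_simps[OF assms(3)]
     NatD_simps[OF assms(4,3)]
  show ?thesis
  proof (rule NatI[OF _ _ compF_Fun[OF assms(1,2,3)] compF_Fun[OF assms(1,2) G]])
    show "comp_at (\<alpha> \<lhd>\<^sub>N H) \<in> extensional (Obj C)"
      using ntrans_ext(3)[of \<alpha> H] by simp
    fix f assume f: "f \<in> Arr C"
    show "farr (G \<circ>\<^sub>F H) f \<cdot>\<^bsub>E\<^esub> comp_at (\<alpha> \<lhd>\<^sub>N H) (Dom C f)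
        = comp_at (\<alpha> \<lhd>\<^sub>N H) (Cod C f) \<cdot>\<^bsub>E\<^esub> farr (F \<circ>\<^sub>F H) f"
      using f Nat_natural[OF assms(4,3), of "farr H f"] by simp
  qed auto
qed

section \<open>Right Kan extensions and cartesian natural transformations\<close>

lemma ran_transpose:
  assumes "is_ran K F G c" "H \<in> Fun (Tgt K) (Tgt F)" "\<beta> \<in> Nat (H \<circ>\<^sub>F K) F"
  shows "ran_transpose K G c H \<beta> \<in> Nat H G"
    and "c \<bullet>\<^sub>N (ran_transpose K G c H \<beta> \<lhd>\<^sub>N K) = \<beta>"
proof -
  have "\<exists>!\<gamma>. \<gamma> \<in> Nat H G \<and> c \<bullet>\<^sub>N (\<gamma> \<lhd>\<^sub>N K) = \<beta>"
    using assms by (auto simp: is_ran_def)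
  from theI'[OF this] show "ran_transpose K G c H \<beta> \<in> Nat H G"
    and "c \<bullet>\<^sub>N (ran_transpose K G c H \<beta> \<lhd>\<^sub>N K) = \<beta>"
    unfolding ran_transpose_def by auto
qed

lemma ran_transpose_comp_at:
  assumes "is_ran K F G c" "H \<in> Fun D E" "\<beta> \<in> Nat (H \<circ>\<^sub>F K) F" "K \<in> Fun C D" "F \<in> Fun C E"
    and "a \<in> Obj C"
  shows "comp_at c a \<cdot>\<^bsub>E\<^esub> comp_at (ran_transpose K G c H \<beta>) (fobj K a) = comp_at \<beta> a"
proof -
  have H: "H \<in> Fun (Tgt K) (Tgt F)" using assms by (simp add: FunD_simps)
  note r = ran_transpose[OF assms(1) H assms(3)]
  have "NDom (ran_transpose K G c H \<beta>) = H" using Nat_NDom[OF r(1) assms(2)] .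
  then show ?thesis
    using arg_cong[OF r(2), of "\<lambda>\<beta>. comp_at \<beta> a"] assms by (simp add: FunD_simps)
qed

text \<open>Both transformations are transposes of the same
  \<open>c \<bullet>\<^sub>N (\<gamma>' \<lhd>\<^sub>N K)\<close>. The gain is that a transformation
  into \<open>G\<close> is tested at objects of the form \<open>K a\<close> only, and only after
  composition with \<open>c\<close>.\<close>

lemma ran_eqI:
  assumes "is_ran K F G c" "\<gamma> \<in> Nat H G" "\<gamma>' \<in> Nat H G"
    and "category C" "category E" "H \<in> Fun D E" "K \<in> Fun C D" "F \<in> Fun C E"
    and eq: "\<And>a. a \<in> Obj C \<Longrightarrow>
      comp_at c a \<cdot>\<^bsub>E\<^esub> comp_at \<gamma> (fobj K a) = comp_at c a \<cdot>\<^bsub>E\<^esub> comp_at \<gamma>' (fobj K a)"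
  shows "\<gamma> = \<gamma>'"
proof -
  have Tgts: "Tgt K = D" "Tgt F = E" "Src K = C" "Src H = D" "Tgt H = E" using assms by (simp_all add: FunD_simps)
  have c: "c \<in> Nat (G \<circ>\<^sub>F K) F" using assms(1) by (simp add: is_ran_def)
  have HK: "H \<circ>\<^sub>F K \<in> Fun C E" using assms by (auto intro: compF_Fun)
  have in_Nat: "c \<bullet>\<^sub>N (\<delta> \<lhd>\<^sub>N K) \<in> Nat (H \<circ>\<^sub>F K) F" if "\<delta> \<in> Nat H G" for \<delta>
    by (rule vcomp_Nat[OF assms(4,5) HK whiskerR_Nat[OF assms(4,7,6) that] c])
  have "c \<bullet>\<^sub>N (\<gamma> \<lhd>\<^sub>N K) = c \<bullet>\<^sub>N (\<gamma>' \<lhd>\<^sub>N K)"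
    using eq by (intro Nat_eqI[OF in_Nat[OF assms(2)] in_Nat[OF assms(3)] HK])
      (simp add: Tgts NatD_simps[OF assms(2,6)] NatD_simps[OF assms(3,6)])
  moreover have "\<exists>!\<delta>. \<delta> \<in> Nat H G \<and> c \<bullet>\<^sub>N (\<delta> \<lhd>\<^sub>N K) = c \<bullet>\<^sub>N (\<gamma>' \<lhd>\<^sub>N K)"
    using assms(1,6) in_Nat[OF assms(3)] by (simp add: is_ran_def Tgts)
  ultimately show ?thesis using assms(2,3) by blast
qed

text \<open>Translates cartesianness over \<open>[C, p]\<close> from arrows of
  \<open>functor_cat\<close> into natural transformations, the form in which units, multiplications
  and generic effects are lifted.\<close>

lemma cartesian_postcomp:
  assumes "cartesian (postcomp C p) \<sigma>" "p \<in> Fun E B"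
  shows cartesian_postcomp_Nat: "\<sigma> \<in> Nat (NDom \<sigma>) (NCod \<sigma>)"
    and cartesian_postcomp_NDom: "NDom \<sigma> \<in> Fun C E"
    and cartesian_postcomp_ex1: "category C \<Longrightarrow> H \<in> Fun C E \<Longrightarrow> \<gamma> \<in> Nat H (NCod \<sigma>) \<Longrightarrow>
      w \<in> Nat (p \<circ>\<^sub>F H) (p \<circ>\<^sub>F NDom \<sigma>) \<Longrightarrow> (p \<rhd>\<^sub>N \<sigma>) \<bullet>\<^sub>N w = p \<rhd>\<^sub>N \<gamma> \<Longrightarrow>
      \<exists>!h. h \<in> Nat H (NDom \<sigma>) \<and> p \<rhd>\<^sub>N h = w \<and> \<sigma> \<bullet>\<^sub>N h = \<gamma>"
proof -
  have Arr: "\<gamma> \<in> Arr (functor_cat C D) \<longleftrightarrow> \<gamma> \<in> Nat (NDom \<gamma>) (NCod \<gamma>) \<and> NDom \<gamma> \<in> Fun C D \<and>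
      NCod \<gamma> \<in> Fun C D" for \<gamma> and D :: "('z,'w) cat"
    by (auto simp: functor_cat_def NatD_simps)
  have HomE: "h \<in> Hom (functor_cat C D) F G \<longleftrightarrow> h \<in> Nat F G" if "F \<in> Fun C D" "G \<in> Fun C D"
    for h F G and D :: "('z,'w) cat"
    using that by (auto simp: functor_cat_def Hom_def NatD_simps)
  have p: "Src p = E" "Tgt p = B" using assms(2) by (simp_all add: FunD_simps)
  have sel: "Dom (functor_cat C D) = NDom" "Cod (functor_cat C D) = NCod"
     "Comp (functor_cat C D) = vcomp" "Obj (functor_cat C D) = Fun C D"
     for D :: "('z,'w) cat" by (auto simp: functor_cat_def)
  have \<sigma>: "\<sigma> \<in> Arr (functor_cat C E)"
    using assms(1) by (simp add: cartesian_def postcomp_def p)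
  then show Nat: "\<sigma> \<in> Nat (NDom \<sigma>) (NCod \<sigma>)" and T: "NDom \<sigma> \<in> Fun C E" 
    by (simp_all add: functor_cat_def) (auto simp: NatD_simps)
  have G: "NCod \<sigma> \<in> Fun C E" using \<sigma> by (simp add: Arr)
  assume C: "category C" and H: "H \<in> Fun C E" and \<gamma>: "\<gamma> \<in> Nat H (NCod \<sigma>)"
    and w: "w \<in> Nat (p \<circ>\<^sub>F H) (p \<circ>\<^sub>F NDom \<sigma>)" and eq: "(p \<rhd>\<^sub>N \<sigma>) \<bullet>\<^sub>N w = p \<rhd>\<^sub>N \<gamma>"
  have \<gamma>A: "\<gamma> \<in> Arr (functor_cat C E)" using \<gamma> H G by (auto simp: functor_cat_def)
  have [simp]: "NDom \<gamma> = H" "NCod \<gamma> = NCod \<sigma>" using NatD_simps[OF \<gamma> H] by auto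
  have post: "Src (postcomp C p) = functor_cat C E" "Tgt (postcomp C p) = functor_cat C B"
    by (simp_all add: postcomp_def p)
  have univ: "g\<in>Arr (functor_cat C E) \<Longrightarrow> NCod g = NCod \<sigma> \<Longrightarrow>
       w\<in>Hom (functor_cat C B) (fobj (postcomp C p) (NDom g)) (fobj (postcomp C p) (NDom \<sigma>)) \<Longrightarrow>
          farr (postcomp C p) \<sigma> \<bullet>\<^sub>N w = farr (postcomp C p) g \<Longrightarrow>
          (\<exists>!h. h \<in> Hom (functor_cat C E) (NDom g) (NDom \<sigma>) \<and>
                farr (postcomp C p) h = w \<and> \<sigma> \<bullet>\<^sub>N h = g)" for g w
    using assms(1) unfolding cartesian_def by (simp add: sel post)
  have farr: "farr (postcomp C p) h = p \<rhd>\<^sub>N h" if "h \<in> Arr (functor_cat C E)" for h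
    using that by (simp add: postcomp_def p)
  have fobj: "fobj (postcomp C p) F = p \<circ>\<^sub>F F" if "F \<in> Fun C E" for F
    using that by (simp add: postcomp_def p sel)
  have "\<exists>!h. h \<in> Hom (functor_cat C E) H (NDom \<sigma>) \<and> farr (postcomp C p) h = w \<and> \<sigma> \<bullet>\<^sub>N h = \<gamma>"
    using univ[OF \<gamma>A] w eq H T \<sigma> \<gamma>A
    by (simp add: farr fobj HomE compF_Fun[OF C _ assms(2)])
  \<comment> \<open>The arrow part of \<open>postcomp\<close> is \<open>undefined\<close> off the
    arrows of the functor category, so it can be replaced by whiskering only under the conjunct that
    \<open>h\<close> is natural.\<close>
  moreover have "farr (postcomp C p) h = p \<rhd>\<^sub>N h" if "h \<in> Nat H (NDom \<sigma>)" for h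
    using that H T by (intro farr) (auto simp: functor_cat_def)
  ultimately show "\<exists>!h. h \<in> Nat H (NDom \<sigma>) \<and> p \<rhd>\<^sub>N h = w \<and> \<sigma> \<bullet>\<^sub>N h = \<gamma>"
    by (simp add: HomE[OF H T] cong: conj_cong)
qed

section \<open>Powers\<close>

lemma ptuple:
  assumes "has_powers C A P" "X \<in> Obj C" "Y \<in> Obj C" "\<And>a. a \<in> A \<Longrightarrow> f a \<in> Hom C Y X"
  shows ptuple_Hom: "ptuple C A P Y X f \<in> Hom C Y (pobj P X)"
    and pproj_ptuple: "a \<in> A \<Longrightarrow> pproj P X a \<cdot>\<^bsub>C\<^esub> ptuple C A P Y X f = f a"
proof -
  have "\<exists>!h. h \<in> Hom C Y (pobj P X) \<and> (\<forall>a\<in>A. pproj P X a \<cdot>\<^bsub>C\<^esub> h = f a)"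
    using assms by (auto simp: has_powers_def is_power_def)
  from theI'[OF this] show "ptuple C A P Y X f \<in> Hom C Y (pobj P X)"
    and "a \<in> A \<Longrightarrow> pproj P X a \<cdot>\<^bsub>C\<^esub> ptuple C A P Y X f = f a"
    unfolding ptuple_def by auto
qed

lemma power_props:
  assumes "has_powers C A P" "X \<in> Obj C"
  shows pobj_Obj: "pobj P X \<in> Obj C"
    and pproj_arr: "a \<in> A \<Longrightarrow> pproj P X a \<in> Arr C"
    and pproj_dom: "a \<in> A \<Longrightarrow> Dom C (pproj P X a) = pobj P X"
    and pproj_cod: "a \<in> A \<Longrightarrow> Cod C (pproj P X a) = X"
  using assms by (auto simp: has_powers_def is_power_def Hom_def)

lemma power_eqI:
  assumes "category C" "has_powers C A P" "X \<in> Obj C"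
    and "h \<in> Hom C Y (pobj P X)" "h' \<in> Hom C Y (pobj P X)"
    and "\<And>a. a \<in> A \<Longrightarrow> pproj P X a \<cdot>\<^bsub>C\<^esub> h = pproj P X a \<cdot>\<^bsub>C\<^esub> h'"
  shows "h = h'"
proof -
  interpret category C by fact
  note [simp] = power_props[OF assms(2,3)]
  have Y: "Y \<in> Obj C" using assms(4) Dom_Obj by (auto simp: Hom_def)
  have f: "(\<lambda>a. pproj P X a \<cdot>\<^bsub>C\<^esub> h) \<in> A \<rightarrow> Hom C Y X"
    using assms(4) by (auto simp: Hom_def)
  have "\<forall>f\<in>A \<rightarrow> Hom C Y X. \<exists>!h. h \<in> Hom C Y (pobj P X) \<and> (\<forall>a\<in>A. pproj P X a \<cdot>\<^bsub>C\<^esub> h = f a)"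
    using assms(2,3) Y by (auto simp: has_powers_def is_power_def)
  from bspec[OF this f] obtain k where
    "\<And>l. l \<in> Hom C Y (pobj P X) \<and> (\<forall>a\<in>A. pproj P X a \<cdot>\<^bsub>C\<^esub> l = pproj P X a \<cdot>\<^bsub>C\<^esub> h) \<Longrightarrow> l = k"
    by (rule ex1E) blast
  from this[of h] this[of h'] assms(4,5,6) show ?thesis by simp
qed

lemma power_functor_sel [simp]:
  "Src (power_functor C A P) = C" "Tgt (power_functor C A P) = C"
  "X \<in> Obj C \<Longrightarrow> fobj (power_functor C A P) X = pobj P X"
  by (auto simp: power_functor_def)

context
  fixes C :: "('o, 'm) cat" and A :: "'i set" and P
  assumes C: "category C" and P: "has_powers C A P"
begin

interpretation category C by (rule C)

lemma power_functor_props: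
  assumes "f \<in> Arr C"
  shows power_functor_arr: "farr (power_functor C A P) f \<in> Hom C (pobj P (Dom C f)) (pobj P (Cod C f))"
    and pproj_power_functor: "a \<in> A \<Longrightarrow>
      pproj P (Cod C f) a \<cdot>\<^bsub>C\<^esub> farr (power_functor C A P) f = f \<cdot>\<^bsub>C\<^esub> pproj P (Dom C f) a"
proof -
  have *: "f \<cdot>\<^bsub>C\<^esub> pproj P (Dom C f) a \<in> Hom C (pobj P (Dom C f)) (Cod C f)" if "a \<in> A" for a
    using that assms by (intro HomI) (simp_all add: power_props[OF P])
  have o: "Cod C f \<in> Obj C" "pobj P (Dom C f) \<in> Obj C"
    using assms by (auto simp: pobj_Obj[OF P])
  show "farr (power_functor C A P) f \<in> Hom C (pobj P (Dom C f)) (pobj P (Cod C f))"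
    "a \<in> A \<Longrightarrow>
      pproj P (Cod C f) a \<cdot>\<^bsub>C\<^esub> farr (power_functor C A P) f = f \<cdot>\<^bsub>C\<^esub> pproj P (Dom C f) a"
    using ptuple[OF P o, of "\<lambda>a. f \<cdot>\<^bsub>C\<^esub> pproj P (Dom C f) a", OF *] assms
    by (simp_all add: power_functor_def)
qed

text \<open>Each functor law compares two arrows into a power, hence is checked on projections,
  where the power of an arrow acts by composition with that arrow.\<close>

lemma power_functor_Fun: "power_functor C A P \<in> Fun C C"
proof (rule FunI)
  note [simp] = power_props[OF P] HomD[OF power_functor_arr]
  show "farr (power_functor C A P) (Ident C X) = Ident C (fobj (power_functor C A P) X)"
    if X: "X \<in> Obj C" for X
  proof (rule power_eqI[OF C P X, where Y = "pobj P X"])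
    fix a assume "a \<in> A"
    with X show "pproj P X a \<cdot>\<^bsub>C\<^esub> farr (power_functor C A P) (Ident C X)
       = pproj P X a \<cdot>\<^bsub>C\<^esub> Ident C (fobj (power_functor C A P) X)"
      using pproj_power_functor[of "Ident C X" a] by simp
  qed (use X in \<open>auto intro!: HomI\<close>)
  show "farr (power_functor C A P) (g \<cdot>\<^bsub>C\<^esub> f)
      = farr (power_functor C A P) g \<cdot>\<^bsub>C\<^esub> farr (power_functor C A P) f"
    if fg: "f \<in> Arr C" "g \<in> Arr C" "Cod C f = Dom C g" for f g
  proof (rule power_eqI[OF C P, where Y = "pobj P (Dom C f)" and X = "Cod C g"])
    fix a assume a: "a \<in> A"
    have "pproj P (Cod C g) a \<cdot>\<^bsub>C\<^esub> (farr (power_functor C A P) g \<cdot>\<^bsub>C\<^esub> farr (power_functor C A P) f)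
        = (pproj P (Cod C g) a \<cdot>\<^bsub>C\<^esub> farr (power_functor C A P) g) \<cdot>\<^bsub>C\<^esub> farr (power_functor C A P) f"
      using fg a by simp
    also have "\<dots> = g \<cdot>\<^bsub>C\<^esub> (pproj P (Cod C f) a \<cdot>\<^bsub>C\<^esub> farr (power_functor C A P) f)"
      using fg a by (simp add: pproj_power_functor)
    also have "\<dots> = pproj P (Cod C g) a \<cdot>\<^bsub>C\<^esub> farr (power_functor C A P) (g \<cdot>\<^bsub>C\<^esub> f)"
      using fg a pproj_power_functor[of "g \<cdot>\<^bsub>C\<^esub> f" a] pproj_power_functor[of f a] by simp
    finally show "pproj P (Cod C g) a \<cdot>\<^bsub>C\<^esub> farr (power_functor C A P) (g \<cdot>\<^bsub>C\<^esub> f) =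
       pproj P (Cod C g) a \<cdot>\<^bsub>C\<^esub> (farr (power_functor C A P) g \<cdot>\<^bsub>C\<^esub> farr (power_functor C A P) f)" ..
  qed (use fg in \<open>auto intro!: HomI\<close>)
  show "fobj (power_functor C A P) \<in> extensional (Obj C)"
    "farr (power_functor C A P) \<in> extensional (Arr C)"
    by (simp_all add: power_functor_def)
qed (auto simp: power_props[OF P] HomD[OF power_functor_arr])

end

lemma power_comparison_comp_at:
  assumes "X \<in> Obj E" "p \<in> Fun E B" "has_powers E A PE" "has_powers B A PB"
  shows power_comparison_Hom: "comp_at (power_comparison p A PE PB) X
      \<in> Hom B (fobj p (pobj PE X)) (pobj PB (fobj p X))"
    and pproj_power_comparison: "a \<in> A \<Longrightarrow>
      pproj PB (fobj p X) a \<cdot>\<^bsub>B\<^esub> comp_at (power_comparison p A PE PB) X = farr p (pproj PE X a)"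
proof -
  have *: "farr p (pproj PE X a) \<in> Hom B (fobj p (pobj PE X)) (fobj p X)" if "a \<in> A" for a
    using that assms by (intro HomI) (auto simp: FunD_simps power_props)
  have o: "fobj p X \<in> Obj B" "fobj p (pobj PE X) \<in> Obj B"
    using assms by (auto simp: FunD_simps power_props)
  show "comp_at (power_comparison p A PE PB) X \<in> Hom B (fobj p (pobj PE X)) (pobj PB (fobj p X))"
    "a \<in> A \<Longrightarrow>
      pproj PB (fobj p X) a \<cdot>\<^bsub>B\<^esub> comp_at (power_comparison p A PE PB) X = farr p (pproj PE X a)"
    using ptuple[OF assms(4) o, of "\<lambda>a. farr p (pproj PE X a)", OF *] assms
    by (simp_all add: power_comparison_def FunD_simps)
qed

text \<open>Tested against the projections of the power in \<open>B\<close>: both composites project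
  to \<open>p\<close> of \<open>f\<close> composed with the projection in \<open>E\<close>, by way
  of the naturality of the projections in either category.\<close>

lemma power_comparison_natural:
  assumes "category E" "category B" "p \<in> Fun E B" "has_powers E A PE" "has_powers B A PB" "f \<in> Arr E"
  shows "farr (power_functor B A PB) (farr p f) \<cdot>\<^bsub>B\<^esub> comp_at (power_comparison p A PE PB) (Dom E f)
    = comp_at (power_comparison p A PE PB) (Cod E f) \<cdot>\<^bsub>B\<^esub> farr p (farr (power_functor E A PE) f)"
    (is "?l = ?r")
proof -
  interpret E: category E by fact
  interpret B: category B by fact
  note [simp] = FunD_simps[OF assms(3)] power_props[OF assms(4)] power_props[OF assms(5)]
    HomD[OF power_functor_arr[OF assms(1,4)]] HomD[OF power_functor_arr[OF assms(2,5)]]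
    HomD[OF power_comparison_Hom[OF _ assms(3,4,5)]]
  show ?thesis
  proof (rule power_eqI[OF assms(2,5), where X = "fobj p (Cod E f)" and Y = "fobj p (pobj PE (Dom E f))"])
    fix a assume a: "a \<in> A"
    let ?k = "comp_at (power_comparison p A PE PB)"
    have "pproj PB (fobj p (Cod E f)) a \<cdot>\<^bsub>B\<^esub> ?l
      = (pproj PB (Cod B (farr p f)) a \<cdot>\<^bsub>B\<^esub> farr (power_functor B A PB) (farr p f)) \<cdot>\<^bsub>B\<^esub> ?k (Dom E f)"
      using a assms(6) by simp
    also have "\<dots> = farr p f \<cdot>\<^bsub>B\<^esub> (pproj PB (fobj p (Dom E f)) a \<cdot>\<^bsub>B\<^esub> ?k (Dom E f))"
      using a assms(6) by (subst pproj_power_functor[OF assms(2,5)]) simp_all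
    also have "\<dots> = farr p (f \<cdot>\<^bsub>E\<^esub> pproj PE (Dom E f) a)"
      using a assms(6) by (subst pproj_power_comparison[OF _ assms(3,4,5)]) simp_all
    also have "\<dots> = farr p (pproj PE (Cod E f) a \<cdot>\<^bsub>E\<^esub> farr (power_functor E A PE) f)"
      using a assms(6) by (simp add: pproj_power_functor[OF assms(1,4)])
    also have "\<dots> = (pproj PB (fobj p (Cod E f)) a \<cdot>\<^bsub>B\<^esub> ?k (Cod E f)) \<cdot>\<^bsub>B\<^esub>
        farr p (farr (power_functor E A PE) f)"
      using a assms(6) by (subst pproj_power_comparison[OF _ assms(3,4,5)]) simp_all
    also have "\<dots> = pproj PB (fobj p (Cod E f)) a \<cdot>\<^bsub>B\<^esub> ?r"
      using a assms(6) by simp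
    finally show "pproj PB (fobj p (Cod E f)) a \<cdot>\<^bsub>B\<^esub> ?l = pproj PB (fobj p (Cod E f)) a \<cdot>\<^bsub>B\<^esub> ?r" .
  qed (use assms(6) in \<open>auto intro!: HomI\<close>)
qed

text \<open>The functor \<open>fpower A PE (IdF E)\<close> in the definition of the comparison
  equals \<open>power_functor E A PE\<close> by \<open>compF_IdF\<close>; the second form is the one
  used in what follows.\<close>

lemma power_comparison_Nat:
  assumes "category E" "category B" "p \<in> Fun E B" "has_powers E A PE" "has_powers B A PB"
  shows "power_comparison p A PE PB \<in> Nat (p \<circ>\<^sub>F power_functor E A PE) (power_functor B A PB \<circ>\<^sub>F p)"
proof (rule NatI)
  interpret E: category E by fact
  note PE = power_functor_Fun[OF assms(1,4)] and PB = power_functor_Fun[OF assms(2,5)]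
  have p: "Src p = E" "Tgt p = B" using assms by (simp_all add: FunD_simps)
  show "NDom (power_comparison p A PE PB) = p \<circ>\<^sub>F power_functor E A PE"
    using compF_IdF[OF PE] by (simp add: power_comparison_def fpower_def p)
  show "NCod (power_comparison p A PE PB) = power_functor B A PB \<circ>\<^sub>F p"
    using compF_IdF[OF PB] by (simp add: power_comparison_def fpower_def p)
  show "p \<circ>\<^sub>F power_functor E A PE \<in> Fun E B" "power_functor B A PB \<circ>\<^sub>F p \<in> Fun E B"
    using compF_Fun[OF assms(1) PE assms(3)] compF_Fun[OF assms(1,3) PB] by auto
  show "comp_at (power_comparison p A PE PB) \<in> extensional (Obj E)"
    by (simp add: power_comparison_def p)
  show "farr (power_functor B A PB \<circ>\<^sub>F p) f \<cdot>\<^bsub>B\<^esub> comp_at (power_comparison p A PE PB) (Dom E f) =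
    comp_at (power_comparison p A PE PB) (Cod E f) \<cdot>\<^bsub>B\<^esub> farr (p \<circ>\<^sub>F power_functor E A PE) f"
    if "f \<in> Arr E" for f
    using power_comparison_natural[OF assms that] that by (simp add: p)
qed (use assms in \<open>auto simp: FunD_simps HomD[OF power_comparison_Hom[OF _ assms(3,4,5)]]\<close>)

section \<open>Kleisli categories\<close>

lemma is_monadD:
  assumes "is_monad C T"
  shows "mfun T \<in> Fun C C" "munit T \<in> Nat (IdF C) (mfun T)"
    "mmult T \<in> Nat (mfun T \<circ>\<^sub>F mfun T) (mfun T)"
  using assms by (auto simp: is_monad_def)

locale monad_on = category C for C :: "('o, 'm) cat" and T :: "('o, 'm) monad" +
  assumes monad: "is_monad C T"
begin

abbreviation "t \<equiv> mfun T"
abbreviation "\<eta> \<equiv> comp_at (munit T)"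
abbreviation "\<mu> \<equiv> comp_at (mmult T)"
abbreviation "K \<equiv> kleisliK T"
abbreviation "J \<equiv> kleisliJ T"

lemmas T_Fun = is_monadD(1)[OF monad]
  and unit_Nat = is_monadD(2)[OF monad]
  and mult_Nat = is_monadD(3)[OF monad]

lemma TT_Fun: "t \<circ>\<^sub>F t \<in> Fun C C"
  by (rule compF_Fun[OF category_axioms T_Fun T_Fun])

lemmas T_simps [simp] = FunD_simps[OF T_Fun]

lemma unit_simps [simp]:
  assumes "X \<in> Obj C"
  shows "\<eta> X \<in> Arr C" "Dom C (\<eta> X) = X" "Cod C (\<eta> X) = fobj t X"
  using NatD_simps[OF unit_Nat IdF_Fun[OF category_axioms]] assms by auto

lemma mult_simps [simp]:
  assumes "X \<in> Obj C"
  shows "\<mu> X \<in> Arr C" "Dom C (\<mu> X) = fobj t (fobj t X)" "Cod C (\<mu> X) = fobj t X"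
  using NatD_simps[OF mult_Nat TT_Fun] assms by auto

lemma NDom_simps [simp]: "NDom (munit T) = IdF C" "NDom (mmult T) = t \<circ>\<^sub>F t"
    "NCod (munit T) = t" "NCod (mmult T) = t"
  using Nat_NDom[OF unit_Nat IdF_Fun[OF category_axioms]] Nat_NDom[OF mult_Nat TT_Fun]
    Nat_NCod[OF unit_Nat IdF_Fun[OF category_axioms]] Nat_NCod[OF mult_Nat TT_Fun] by auto

lemma unit_natural: "f \<in> Arr C \<Longrightarrow> farr t f \<cdot>\<^bsub>C\<^esub> \<eta> (Dom C f) = \<eta> (Cod C f) \<cdot>\<^bsub>C\<^esub> f"
  using Nat_natural[OF unit_Nat IdF_Fun[OF category_axioms]] by simp

lemma mult_natural:
  "f \<in> Arr C \<Longrightarrow> farr t f \<cdot>\<^bsub>C\<^esub> \<mu> (Dom C f) = \<mu> (Cod C f) \<cdot>\<^bsub>C\<^esub> farr t (farr t f)"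
  using Nat_natural[OF mult_Nat TT_Fun] by simp

lemma monad_laws:
  assumes "X \<in> Obj C"
  shows mult_unitL: "\<mu> X \<cdot>\<^bsub>C\<^esub> \<eta> (fobj t X) = Ident C (fobj t X)"
    and mult_unitR: "\<mu> X \<cdot>\<^bsub>C\<^esub> farr t (\<eta> X) = Ident C (fobj t X)"
    and mult_assoc: "\<mu> X \<cdot>\<^bsub>C\<^esub> \<mu> (fobj t X) = \<mu> X \<cdot>\<^bsub>C\<^esub> farr t (\<mu> X)"
proof -
  have 1: "mmult T \<bullet>\<^sub>N (munit T \<lhd>\<^sub>N mfun T) = idN (mfun T)"
    "mmult T \<bullet>\<^sub>N (mfun T \<rhd>\<^sub>N munit T) = idN (mfun T)"
    "mmult T \<bullet>\<^sub>N (mmult T \<lhd>\<^sub>N mfun T) = mmult T \<bullet>\<^sub>N (mfun T \<rhd>\<^sub>N mmult T)"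
    using monad by (auto simp: is_monad_def)
  from 1[THEN arg_cong[where f = "\<lambda>\<gamma>. comp_at \<gamma> X"]] assms
  show "\<mu> X \<cdot>\<^bsub>C\<^esub> \<eta> (fobj t X) = Ident C (fobj t X)"
    "\<mu> X \<cdot>\<^bsub>C\<^esub> farr t (\<eta> X) = Ident C (fobj t X)"
    "\<mu> X \<cdot>\<^bsub>C\<^esub> \<mu> (fobj t X) = \<mu> X \<cdot>\<^bsub>C\<^esub> farr t (\<mu> X)"
    by simp_all
qed

lemma kleisli_sel [simp]:
  "Obj (kleisli T) = Obj C"
  "(X, f, Y) \<in> Arr (kleisli T) \<longleftrightarrow> X \<in> Obj C \<and> Y \<in> Obj C \<and> f \<in> Hom C X (fobj t Y)"
  "Dom (kleisli T) (X, f, Y) = X" "Cod (kleisli T) (X, f, Y) = Y"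
  "Ident (kleisli T) X = (X, \<eta> X, X)"
  "(Y', g, Z) \<cdot>\<^bsub>kleisli T\<^esub> (X, f, Y) = (X, \<mu> Z \<cdot>\<^bsub>C\<^esub> (farr t g \<cdot>\<^bsub>C\<^esub> f), Z)"
  by (auto simp: kleisli_def)

lemma kleisliK_sel [simp]:
  "Src K = kleisli T" "Tgt K = C"
  "X \<in> Obj C \<Longrightarrow> fobj K X = fobj t X"
  "(X, f, Y) \<in> Arr (kleisli T) \<Longrightarrow> farr K (X, f, Y) = \<mu> Y \<cdot>\<^bsub>C\<^esub> farr t f"
  by (auto simp: kleisliK_def)

lemma kleisliJ_sel [simp]:
  "Src J = C" "Tgt J = kleisli T"
  "X \<in> Obj C \<Longrightarrow> fobj J X = X"
  "f \<in> Arr C \<Longrightarrow> farr J f = (Dom C f, \<eta> (Cod C f) \<cdot>\<^bsub>C\<^esub> f, Cod C f)"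
  by (auto simp: kleisliJ_def)

text \<open>The unit laws change sides: the left identity comes from \<open>mult_unitR\<close>, the
  right identity from \<open>mult_unitL\<close> after naturality of \<eta>. Associativity combines
  \<open>mult_assoc\<close> with naturality of \<mu>.\<close>

lemma kleisli_category: "category (kleisli T)"
proof
  note [simp] = Hom_def
  show "Dom (kleisli T) f \<in> Obj (kleisli T)" "Cod (kleisli T) f \<in> Obj (kleisli T)"
    if "f \<in> Arr (kleisli T)" for f
    using that by (cases f; auto)+
  show "Ident (kleisli T) X \<in> Hom (kleisli T) X X" if "X \<in> Obj (kleisli T)" for X
    using that by simp
  show "g \<cdot>\<^bsub>kleisli T\<^esub> f \<in> Hom (kleisli T) X Z"
    if "f \<in> Hom (kleisli T) X Y" "g \<in> Hom (kleisli T) Y Z" for f g X Y Z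
    using that by (cases f; cases g; auto)
  show "Ident (kleisli T) Y \<cdot>\<^bsub>kleisli T\<^esub> f = f"
    "f \<cdot>\<^bsub>kleisli T\<^esub> Ident (kleisli T) X = f"
    if f: "f \<in> Hom (kleisli T) X Y" for f X Y
  proof -
    obtain k where k: "f = (X, k, Y)" and X: "X \<in> Obj C" and Y: "Y \<in> Obj C" 
      and arr: "k \<in> Arr C" "Dom C k = X" "Cod C k = fobj t Y"
      using f by (cases f) auto
    have "\<mu> Y \<cdot>\<^bsub>C\<^esub> (farr t (\<eta> Y) \<cdot>\<^bsub>C\<^esub> k) = (\<mu> Y \<cdot>\<^bsub>C\<^esub> farr t (\<eta> Y)) \<cdot>\<^bsub>C\<^esub> k"
      using Y arr by simp
    also have "\<dots> = k" using Y arr by (simp only: mult_unitR) simp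
    finally show "Ident (kleisli T) Y \<cdot>\<^bsub>kleisli T\<^esub> f = f" by (simp add: k)
    have "\<mu> Y \<cdot>\<^bsub>C\<^esub> (farr t k \<cdot>\<^bsub>C\<^esub> \<eta> X) = (\<mu> Y \<cdot>\<^bsub>C\<^esub> \<eta> (fobj t Y)) \<cdot>\<^bsub>C\<^esub> k"
      using X Y arr unit_natural[OF arr(1)] by simp
    also have "\<dots> = k" using Y arr by (simp only: mult_unitL) simp
    finally show "f \<cdot>\<^bsub>kleisli T\<^esub> Ident (kleisli T) X = f" by (simp add: k)
  qed
  show "(h \<cdot>\<^bsub>kleisli T\<^esub> g) \<cdot>\<^bsub>kleisli T\<^esub> f = h \<cdot>\<^bsub>kleisli T\<^esub> (g \<cdot>\<^bsub>kleisli T\<^esub> f)"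
    if fgh: "f \<in> Hom (kleisli T) W X" "g \<in> Hom (kleisli T) X Y" "h \<in> Hom (kleisli T) Y Z"
    for f g h W X Y Z
  proof -
    obtain f' g' h' where k: "f = (W, f', X)" "g = (X, g', Y)" "h = (Y, h', Z)"
      and o: "W \<in> Obj C" "X \<in> Obj C" "Y \<in> Obj C" "Z \<in> Obj C"
      and arr: "f' \<in> Arr C" "Dom C f' = W" "Cod C f' = fobj t X"
        "g' \<in> Arr C" "Dom C g' = X" "Cod C g' = fobj t Y"
        "h' \<in> Arr C" "Dom C h' = Y" "Cod C h' = fobj t Z"
      using fgh by (cases f; cases g; cases h) auto
    have "\<mu> Z \<cdot>\<^bsub>C\<^esub> (farr t (\<mu> Z \<cdot>\<^bsub>C\<^esub> (farr t h' \<cdot>\<^bsub>C\<^esub> g')) \<cdot>\<^bsub>C\<^esub> f')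
       = (\<mu> Z \<cdot>\<^bsub>C\<^esub> farr t (\<mu> Z)) \<cdot>\<^bsub>C\<^esub> (farr t (farr t h') \<cdot>\<^bsub>C\<^esub> (farr t g' \<cdot>\<^bsub>C\<^esub> f'))"
      using o arr by simp
    also have "\<dots> = (\<mu> Z \<cdot>\<^bsub>C\<^esub> \<mu> (fobj t Z)) \<cdot>\<^bsub>C\<^esub> (farr t (farr t h') \<cdot>\<^bsub>C\<^esub> (farr t g' \<cdot>\<^bsub>C\<^esub> f'))"
      using o by (simp only: mult_assoc)
    also have "\<dots> = \<mu> Z \<cdot>\<^bsub>C\<^esub> ((\<mu> (fobj t Z) \<cdot>\<^bsub>C\<^esub> farr t (farr t h')) \<cdot>\<^bsub>C\<^esub> (farr t g' \<cdot>\<^bsub>C\<^esub> f'))"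
      using o arr by simp
    also have "\<dots> = \<mu> Z \<cdot>\<^bsub>C\<^esub> ((farr t h' \<cdot>\<^bsub>C\<^esub> \<mu> Y) \<cdot>\<^bsub>C\<^esub> (farr t g' \<cdot>\<^bsub>C\<^esub> f'))"
      using o arr mult_natural[OF arr(7)] by simp
    also have "\<dots> = \<mu> Z \<cdot>\<^bsub>C\<^esub> (farr t h' \<cdot>\<^bsub>C\<^esub> (\<mu> Y \<cdot>\<^bsub>C\<^esub> (farr t g' \<cdot>\<^bsub>C\<^esub> f')))"
      using o arr by simp
    finally show ?thesis by (simp add: k)
  qed
qed

end

context monad_on
begin

text \<open>On arrows \<open>K\<close> is Kleisli extension, and extension respects composition by
  the same two facts that make Kleisli composition associative.\<close>

lemma kleisliK_Fun: "K \<in> Fun (kleisli T) C"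
proof (rule FunI)
  show "farr K (g \<cdot>\<^bsub>kleisli T\<^esub> f) = farr K g \<cdot>\<^bsub>C\<^esub> farr K f"
    if fg: "f \<in> Arr (kleisli T)" "g \<in> Arr (kleisli T)" "Cod (kleisli T) f = Dom (kleisli T) g" for f g
  proof -
    obtain X Y Z f' g' where k: "f = (X, f', Y)" "g = (Y, g', Z)"
      using fg by (cases f; cases g) auto
    with fg have o: "X \<in> Obj C" "Y \<in> Obj C" "Z \<in> Obj C"
      and arr: "f' \<in> Arr C" "Dom C f' = X" "Cod C f' = fobj t Y"
        "g' \<in> Arr C" "Dom C g' = Y" "Cod C g' = fobj t Z"
      by (auto simp: Hom_def)
    have "\<mu> Z \<cdot>\<^bsub>C\<^esub> farr t (\<mu> Z \<cdot>\<^bsub>C\<^esub> (farr t g' \<cdot>\<^bsub>C\<^esub> f'))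
       = (\<mu> Z \<cdot>\<^bsub>C\<^esub> farr t (\<mu> Z)) \<cdot>\<^bsub>C\<^esub> (farr t (farr t g') \<cdot>\<^bsub>C\<^esub> farr t f')"
      using o arr by simp
    also have "\<dots> = (\<mu> Z \<cdot>\<^bsub>C\<^esub> \<mu> (fobj t Z)) \<cdot>\<^bsub>C\<^esub> (farr t (farr t g') \<cdot>\<^bsub>C\<^esub> farr t f')"
      using o by (simp only: mult_assoc)
    also have "\<dots> = \<mu> Z \<cdot>\<^bsub>C\<^esub> ((\<mu> (fobj t Z) \<cdot>\<^bsub>C\<^esub> farr t (farr t g')) \<cdot>\<^bsub>C\<^esub> farr t f')"
      using o arr by simp
    also have "\<dots> = (\<mu> Z \<cdot>\<^bsub>C\<^esub> farr t g') \<cdot>\<^bsub>C\<^esub> (\<mu> Y \<cdot>\<^bsub>C\<^esub> farr t f')"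
      using o arr mult_natural[OF arr(4), symmetric] by simp
    finally show ?thesis using o arr by (simp add: k Hom_def)
  qed
  show "fobj K \<in> extensional (Obj (kleisli T))" "farr K \<in> extensional (Arr (kleisli T))"
    by (simp_all add: kleisliK_def)
  show "farr K f \<in> Arr C" "Dom C (farr K f) = fobj K (Dom (kleisli T) f)"
    "Cod C (farr K f) = fobj K (Cod (kleisli T) f)" if "f \<in> Arr (kleisli T)" for f
    using that by (cases f; auto simp: Hom_def)+
qed (auto simp: mult_unitR Hom_def)

lemma kleisliJ_Fun: "J \<in> Fun C (kleisli T)"
proof (rule FunI)
  show "farr J (g \<cdot>\<^bsub>C\<^esub> f) = farr J g \<cdot>\<^bsub>kleisli T\<^esub> farr J f"
    if fg: "f \<in> Arr C" "g \<in> Arr C" "Cod C f = Dom C g" for f g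
  proof -
    have "\<mu> (Cod C g) \<cdot>\<^bsub>C\<^esub> (farr t (\<eta> (Cod C g) \<cdot>\<^bsub>C\<^esub> g) \<cdot>\<^bsub>C\<^esub> (\<eta> (Dom C g) \<cdot>\<^bsub>C\<^esub> f))
       = (\<mu> (Cod C g) \<cdot>\<^bsub>C\<^esub> farr t (\<eta> (Cod C g))) \<cdot>\<^bsub>C\<^esub> ((farr t g \<cdot>\<^bsub>C\<^esub> \<eta> (Dom C g)) \<cdot>\<^bsub>C\<^esub> f)"
      using fg by simp
    also have "\<dots> = \<eta> (Cod C g) \<cdot>\<^bsub>C\<^esub> (g \<cdot>\<^bsub>C\<^esub> f)"
      using fg by (subst mult_unitR; simp add: unit_natural)
    finally show ?thesis using fg by simp
  qed
  show "fobj J \<in> extensional (Obj C)" "farr J \<in> extensional (Arr C)"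
    by (simp_all add: kleisliJ_def)
qed (auto simp: Hom_def)

text \<open>An equality of functors, not merely an isomorphism, since Kleisli objects are the
  objects of \<open>C\<close>. Restricting an operation along \<open>J\<close> therefore gives a
  transformation with codomain literally \<open>t\<close>.\<close>

lemma kleisliK_kleisliJ: "K \<circ>\<^sub>F J = t"
proof (rule Fun_eqI[OF compF_Fun[OF category_axioms kleisliJ_Fun kleisliK_Fun] T_Fun])
  fix f assume f: "f \<in> Arr C"
  then have "farr (K \<circ>\<^sub>F J) f = (\<mu> (Cod C f) \<cdot>\<^bsub>C\<^esub> farr t (\<eta> (Cod C f))) \<cdot>\<^bsub>C\<^esub> farr t f"
    by (simp add: Hom_def)
  also have "\<dots> = farr t f"
    using f by (subst mult_unitR) simp_all
  finally show "farr (K \<circ>\<^sub>F J) f = farr t f" .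
qed simp

lemma kleisli_counit_sel [simp]:
  "NDom (kleisli_counit T) = J \<circ>\<^sub>F K" "NCod (kleisli_counit T) = IdF (kleisli T)"
  "X \<in> Obj C \<Longrightarrow> comp_at (kleisli_counit T) X = (fobj t X, Ident C (fobj t X), X)"
  by (auto simp: kleisli_counit_def)

text \<open>The last step of \<open>phi\<close>, isolated for an arbitrary monad. Its component at
  \<open>X\<close> is \<open>\<mu> X \<cdot> \<beta> (T X)\<close>.\<close>

definition alg_of_generic :: "('o, 'm, 'o, 'm) ntrans \<Rightarrow> ('o, 'o \<times> 'm \<times> 'o, 'o, 'm) ntrans" where
  "alg_of_generic \<beta> = (K \<rhd>\<^sub>N kleisli_counit T) \<bullet>\<^sub>N (\<beta> \<lhd>\<^sub>N K)"

text \<open>The generic effect of an operation: the operation evaluated on pure computations, with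
  component \<open>\<alpha> X \<cdot> W (\<eta> X)\<close>.\<close>

definition generic_of_alg ::
    "'i set \<Rightarrow> ('o, 'i, 'm) powers \<Rightarrow> ('o, 'o \<times> 'm \<times> 'o, 'o, 'm) ntrans \<Rightarrow> ('o, 'm, 'o, 'm) ntrans" where
  "generic_of_alg A P \<alpha> = (\<alpha> \<lhd>\<^sub>N J) \<bullet>\<^sub>N (power_functor C A P \<rhd>\<^sub>N munit T)"

end

section \<open>Algebraic operations and generic effects\<close>

locale monad_with_powers = monad_on C T for C :: "('o, 'm) cat" and T :: "('o, 'm) monad" +
  fixes A :: "'i set" and P :: "('o, 'i, 'm) powers"
  assumes powers: "has_powers C A P"
begin

abbreviation "W \<equiv> power_functor C A P"

lemmas W_Fun = power_functor_Fun[OF category_axioms powers]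
lemmas W_simps [simp] = FunD_simps(3-)[OF W_Fun]
lemmas pobj_simps [simp] = power_props[OF powers]

lemma Alg_eq: "Alg T A P = Nat (W \<circ>\<^sub>F K) K"
  by (simp add: Alg_def fpower_def)

lemma WK_Fun: "W \<circ>\<^sub>F K \<in> Fun (kleisli T) C"
  by (rule compF_Fun[OF kleisli_category kleisliK_Fun W_Fun])

context
  fixes \<alpha> assumes \<alpha>: "\<alpha> \<in> Alg T A P"
begin

lemma Alg_simps:
  "NDom \<alpha> = W \<circ>\<^sub>F K" "NCod \<alpha> = K"
  "X \<in> Obj C \<Longrightarrow> comp_at \<alpha> X \<in> Arr C"
  "X \<in> Obj C \<Longrightarrow> Dom C (comp_at \<alpha> X) = pobj P (fobj t X)"
  "X \<in> Obj C \<Longrightarrow> Cod C (comp_at \<alpha> X) = fobj t X"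
  using NatD_simps[OF \<alpha>[unfolded Alg_eq] WK_Fun] by auto

lemma Alg_natural:
  assumes "X \<in> Obj C" "Y \<in> Obj C" "f \<in> Arr C" "Dom C f = X" "Cod C f = fobj t Y"
  shows "(\<mu> Y \<cdot>\<^bsub>C\<^esub> farr t f) \<cdot>\<^bsub>C\<^esub> comp_at \<alpha> X = comp_at \<alpha> Y \<cdot>\<^bsub>C\<^esub> farr W (\<mu> Y \<cdot>\<^bsub>C\<^esub> farr t f)"
  using Nat_natural[OF \<alpha>[unfolded Alg_eq] WK_Fun, of "(X, f, Y)"] assms by (simp add: Hom_def)

text \<open>The arrow \<open>\<mu> X\<close> is \<open>K\<close> of the counit, the Kleisli arrow
  from \<open>T X\<close> to \<open>X\<close> given by the identity of \<open>T X\<close>; this is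
  naturality of the operation at that arrow.\<close>

lemma Alg_mult:
  assumes "X \<in> Obj C"
  shows "\<mu> X \<cdot>\<^bsub>C\<^esub> comp_at \<alpha> (fobj t X) = comp_at \<alpha> X \<cdot>\<^bsub>C\<^esub> farr W (\<mu> X)"
  using Alg_natural[of "fobj t X" X "Ident C (fobj t X)"] assms by simp

text \<open>By naturality along the counit \<mu> moves under \<open>W\<close>, where it cancels
  against \<eta>. The operation is thus recovered from its generic effect; the identity is used
  again in the base, for \<alpha> itself.\<close>

lemma Alg_generic:
  assumes "X \<in> Obj C"
  shows "\<mu> X \<cdot>\<^bsub>C\<^esub> (comp_at \<alpha> (fobj t X) \<cdot>\<^bsub>C\<^esub> farr W (\<eta> (fobj t X))) = comp_at \<alpha> X"
proof -
  have "\<mu> X \<cdot>\<^bsub>C\<^esub> (comp_at \<alpha> (fobj t X) \<cdot>\<^bsub>C\<^esub> farr W (\<eta> (fobj t X)))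
     = (\<mu> X \<cdot>\<^bsub>C\<^esub> comp_at \<alpha> (fobj t X)) \<cdot>\<^bsub>C\<^esub> farr W (\<eta> (fobj t X))"
    using assms by (simp add: Alg_simps)
  also have "\<dots> = comp_at \<alpha> X \<cdot>\<^bsub>C\<^esub> farr W (\<mu> X \<cdot>\<^bsub>C\<^esub> \<eta> (fobj t X))"
    using assms by (simp add: Alg_mult Alg_simps)
  also have "\<dots> = comp_at \<alpha> X"
    using assms by (simp add: mult_unitL Alg_simps)
  finally show ?thesis .
qed

lemma generic_of_alg_Nat: "generic_of_alg A P \<alpha> \<in> Nat W t"
proof -
  have "W \<rhd>\<^sub>N munit T \<in> Nat W (W \<circ>\<^sub>F t)"
    using whiskerL_Nat[OF category_axioms IdF_Fun[OF category_axioms] unit_Nat W_Fun]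
    by (simp add: compF_IdF[OF W_Fun])
  moreover have "\<alpha> \<lhd>\<^sub>N J \<in> Nat (W \<circ>\<^sub>F t) t"
    using whiskerR_Nat[OF category_axioms kleisliJ_Fun WK_Fun \<alpha>[unfolded Alg_eq]]
    by (simp add: compF_assoc[OF kleisliJ_Fun kleisliK_Fun] kleisliK_kleisliJ)
  ultimately show ?thesis
    unfolding generic_of_alg_def by (rule vcomp_Nat[OF category_axioms category_axioms W_Fun])
qed

lemma generic_of_alg_comp_at:
  "X \<in> Obj C \<Longrightarrow> comp_at (generic_of_alg A P \<alpha>) X = comp_at \<alpha> X \<cdot>\<^bsub>C\<^esub> farr W (\<eta> X)"
  by (simp add: generic_of_alg_def)

end

context
  fixes \<beta> assumes \<beta>: "\<beta> \<in> Nat W t"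
begin

lemma alg_of_generic_comp_at:
  "X \<in> Obj C \<Longrightarrow> comp_at (alg_of_generic \<beta>) X = \<mu> X \<cdot>\<^bsub>C\<^esub> comp_at \<beta> (fobj t X)"
  using NatD_simps[OF \<beta> W_Fun] by (simp add: alg_of_generic_def Hom_def)

text \<open>For a Kleisli arrow \<open>g\<close> the extension \<open>\<mu> Y \<cdot> T g\<close> is
  a morphism of free algebras, so it passes \<mu> and becomes \<open>T\<close> of itself; then
  naturality of \<beta> in \<open>C\<close> carries it under \<open>W\<close>.\<close>

lemma alg_of_generic_Alg: "alg_of_generic \<beta> \<in> Alg T A P"
  unfolding Alg_eq
proof (rule NatI[OF _ _ WK_Fun kleisliK_Fun])
  note [simp] = NatD_simps[OF \<beta> W_Fun] alg_of_generic_comp_at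
  show "NDom (alg_of_generic \<beta>) = W \<circ>\<^sub>F K" "NCod (alg_of_generic \<beta>) = K"
    using compF_IdF[OF kleisliK_Fun] by (simp_all add: alg_of_generic_def)
  show "comp_at (alg_of_generic \<beta>) \<in> extensional (Obj (kleisli T))"
    by (simp add: alg_of_generic_def vcomp_def)
  fix f assume "f \<in> Arr (kleisli T)"
  then obtain X g Y where f: "f = (X, g, Y)" and X: "X \<in> Obj C" and Y: "Y \<in> Obj C"
    and g: "g \<in> Arr C" "Dom C g = X" "Cod C g = fobj t Y"
    by (cases f) (auto simp: Hom_def)
  let ?k = "\<mu> Y \<cdot>\<^bsub>C\<^esub> farr t g"
  have "?k \<cdot>\<^bsub>C\<^esub> (\<mu> X \<cdot>\<^bsub>C\<^esub> comp_at \<beta> (fobj t X)) = \<mu> Y \<cdot>\<^bsub>C\<^esub> ((farr t g \<cdot>\<^bsub>C\<^esub> \<mu> X) \<cdot>\<^bsub>C\<^esub> comp_at \<beta> (fobj t X))"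
    using X Y g by simp
  also have "\<dots> = (\<mu> Y \<cdot>\<^bsub>C\<^esub> \<mu> (fobj t Y)) \<cdot>\<^bsub>C\<^esub> (farr t (farr t g) \<cdot>\<^bsub>C\<^esub> comp_at \<beta> (fobj t X))"
    using X Y g mult_natural[OF g(1)] by simp
  also have "\<dots> = (\<mu> Y \<cdot>\<^bsub>C\<^esub> farr t (\<mu> Y)) \<cdot>\<^bsub>C\<^esub> (farr t (farr t g) \<cdot>\<^bsub>C\<^esub> comp_at \<beta> (fobj t X))"
    using Y by (simp only: mult_assoc)
  also have "\<dots> = \<mu> Y \<cdot>\<^bsub>C\<^esub> (farr t ?k \<cdot>\<^bsub>C\<^esub> comp_at \<beta> (fobj t X))"
    using X Y g by simp
  \<comment> \<open>Naturality of \<beta> is applied to the whole extension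
    \<open>?k : T X \<rightarrow> T Y\<close>; the rules that distribute functors over composition
    are switched off to keep it in one piece.\<close>
  also have "\<dots> = \<mu> Y \<cdot>\<^bsub>C\<^esub> (comp_at \<beta> (fobj t Y) \<cdot>\<^bsub>C\<^esub> farr W ?k)"
    using Nat_natural[OF \<beta> W_Fun, of ?k] X Y g by (simp del: T_simps W_simps add: T_simps(1-7))
  finally show "farr K f \<cdot>\<^bsub>C\<^esub> comp_at (alg_of_generic \<beta>) (Dom (kleisli T) f)
      = comp_at (alg_of_generic \<beta>) (Cod (kleisli T) f) \<cdot>\<^bsub>C\<^esub> farr (W \<circ>\<^sub>F K) f"
    using X Y g by (simp add: f Hom_def)
qed (use NatD_simps[OF \<beta> W_Fun] in \<open>auto simp: alg_of_generic_comp_at\<close>)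

text \<open>Naturality of \<beta> at \<open>\<eta> X\<close> turns the composite into
  \<open>\<mu> X \<cdot> T (\<eta> X)\<close> followed after \<open>\<beta> X\<close>, and the unit
  law removes it.\<close>

lemma generic_of_alg_of_generic: "generic_of_alg A P (alg_of_generic \<beta>) = \<beta>"
proof (rule Nat_eqI[OF generic_of_alg_Nat[OF alg_of_generic_Alg] \<beta> W_Fun])
  note [simp] = NatD_simps[OF \<beta> W_Fun]
  fix X assume X: "X \<in> Obj C"
  have "comp_at (generic_of_alg A P (alg_of_generic \<beta>)) X
      = \<mu> X \<cdot>\<^bsub>C\<^esub> (comp_at \<beta> (fobj t X) \<cdot>\<^bsub>C\<^esub> farr W (\<eta> X))"
    using X by (simp add: generic_of_alg_comp_at[OF alg_of_generic_Alg] alg_of_generic_comp_at)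
  also have "\<dots> = (\<mu> X \<cdot>\<^bsub>C\<^esub> farr t (\<eta> X)) \<cdot>\<^bsub>C\<^esub> comp_at \<beta> X"
    using X Nat_natural[OF \<beta> W_Fun, of "\<eta> X"] by simp
  also have "\<dots> = comp_at \<beta> X"
    using X by (simp only: mult_unitR) simp
  finally show "comp_at (generic_of_alg A P (alg_of_generic \<beta>)) X = comp_at \<beta> X" .
qed

end

lemma alg_of_generic_of_alg:
  assumes "\<alpha> \<in> Alg T A P"
  shows "alg_of_generic (generic_of_alg A P \<alpha>) = \<alpha>"
proof (rule Nat_eqI[OF _ _ WK_Fun])
  note g = generic_of_alg_Nat[OF assms]
  show "alg_of_generic (generic_of_alg A P \<alpha>) \<in> Nat (W \<circ>\<^sub>F K) K" "\<alpha> \<in> Nat (W \<circ>\<^sub>F K) K"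
    using alg_of_generic_Alg[OF g] assms by (simp_all add: Alg_eq)
  fix X assume "X \<in> Obj (kleisli T)"
  then show "comp_at (alg_of_generic (generic_of_alg A P \<alpha>)) X = comp_at \<alpha> X"
    using Alg_generic[OF assms, of X]
    by (simp add: alg_of_generic_comp_at[OF g] generic_of_alg_comp_at[OF assms])
qed

end

section \<open>Operations and generic effects along a strict lifting of monads\<close>

locale monad_lifting = T: monad_on B T + T': monad_on E T'
  for B :: "('ob, 'mb) cat" and T and E :: "('oe, 'me) cat" and T' +
  fixes p :: "('oe, 'me, 'ob, 'mb) func"
  assumes p_Fun: "p \<in> Fun E B"
    and p_mfun: "p \<circ>\<^sub>F mfun T' = mfun T \<circ>\<^sub>F p"
    and p_munit: "p \<rhd>\<^sub>N munit T' = munit T \<lhd>\<^sub>N p"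
    and p_mmult: "p \<rhd>\<^sub>N mmult T' = mmult T \<lhd>\<^sub>N p"
begin

lemmas p_simps [simp] = FunD_simps[OF p_Fun]

lemma p_lifting_simps [simp]:
  "X \<in> Obj E \<Longrightarrow> fobj p (fobj T'.t X) = fobj T.t (fobj p X)"
  "X \<in> Obj E \<Longrightarrow> farr p (T'.\<eta> X) = T.\<eta> (fobj p X)"
  "X \<in> Obj E \<Longrightarrow> farr p (T'.\<mu> X) = T.\<mu> (fobj p X)"
  "f \<in> Arr E \<Longrightarrow> farr p (farr T'.t f) = farr T.t (farr p f)"
  using p_mfun[THEN arg_cong[where f = "\<lambda>F. fobj F X"]] p_mfun[THEN arg_cong[where f = "\<lambda>F. farr F f"]]
   p_munit[THEN arg_cong[where f = "\<lambda>\<gamma>. comp_at \<gamma> X"]] p_mmult[THEN arg_cong[where f = "\<lambda>\<gamma>. comp_at \<gamma> X"]]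
  by simp_all

text \<open>Both sides are restricted to the same Kleisli category and are compared value by value.
  On arrows the point is that \<open>p\<close> carries the multiplication upstairs to the one
  downstairs, hence extensions to extensions.\<close>

lemma p_kleisliK: "p \<circ>\<^sub>F T'.K = T.K \<circ>\<^sub>F kleisli_ext p T' T"
proof (rule func.equality)
  show "fobj (p \<circ>\<^sub>F T'.K) = fobj (T.K \<circ>\<^sub>F kleisli_ext p T' T)"
    by (auto simp: compF_def kleisli_ext_def)
  show "farr (p \<circ>\<^sub>F T'.K) = farr (T.K \<circ>\<^sub>F kleisli_ext p T' T)"
  proof
    fix f show "farr (p \<circ>\<^sub>F T'.K) f = farr (T.K \<circ>\<^sub>F kleisli_ext p T' T) f"
      by (cases f) (auto simp: compF_def kleisli_ext_def Hom_def)
  qed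
qed (auto simp: kleisli_ext_def)

end

locale monad_lifting_with_powers = monad_lifting B T E T' p
    + PB: monad_with_powers B T A PB + PE: monad_with_powers E T' A PE
  for B :: "('ob, 'mb) cat" and T and E :: "('oe, 'me) cat" and T' p A PB PE
begin

abbreviation "\<kappa> \<equiv> comp_at (power_comparison p A PE PB)"

lemmas \<kappa>_Nat = power_comparison_Nat[OF T'.category_axioms T.category_axioms p_Fun PE.powers PB.powers]
lemmas \<kappa>_natural = power_comparison_natural[OF T'.category_axioms T.category_axioms p_Fun PE.powers PB.powers]
lemmas \<kappa>_simps [simp] = HomD[OF power_comparison_Hom[OF _ p_Fun PE.powers PB.powers]]

lemma NDom_\<kappa> [simp]: "NDom (power_comparison p A PE PB) = p \<circ>\<^sub>F PE.W"
  using compF_IdF[OF PE.W_Fun] by (simp add: power_comparison_def fpower_def)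

text \<open>By \<open>p_kleisliK\<close> the two transformations in the condition have the same
  domain and codomain, so the condition reduces to an equation in \<open>B\<close> for each object
  of \<open>E\<close>. The comparison occurs at \<open>T' X\<close>, the object whose power is the
  source of the operation.\<close>

lemma Alg_over_iff:
  assumes "\<alpha> \<in> Alg T A PB"
  shows "\<alpha>' \<in> Alg_over p T A PE PB \<alpha> T' \<longleftrightarrow> \<alpha>' \<in> Alg T' A PE \<and>
    (\<forall>X\<in>Obj E. farr p (comp_at \<alpha>' X) = comp_at \<alpha> (fobj p X) \<cdot>\<^bsub>B\<^esub> \<kappa> (fobj T'.t X))"
proof (cases "\<alpha>' \<in> Alg T' A PE")
  case True
  let ?r = "(\<alpha> \<lhd>\<^sub>N kleisli_ext p T' T) \<bullet>\<^sub>N (power_comparison p A PE PB \<lhd>\<^sub>N T'.K)"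
  note [simp] = PE.Alg_simps[OF True] PB.Alg_simps[OF assms]
  have eq: "comp_at ?r X = comp_at \<alpha> (fobj p X) \<cdot>\<^bsub>B\<^esub> \<kappa> (fobj T'.t X)" if "X \<in> Obj E" for X
    using that by (simp add: kleisli_ext_def)
  have "p \<rhd>\<^sub>N \<alpha>' = ?r \<longleftrightarrow> comp_at (p \<rhd>\<^sub>N \<alpha>') = comp_at ?r"
  proof -
    have "NDom (p \<rhd>\<^sub>N \<alpha>') = NDom ?r" "NCod (p \<rhd>\<^sub>N \<alpha>') = NCod ?r"
      using p_kleisliK by (simp_all add: compF_assoc[OF T'.kleisliK_Fun PE.W_Fun])
    then show ?thesis by (metis ntrans.equality old.unit.exhaust)
  qed
  also have "\<dots> \<longleftrightarrow> (\<forall>X\<in>Obj E. comp_at (p \<rhd>\<^sub>N \<alpha>') X = comp_at ?r X)"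
  proof -
    have "comp_at (p \<rhd>\<^sub>N \<alpha>') \<in> extensional (Obj E)" "comp_at ?r \<in> extensional (Obj E)"
      by (simp_all add: whiskerL_def vcomp_def)
    then show ?thesis by (metis extensionalityI)
  qed
  finally show ?thesis
    using True by (simp add: Alg_over_def eq del: comp_at_vcomp)
qed (auto simp: Alg_over_def)

text \<open>The generic effect of \<alpha>, restricted along \<open>p\<close> and precomposed with
  \<kappa>: what \<open>p\<close> must send the generic effect of an operation over \<alpha> to, and
  the transformation that \<open>phi_beta\<close> lifts.\<close>

definition generic_base :: "('ob, 'ob \<times> 'mb \<times> 'ob, 'ob, 'mb) ntrans \<Rightarrow> ('oe, 'me, 'ob, 'mb) ntrans" where
  "generic_base \<alpha> = (\<alpha> \<lhd>\<^sub>N (T.J \<circ>\<^sub>F p)) \<bullet>\<^sub>N (PB.W \<rhd>\<^sub>N (munit T \<lhd>\<^sub>N p)) \<bullet>\<^sub>N power_comparison p A PE PB"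

lemma generic_base_comp_at:
  "X \<in> Obj E \<Longrightarrow> comp_at (generic_base \<alpha>) X
    = comp_at \<alpha> (fobj p X) \<cdot>\<^bsub>B\<^esub> (farr PB.W (T.\<eta> (fobj p X)) \<cdot>\<^bsub>B\<^esub> \<kappa> X)"
  by (simp add: generic_base_def)

lemma generic_base_Nat:
  assumes "\<alpha> \<in> Alg T A PB"
  shows "generic_base \<alpha> \<in> Nat (p \<circ>\<^sub>F PE.W) (p \<circ>\<^sub>F T'.t)"
proof -
  note B = T.category_axioms and E = T'.category_axioms
  have "munit T \<lhd>\<^sub>N p \<in> Nat p (T.t \<circ>\<^sub>F p)"
    using whiskerR_Nat[OF E p_Fun IdF_Fun[OF B] T.unit_Nat] by (simp add: IdF_compF[OF p_Fun])
  then have "PB.W \<rhd>\<^sub>N (munit T \<lhd>\<^sub>N p) \<in> Nat (PB.W \<circ>\<^sub>F p) (PB.W \<circ>\<^sub>F (T.t \<circ>\<^sub>F p))"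
    by (rule whiskerL_Nat[OF E p_Fun _ PB.W_Fun])
  with \<kappa>_Nat have 1: "(PB.W \<rhd>\<^sub>N (munit T \<lhd>\<^sub>N p)) \<bullet>\<^sub>N power_comparison p A PE PB
      \<in> Nat (p \<circ>\<^sub>F PE.W) (PB.W \<circ>\<^sub>F (T.t \<circ>\<^sub>F p))"
    by (rule vcomp_Nat[OF E B compF_Fun[OF E PE.W_Fun p_Fun]])
  have Jp: "T.J \<circ>\<^sub>F p \<in> Fun E (kleisli T)"
    by (rule compF_Fun[OF E p_Fun T.kleisliJ_Fun])
  have KJp: "T.K \<circ>\<^sub>F (T.J \<circ>\<^sub>F p) = T.t \<circ>\<^sub>F p"
    by (simp add: compF_assoc[OF p_Fun T.kleisliJ_Fun, symmetric] T.kleisliK_kleisliJ)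
  have "\<alpha> \<lhd>\<^sub>N (T.J \<circ>\<^sub>F p) \<in> Nat (PB.W \<circ>\<^sub>F (T.t \<circ>\<^sub>F p)) (T.t \<circ>\<^sub>F p)"
    using whiskerR_Nat[OF E Jp PB.WK_Fun assms[unfolded PB.Alg_eq]]
    by (simp add: compF_assoc[OF Jp T.kleisliK_Fun] KJp)
  with 1 show ?thesis
    unfolding generic_base_def p_mfun by (rule vcomp_Nat[OF E B compF_Fun[OF E PE.W_Fun p_Fun]])
qed

lemma generic_over_iff:
  assumes "\<alpha> \<in> Alg T A PB" "\<beta> \<in> Nat PE.W T'.t"
  shows "p \<rhd>\<^sub>N \<beta> = generic_base \<alpha> \<longleftrightarrow>
    (\<forall>X\<in>Obj E. farr p (comp_at \<beta> X) = comp_at \<alpha> (fobj p X) \<cdot>\<^bsub>B\<^esub> (farr PB.W (T.\<eta> (fobj p X)) \<cdot>\<^bsub>B\<^esub> \<kappa> X))"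
proof -
  note E = T'.category_axioms
  note p\<beta> = whiskerL_Nat[OF E PE.W_Fun assms(2) p_Fun]
  have eq: "comp_at (p \<rhd>\<^sub>N \<beta>) X = farr p (comp_at \<beta> X)" if "X \<in> Obj E" for X
    using that by (simp add: NatD_simps[OF assms(2) PE.W_Fun])
  show ?thesis
    using Nat_eqI[OF p\<beta> generic_base_Nat[OF assms(1)] compF_Fun[OF E PE.W_Fun p_Fun]]
    by (metis eq generic_base_comp_at)
qed

text \<open>The two maps are mutually inverse by the previous results; the content is that they
  respect the conditions over \<alpha>. From \<beta> to operations this is
  \<open>Alg_generic\<close> for \<alpha> at \<open>p X\<close>; in the other direction \<kappa> is
  moved past the power of the lifted unit by naturality.\<close>

lemma bij_betw_alg_of_generic:
  assumes \<alpha>: "\<alpha> \<in> Alg T A PB"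
  shows "bij_betw T'.alg_of_generic {\<beta> \<in> Nat PE.W T'.t. p \<rhd>\<^sub>N \<beta> = generic_base \<alpha>}
    (Alg_over p T A PE PB \<alpha> T')"
proof (rule bij_betwI[where g = "T'.generic_of_alg A PE"])
  note [simp] = PB.Alg_simps[OF \<alpha>]
  show "T'.alg_of_generic \<in> {\<beta> \<in> Nat PE.W T'.t. p \<rhd>\<^sub>N \<beta> = generic_base \<alpha>}
      \<rightarrow> Alg_over p T A PE PB \<alpha> T'"
  proof
    fix \<beta> assume "\<beta> \<in> {\<beta> \<in> Nat PE.W T'.t. p \<rhd>\<^sub>N \<beta> = generic_base \<alpha>}"
    then have \<beta>: "\<beta> \<in> Nat PE.W T'.t" and over: "X \<in> Obj E \<Longrightarrow> farr p (comp_at \<beta> X)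
       = comp_at \<alpha> (fobj p X) \<cdot>\<^bsub>B\<^esub> (farr PB.W (T.\<eta> (fobj p X)) \<cdot>\<^bsub>B\<^esub> \<kappa> X)" for X
      using generic_over_iff[OF \<alpha>] by auto
    note [simp] = NatD_simps[OF \<beta> PE.W_Fun]
    have "farr p (comp_at (T'.alg_of_generic \<beta>) X) = comp_at \<alpha> (fobj p X) \<cdot>\<^bsub>B\<^esub> \<kappa> (fobj T'.t X)"
      if X: "X \<in> Obj E" for X
    proof -
      let ?Y = "fobj p X"
      have "farr p (comp_at (T'.alg_of_generic \<beta>) X)
         = T.\<mu> ?Y \<cdot>\<^bsub>B\<^esub> (comp_at \<alpha> (fobj T.t ?Y) \<cdot>\<^bsub>B\<^esub> (farr PB.W (T.\<eta> (fobj T.t ?Y)) \<cdot>\<^bsub>B\<^esub> \<kappa> (fobj T'.t X)))"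
        using X by (simp add: PE.alg_of_generic_comp_at[OF \<beta>] over)
      also have "\<dots> = (T.\<mu> ?Y \<cdot>\<^bsub>B\<^esub> (comp_at \<alpha> (fobj T.t ?Y) \<cdot>\<^bsub>B\<^esub> farr PB.W (T.\<eta> (fobj T.t ?Y)))) \<cdot>\<^bsub>B\<^esub> \<kappa> (fobj T'.t X)"
        using X by simp
      also have "\<dots> = comp_at \<alpha> (fobj p X) \<cdot>\<^bsub>B\<^esub> \<kappa> (fobj T'.t X)"
        using X by (subst PB.Alg_generic[OF \<alpha>]) simp_all
      finally show ?thesis .
    qed
    then show "T'.alg_of_generic \<beta> \<in> Alg_over p T A PE PB \<alpha> T'"
      using PE.alg_of_generic_Alg[OF \<beta>] by (simp add: Alg_over_iff[OF \<alpha>])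
  qed
  show "T'.generic_of_alg A PE \<in> Alg_over p T A PE PB \<alpha> T'
      \<rightarrow> {\<beta> \<in> Nat PE.W T'.t. p \<rhd>\<^sub>N \<beta> = generic_base \<alpha>}"
  proof
    fix \<alpha>' assume "\<alpha>' \<in> Alg_over p T A PE PB \<alpha> T'"
    then have \<alpha>': "\<alpha>' \<in> Alg T' A PE" and over: "X \<in> Obj E \<Longrightarrow>
      farr p (comp_at \<alpha>' X) = comp_at \<alpha> (fobj p X) \<cdot>\<^bsub>B\<^esub> \<kappa> (fobj T'.t X)" for X
      by (simp_all add: Alg_over_iff[OF \<alpha>])
    note [simp] = PE.Alg_simps[OF \<alpha>']
    have "farr p (comp_at (T'.generic_of_alg A PE \<alpha>') X)
        = comp_at \<alpha> (fobj p X) \<cdot>\<^bsub>B\<^esub> (farr PB.W (T.\<eta> (fobj p X)) \<cdot>\<^bsub>B\<^esub> \<kappa> X)" if X: "X \<in> Obj E" for X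
    proof -
      have "farr p (comp_at (T'.generic_of_alg A PE \<alpha>') X)
        = comp_at \<alpha> (fobj p X) \<cdot>\<^bsub>B\<^esub> (\<kappa> (fobj T'.t X) \<cdot>\<^bsub>B\<^esub> farr p (farr PE.W (T'.\<eta> X)))"
        using X by (simp add: PE.generic_of_alg_comp_at[OF \<alpha>'] over)
      also have "\<dots> = comp_at \<alpha> (fobj p X) \<cdot>\<^bsub>B\<^esub> (farr PB.W (T.\<eta> (fobj p X)) \<cdot>\<^bsub>B\<^esub> \<kappa> X)"
        using X \<kappa>_natural[of "T'.\<eta> X"] by simp
      finally show ?thesis .
    qed
    then show "T'.generic_of_alg A PE \<alpha>' \<in> {\<beta> \<in> Nat PE.W T'.t. p \<rhd>\<^sub>N \<beta> = generic_base \<alpha>}"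
      using PE.generic_of_alg_Nat[OF \<alpha>'] by (simp add: generic_over_iff[OF \<alpha>])
  qed
qed (auto simp: PE.generic_of_alg_of_generic PE.alg_of_generic_of_alg Alg_over_iff[OF \<alpha>])

end

section \<open>The codensity lifting is a monad lifting\<close>

locale codensity = A: category \<A> + E: category E + T: monad_on B T
  for \<A> :: "('oa, 'ma) cat" and E :: "('oe, 'me) cat" and B :: "('ob, 'mb) cat" and T +
  fixes p :: "('oe, 'me, 'ob, 'mb) func" and R :: "('oa, 'ma, 'ob, 'ob \<times> 'mb \<times> 'ob) func"
    and S :: "('oa, 'ma, 'oe, 'me) func" and G c \<sigma>
  assumes p_Fun: "p \<in> Fun E B"
    and parameter: "lifting_parameter \<A> E p T R S"
    and condition: "codensity_condition p S G c"
    and cartesian: "codensity_cartesian p T R S G c \<sigma>"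
begin

text \<open>The transpose of \<open>K \<epsilon> R\<close>, that is, the transformation
  \<open>T p \<rightarrow> p Ran\<close> in the base over which \<sigma> is cartesian.\<close>

abbreviation "\<tau> \<equiv> ran_transpose S (p \<circ>\<^sub>F G) (p \<rhd>\<^sub>N c) (T.t \<circ>\<^sub>F p) (T.K \<rhd>\<^sub>N (kleisli_counit T \<lhd>\<^sub>N R))"
abbreviation "TT \<equiv> NDom \<sigma>"
abbreviation "u \<equiv> codensity_unit S G c"
abbreviation "m \<equiv> codensity_mult S G c"

lemma R_Fun: "R \<in> Fun \<A> (kleisli T)" and S_Fun: "S \<in> Fun \<A> E"
  and K_R: "T.K \<circ>\<^sub>F R = p \<circ>\<^sub>F S"
  using parameter by (auto simp: lifting_parameter_def)

lemmas func_simps [simp] = FunD_simps[OF p_Fun] FunD_simps[OF S_Fun] FunD_simps(1-3)[OF R_Fun, simplified]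

lemma ran: "is_ran S S G c" "is_ran S (p \<circ>\<^sub>F S) (p \<circ>\<^sub>F G) (p \<rhd>\<^sub>N c)"
  using condition by (auto simp: codensity_condition_def)

lemma G_Fun: "G \<in> Fun E E" and c_Nat: "c \<in> Nat (G \<circ>\<^sub>F S) S"
  using ran(1) by (auto simp: is_ran_def)

lemmas G_simps [simp] = FunD_simps[OF G_Fun]

lemma composite_Fun:
  "G \<circ>\<^sub>F S \<in> Fun \<A> E" "p \<circ>\<^sub>F S \<in> Fun \<A> B" "p \<circ>\<^sub>F G \<in> Fun E B" "G \<circ>\<^sub>F G \<in> Fun E E"
  "T.t \<circ>\<^sub>F p \<in> Fun E B" "IdF E \<in> Fun E E"
  using compF_Fun[OF A.category_axioms S_Fun G_Fun] compF_Fun[OF A.category_axioms S_Fun p_Fun]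
    compF_Fun[OF E.category_axioms G_Fun p_Fun] compF_Fun[OF E.category_axioms G_Fun G_Fun]
    compF_Fun[OF E.category_axioms p_Fun T.T_Fun] IdF_Fun[OF E.category_axioms] by auto

lemmas c_simps [simp] = NatD_simps[OF c_Nat composite_Fun(1), simplified]

lemma R_obj [simp]: "a \<in> Obj \<A> \<Longrightarrow> fobj T.t (fobj R a) = fobj p (fobj S a)"
  using K_R[THEN arg_cong[where f = "\<lambda>F. fobj F a"]] by simp

text \<open>The domain is \<open>T p S\<close> because \<open>K J = T\<close> and
  \<open>K R = p S\<close>. The component at \<open>a\<close> is \<open>\<mu> (R a)\<close>, and
  \<open>p (S f)\<close> is the extension of the Kleisli arrow \<open>R f\<close>, so naturality
  says that extensions commute with multiplication.\<close>

lemma counit_Nat: "T.K \<rhd>\<^sub>N (kleisli_counit T \<lhd>\<^sub>N R) \<in> Nat ((T.t \<circ>\<^sub>F p) \<circ>\<^sub>F S) (p \<circ>\<^sub>F S)"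
proof (rule NatI)
  show "NDom (T.K \<rhd>\<^sub>N (kleisli_counit T \<lhd>\<^sub>N R)) = (T.t \<circ>\<^sub>F p) \<circ>\<^sub>F S"
    using compF_assoc[OF R_Fun T.kleisliK_Fun, of T.J]
      compF_assoc[OF composite_Fun(2) T.kleisliJ_Fun, of T.K]
    by (simp add: K_R T.kleisliK_kleisliJ compF_assoc[OF S_Fun p_Fun])
  show "NCod (T.K \<rhd>\<^sub>N (kleisli_counit T \<lhd>\<^sub>N R)) = p \<circ>\<^sub>F S"
    by (simp add: IdF_compF[OF R_Fun] K_R)
  show "(T.t \<circ>\<^sub>F p) \<circ>\<^sub>F S \<in> Fun \<A> B" "p \<circ>\<^sub>F S \<in> Fun \<A> B"
    using composite_Fun compF_Fun[OF A.category_axioms S_Fun] by auto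
  show "comp_at (T.K \<rhd>\<^sub>N (kleisli_counit T \<lhd>\<^sub>N R)) \<in> extensional (Obj \<A>)"
    by (simp add: whiskerL_def)
  fix f assume f: "f \<in> Arr \<A>"
  obtain X g Y where Rf: "farr R f = (X, g, Y)" by (cases "farr R f") auto
  have *: "X \<in> Obj B" "Y \<in> Obj B" "g \<in> Arr B" "Dom B g = X" "Cod B g = fobj T.t Y"
    "fobj R (Dom \<A> f) = X" "fobj R (Cod \<A> f) = Y"
    using Fun_arr[OF R_Fun f] Fun_dom[OF R_Fun f] Fun_cod[OF R_Fun f] by (auto simp: Rf Hom_def)
  have pS: "farr p (farr S f) = T.\<mu> Y \<cdot>\<^bsub>B\<^esub> farr T.t g"
    using K_R[THEN arg_cong[where f = "\<lambda>F. farr F f"]] f * by (simp add: Rf Hom_def)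
  have "(T.\<mu> Y \<cdot>\<^bsub>B\<^esub> farr T.t g) \<cdot>\<^bsub>B\<^esub> T.\<mu> X = (T.\<mu> Y \<cdot>\<^bsub>B\<^esub> T.\<mu> (fobj T.t Y)) \<cdot>\<^bsub>B\<^esub> farr T.t (farr T.t g)"
    using * T.mult_natural[of g] by simp
  also have "\<dots> = T.\<mu> Y \<cdot>\<^bsub>B\<^esub> farr T.t (T.\<mu> Y \<cdot>\<^bsub>B\<^esub> farr T.t g)"
    using * by (subst T.mult_assoc) simp_all
  finally show "farr (p \<circ>\<^sub>F S) f \<cdot>\<^bsub>B\<^esub> comp_at (T.K \<rhd>\<^sub>N (kleisli_counit T \<lhd>\<^sub>N R)) (Dom \<A> f) =
         comp_at (T.K \<rhd>\<^sub>N (kleisli_counit T \<lhd>\<^sub>N R)) (Cod \<A> f) \<cdot>\<^bsub>B\<^esub> farr ((T.t \<circ>\<^sub>F p) \<circ>\<^sub>F S) f"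
    using f * R_obj[of "Dom \<A> f"] R_obj[of "Cod \<A> f"] by (simp add: Hom_def pS del: R_obj)
qed (auto simp: Hom_def)

lemma \<tau>_Nat: "\<tau> \<in> Nat (T.t \<circ>\<^sub>F p) (p \<circ>\<^sub>F G)"
  by (rule ran_transpose(1)[OF ran(2) _ counit_Nat]) (simp add: composite_Fun)

lemmas \<tau>_simps [simp] = NatD_simps[OF \<tau>_Nat composite_Fun(5), simplified]

text \<open>The defining equation of the transpose, with \<open>K \<epsilon> R\<close> evaluated to
  \<mu>. Calculations with \<tau> at objects \<open>S a\<close> rest on it.\<close>

lemma c_\<tau>: "a \<in> Obj \<A> \<Longrightarrow> farr p (comp_at c a) \<cdot>\<^bsub>B\<^esub> comp_at \<tau> (fobj S a) = T.\<mu> (fobj R a)"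
  using ran_transpose_comp_at[OF ran(2) composite_Fun(5) counit_Nat S_Fun composite_Fun(2), of a]
  by (simp add: Hom_def)

lemma \<sigma>_props:
  shows NCod_\<sigma> [simp]: "NCod \<sigma> = G" and p_\<sigma>: "p \<rhd>\<^sub>N \<sigma> = \<tau>" and TT_Fun: "TT \<in> Fun E E"
    and \<sigma>_Nat: "\<sigma> \<in> Nat TT G"
    and cart: "Defs.cartesian (postcomp E p) \<sigma>"
proof -
  show c: "Defs.cartesian (postcomp E p) \<sigma>"
    using cartesian by (simp add: codensity_cartesian_def cartesian_lifting_def)
  show T: "TT \<in> Fun E E" by (rule cartesian_postcomp_NDom[OF c p_Fun])
  show N: "NCod \<sigma> = G"
    using cartesian by (simp add: codensity_cartesian_def cartesian_lifting_def postcomp_def functor_cat_def)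
  show *: "\<sigma> \<in> Nat TT G" using cartesian_postcomp_Nat[OF c p_Fun] N by simp
  have "\<sigma> \<in> Arr (functor_cat E E)" using c by (simp add: cartesian_def postcomp_def)
  then show "p \<rhd>\<^sub>N \<sigma> = \<tau>"
    using cartesian by (simp add: codensity_cartesian_def cartesian_lifting_def postcomp_def)
qed

lemmas TT_simps [simp] = FunD_simps[OF TT_Fun]
lemmas \<sigma>_simps [simp] = NatD_simps(3-)[OF \<sigma>_Nat TT_Fun]

lemma p_\<sigma>_comp_at [simp]: "X \<in> Obj E \<Longrightarrow> farr p (comp_at \<sigma> X) = comp_at \<tau> X"
  using p_\<sigma>[THEN arg_cong[where f = "\<lambda>\<gamma>. comp_at \<gamma> X"]] by simp

text \<open>Already contained in \<open>p_\<sigma>\<close>: equal transformations have equal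
  domains.\<close>

lemma p_TT: "p \<circ>\<^sub>F TT = T.t \<circ>\<^sub>F p"
  using p_\<sigma>[THEN arg_cong[where f = NDom]] by simp

lemma p_TT_TT: "(T.t \<circ>\<^sub>F T.t) \<circ>\<^sub>F p = p \<circ>\<^sub>F (TT \<circ>\<^sub>F TT)"
proof -
  have "p \<circ>\<^sub>F (TT \<circ>\<^sub>F TT) = (T.t \<circ>\<^sub>F p) \<circ>\<^sub>F TT"
    by (simp only: compF_assoc[OF TT_Fun TT_Fun, symmetric] p_TT)
  also have "\<dots> = T.t \<circ>\<^sub>F (T.t \<circ>\<^sub>F p)"
    by (simp only: compF_assoc[OF TT_Fun p_Fun] p_TT)
  finally show ?thesis
    by (simp only: compF_assoc[OF p_Fun T.T_Fun])
qed

lemma p_TT_simps [simp]: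
  "X \<in> Obj E \<Longrightarrow> fobj p (fobj TT X) = fobj T.t (fobj p X)"
  "f \<in> Arr E \<Longrightarrow> farr p (farr TT f) = farr T.t (farr p f)"
  using p_TT[THEN arg_cong[where f = "\<lambda>F. fobj F X"]] p_TT[THEN arg_cong[where f = "\<lambda>F. farr F f"]]
  by simp_all

section \<open>Factorisation through the cartesian transformation \<sigma>\<close>

text \<open>The common source of the lifted unit, the lifted multiplication and the generic effect
  \<beta>: each arises from a transformation into \<open>G\<close> and one into \<open>p TT\<close>
  in the base that agree after \<tau>.\<close>

lemma lift_ex1:
  assumes H: "H \<in> Fun E E" and \<gamma>: "\<gamma> \<in> Nat H G" and w: "w \<in> Nat (p \<circ>\<^sub>F H) (p \<circ>\<^sub>F TT)"
    and eq: "\<And>X. X \<in> Obj E \<Longrightarrow> comp_at \<tau> X \<cdot>\<^bsub>B\<^esub> comp_at w X = farr p (comp_at \<gamma> X)"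
  shows "\<exists>!h. h \<in> Nat H TT \<and> p \<rhd>\<^sub>N h = w \<and> \<sigma> \<bullet>\<^sub>N h = \<gamma>"
proof (rule cartesian_postcomp_ex1[OF cart p_Fun E.category_axioms H _ w])
  note E = E.category_axioms and B = T.category_axioms
  have pH: "p \<circ>\<^sub>F H \<in> Fun E B" by (rule compF_Fun[OF E H p_Fun])
  show "\<gamma> \<in> Nat H (NCod \<sigma>)" using \<gamma> by simp
  show "(p \<rhd>\<^sub>N \<sigma>) \<bullet>\<^sub>N w = p \<rhd>\<^sub>N \<gamma>"
  proof (rule Nat_eqI[OF vcomp_Nat[OF E B pH w] whiskerL_Nat[OF E H \<gamma> p_Fun] pH])
    show "p \<rhd>\<^sub>N \<sigma> \<in> Nat (p \<circ>\<^sub>F TT) (p \<circ>\<^sub>F G)"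
      by (rule whiskerL_Nat[OF E TT_Fun \<sigma>_Nat p_Fun])
    fix X assume "X \<in> Obj E"
    then show "comp_at ((p \<rhd>\<^sub>N \<sigma>) \<bullet>\<^sub>N w) X = comp_at (p \<rhd>\<^sub>N \<gamma>) X"
      using eq by (simp add: NatD_simps[OF w pH] NatD_simps[OF \<gamma> H] FunD_simps[OF H] FunD_simps[OF pH])
  qed
qed

text \<open>Both \<open>h\<close> and \<open>h'\<close> are factorisations of
  \<open>\<sigma> \<bullet>\<^sub>N h\<close> through \<sigma> over
  \<open>p \<rhd>\<^sub>N h\<close>, so uniqueness identifies them.\<close>

lemma lift_eqI:
  assumes H: "H \<in> Fun E E" and h: "h \<in> Nat H TT" and h': "h' \<in> Nat H TT"
    and p: "\<And>X. X \<in> Obj E \<Longrightarrow> farr p (comp_at h X) = farr p (comp_at h' X)"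
    and \<sigma>: "\<And>X. X \<in> Obj E \<Longrightarrow> comp_at \<sigma> X \<cdot>\<^bsub>E\<^esub> comp_at h X = comp_at \<sigma> X \<cdot>\<^bsub>E\<^esub> comp_at h' X"
  shows "h = h'"
proof -
  note E = E.category_axioms
  note [simp] = FunD_simps[OF H] NatD_simps[OF h H] NatD_simps[OF h' H]
  note \<sigma>h = vcomp_Nat[OF E E H _ \<sigma>_Nat] and ph = whiskerL_Nat[OF E H _ p_Fun]
  have "\<exists>!k. k \<in> Nat H TT \<and> p \<rhd>\<^sub>N k = p \<rhd>\<^sub>N h \<and> \<sigma> \<bullet>\<^sub>N k = \<sigma> \<bullet>\<^sub>N h"
    by (rule lift_ex1[OF H \<sigma>h[OF h] ph[OF h]]) simp
  moreover have "p \<rhd>\<^sub>N h' = p \<rhd>\<^sub>N h"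
    using p by (intro Nat_eqI[OF ph[OF h'] ph[OF h] compF_Fun[OF E H p_Fun]]) simp
  moreover have "\<sigma> \<bullet>\<^sub>N h' = \<sigma> \<bullet>\<^sub>N h"
    using \<sigma> by (intro Nat_eqI[OF \<sigma>h[OF h'] \<sigma>h[OF h] H]) simp
  ultimately show ?thesis using h h' by blast
qed

text \<open>Naturality of \<gamma> at the arrow \<open>c : G (S a) \<rightarrow> S a\<close>, used
  to exchange \<open>u\<close> or \<open>m\<close> with \<open>c\<close>.\<close>

lemma c_natural:
  assumes "\<gamma> \<in> Nat H H'" "H \<in> Fun E D" "a \<in> Obj \<A>"
  shows "farr H' (comp_at c a) \<cdot>\<^bsub>D\<^esub> comp_at \<gamma> (fobj G (fobj S a))
    = comp_at \<gamma> (fobj S a) \<cdot>\<^bsub>D\<^esub> farr H (comp_at c a)"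
  using Nat_natural[OF assms(1,2), of "comp_at c a"] assms(3) by simp

section \<open>The codensity monad on \<open>E\<close>\<close>

lemmas ran_E_eqI = ran_eqI[OF ran(1) _ _ A.category_axioms E.category_axioms _ S_Fun S_Fun]
lemmas ran_B_eqI = ran_eqI[OF ran(2) _ _ A.category_axioms T.category_axioms _ S_Fun composite_Fun(2)]

lemma u_Nat: "u \<in> Nat (IdF E) G"
  and c_u: "a \<in> Obj \<A> \<Longrightarrow> comp_at c a \<cdot>\<^bsub>E\<^esub> comp_at u (fobj S a) = Ident E (fobj S a)"
proof -
  have "idN S \<in> Nat (IdF E \<circ>\<^sub>F S) S"
    by (simp add: IdF_compF[OF S_Fun] idN_Nat[OF A.category_axioms E.category_axioms S_Fun])
  from ran_transpose(1)[OF ran(1) _ this] ran_transpose_comp_at[OF ran(1) composite_Fun(6) this S_Fun S_Fun]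
  show "u \<in> Nat (IdF E) G"
    "a \<in> Obj \<A> \<Longrightarrow> comp_at c a \<cdot>\<^bsub>E\<^esub> comp_at u (fobj S a) = Ident E (fobj S a)"
    by (simp_all add: codensity_unit_def composite_Fun)
qed

lemma m_Nat: "m \<in> Nat (G \<circ>\<^sub>F G) G"
  and c_m: "a \<in> Obj \<A> \<Longrightarrow> comp_at c a \<cdot>\<^bsub>E\<^esub> comp_at m (fobj S a)
    = comp_at c a \<cdot>\<^bsub>E\<^esub> farr G (comp_at c a)"
proof -
  have "G \<rhd>\<^sub>N c \<in> Nat ((G \<circ>\<^sub>F G) \<circ>\<^sub>F S) (G \<circ>\<^sub>F S)"
    using whiskerL_Nat[OF A.category_axioms composite_Fun(1) c_Nat G_Fun]
    by (simp add: compF_assoc[OF S_Fun G_Fun])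
  from vcomp_Nat[OF A.category_axioms E.category_axioms _ this c_Nat]
  have "c \<bullet>\<^sub>N (G \<rhd>\<^sub>N c) \<in> Nat ((G \<circ>\<^sub>F G) \<circ>\<^sub>F S) S"
    using compF_Fun[OF A.category_axioms S_Fun composite_Fun(4)] by simp
  from ran_transpose(1)[OF ran(1) _ this] ran_transpose_comp_at[OF ran(1) composite_Fun(4) this S_Fun S_Fun]
  show "m \<in> Nat (G \<circ>\<^sub>F G) G"
    "a \<in> Obj \<A> \<Longrightarrow> comp_at c a \<cdot>\<^bsub>E\<^esub> comp_at m (fobj S a)
      = comp_at c a \<cdot>\<^bsub>E\<^esub> farr G (comp_at c a)"
    by (simp_all add: codensity_mult_def composite_Fun)
qed

lemmas u_simps [simp] = NatD_simps[OF u_Nat composite_Fun(6), simplified]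
lemmas m_simps [simp] = NatD_simps[OF m_Nat composite_Fun(4), simplified]

text \<open>Composites are kept bracketed to the right, so the law is needed with a further arrow
  \<open>f\<close> behind it; the same holds for \<open>m\<close> below.\<close>

lemma c_u_comp:
  assumes "a \<in> Obj \<A>" "f \<in> Arr E" "Cod E f = fobj S a"
  shows "comp_at c a \<cdot>\<^bsub>E\<^esub> (comp_at u (fobj S a) \<cdot>\<^bsub>E\<^esub> f) = f"
proof -
  have "comp_at c a \<cdot>\<^bsub>E\<^esub> (comp_at u (fobj S a) \<cdot>\<^bsub>E\<^esub> f) = (comp_at c a \<cdot>\<^bsub>E\<^esub> comp_at u (fobj S a)) \<cdot>\<^bsub>E\<^esub> f"
    using assms by simp
  then show ?thesis using assms by (simp only: c_u) simp
qed

lemma c_m_comp: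
  assumes "a \<in> Obj \<A>" "f \<in> Arr E" "Cod E f = fobj G (fobj G (fobj S a))"
  shows "comp_at c a \<cdot>\<^bsub>E\<^esub> (comp_at m (fobj S a) \<cdot>\<^bsub>E\<^esub> f) = comp_at c a \<cdot>\<^bsub>E\<^esub> (farr G (comp_at c a) \<cdot>\<^bsub>E\<^esub> f)"
proof -
  have "comp_at c a \<cdot>\<^bsub>E\<^esub> (comp_at m (fobj S a) \<cdot>\<^bsub>E\<^esub> f) = (comp_at c a \<cdot>\<^bsub>E\<^esub> comp_at m (fobj S a)) \<cdot>\<^bsub>E\<^esub> f"
    using assms by simp
  then show ?thesis using assms by (simp add: c_m)
qed

text \<open>Each law is tested at \<open>S a\<close> after composition with \<open>c\<close>. There
  \<open>u\<close> cancels and \<open>m\<close> may be replaced by \<open>G c\<close>, which leaves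
  identities about \<open>c\<close> alone.\<close>

lemma codensity_monad: "is_monad E \<lparr>mfun = G, munit = u, mmult = m\<rparr>"
proof -
  note E = E.category_axioms
  note GGG_Fun = compF_Fun[OF E composite_Fun(4) G_Fun]
  have uG: "u \<lhd>\<^sub>N G \<in> Nat G (G \<circ>\<^sub>F G)"
    using whiskerR_Nat[OF E G_Fun composite_Fun(6) u_Nat] by (simp add: IdF_compF[OF G_Fun])
  have Gu: "G \<rhd>\<^sub>N u \<in> Nat G (G \<circ>\<^sub>F G)"
    using whiskerL_Nat[OF E composite_Fun(6) u_Nat G_Fun] by (simp add: compF_IdF[OF G_Fun])
  have mG: "m \<lhd>\<^sub>N G \<in> Nat (G \<circ>\<^sub>F (G \<circ>\<^sub>F G)) (G \<circ>\<^sub>F G)"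
    using whiskerR_Nat[OF E G_Fun composite_Fun(4) m_Nat] by (simp add: compF_assoc[OF G_Fun G_Fun])
  have Gm: "G \<rhd>\<^sub>N m \<in> Nat (G \<circ>\<^sub>F (G \<circ>\<^sub>F G)) (G \<circ>\<^sub>F G)"
    using whiskerL_Nat[OF E composite_Fun(4) m_Nat G_Fun] by simp
  have "m \<bullet>\<^sub>N (u \<lhd>\<^sub>N G) = idN G"
  proof (rule ran_E_eqI[OF vcomp_Nat[OF E E G_Fun uG m_Nat] idN_Nat[OF E E G_Fun] G_Fun])
    fix a assume a: "a \<in> Obj \<A>"
    then have "comp_at c a \<cdot>\<^bsub>E\<^esub> (comp_at m (fobj S a) \<cdot>\<^bsub>E\<^esub> comp_at u (fobj G (fobj S a)))
      = comp_at c a \<cdot>\<^bsub>E\<^esub> (farr G (comp_at c a) \<cdot>\<^bsub>E\<^esub> comp_at u (fobj G (fobj S a)))"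
      by (simp add: c_m_comp)
    also have "\<dots> = comp_at c a"
      using a c_natural[OF u_Nat composite_Fun(6)] by (simp add: c_u_comp)
    finally show "comp_at c a \<cdot>\<^bsub>E\<^esub> comp_at (m \<bullet>\<^sub>N (u \<lhd>\<^sub>N G)) (fobj S a)
      = comp_at c a \<cdot>\<^bsub>E\<^esub> comp_at (idN G) (fobj S a)" using a by simp
  qed
  moreover have "m \<bullet>\<^sub>N (G \<rhd>\<^sub>N u) = idN G"
  proof (rule ran_E_eqI[OF vcomp_Nat[OF E E G_Fun Gu m_Nat] idN_Nat[OF E E G_Fun] G_Fun])
    fix a assume a: "a \<in> Obj \<A>"
    then have "comp_at c a \<cdot>\<^bsub>E\<^esub> (comp_at m (fobj S a) \<cdot>\<^bsub>E\<^esub> farr G (comp_at u (fobj S a)))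
      = comp_at c a \<cdot>\<^bsub>E\<^esub> farr G (comp_at c a \<cdot>\<^bsub>E\<^esub> comp_at u (fobj S a))"
      by (simp add: c_m_comp)
    then show "comp_at c a \<cdot>\<^bsub>E\<^esub> comp_at (m \<bullet>\<^sub>N (G \<rhd>\<^sub>N u)) (fobj S a)
      = comp_at c a \<cdot>\<^bsub>E\<^esub> comp_at (idN G) (fobj S a)" using a by (simp add: c_u del: G_simps(8))
  qed
  moreover have "m \<bullet>\<^sub>N (m \<lhd>\<^sub>N G) = m \<bullet>\<^sub>N (G \<rhd>\<^sub>N m)"
  proof (rule ran_E_eqI[OF vcomp_Nat[OF E E GGG_Fun mG m_Nat] vcomp_Nat[OF E E GGG_Fun Gm m_Nat] GGG_Fun])
    fix a assume a: "a \<in> Obj \<A>"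
    let ?c = "comp_at c a" and ?s = "fobj S a"
    \<comment> \<open>After the outer \<open>m\<close> has become \<open>G c\<close>, naturality of
      \<open>m\<close> at \<open>c\<close> exchanges it with the inner \<open>m\<close>, so that an
      \<open>m\<close> stands next to \<open>c\<close> again and the law for \<open>c\<close> and
      \<open>m\<close> can be repeated.\<close>
    have "?c \<cdot>\<^bsub>E\<^esub> (comp_at m ?s \<cdot>\<^bsub>E\<^esub> comp_at m (fobj G ?s))
       = ?c \<cdot>\<^bsub>E\<^esub> (comp_at m ?s \<cdot>\<^bsub>E\<^esub> farr G (farr G ?c))"
      using a c_natural[OF m_Nat composite_Fun(4) a] by (simp add: c_m_comp)
    also have "\<dots> = ?c \<cdot>\<^bsub>E\<^esub> farr G (?c \<cdot>\<^bsub>E\<^esub> farr G ?c)"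
      using a by (simp add: c_m_comp)
    also have "\<dots> = ?c \<cdot>\<^bsub>E\<^esub> farr G (?c \<cdot>\<^bsub>E\<^esub> comp_at m ?s)"
      using a by (simp only: c_m)
    also have "\<dots> = ?c \<cdot>\<^bsub>E\<^esub> (comp_at m ?s \<cdot>\<^bsub>E\<^esub> farr G (comp_at m ?s))"
      using a by (simp add: c_m_comp)
    finally show "?c \<cdot>\<^bsub>E\<^esub> comp_at (m \<bullet>\<^sub>N (m \<lhd>\<^sub>N G)) ?s = ?c \<cdot>\<^bsub>E\<^esub> comp_at (m \<bullet>\<^sub>N (G \<rhd>\<^sub>N m)) ?s"
      using a by simp
  qed
  ultimately show ?thesis
    using G_Fun u_Nat m_Nat by (simp add: is_monad_def)
qed

sublocale G: monad_on E "\<lparr>mfun = G, munit = u, mmult = m\<rparr>"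
  by unfold_locales (rule codensity_monad)

section \<open>Unit, multiplication and monad laws of the codensity lifting\<close>

abbreviation "T' \<equiv> codensity_lifting p T S G c \<sigma>"

lemma T'_mfun [simp]: "mfun T' = TT"
  by (simp add: codensity_lifting_def Let_def)

text \<open>The condition for lifting the unit along \<sigma>. It is an equality of transformations
  into \<open>p Ran\<close>, so it may be checked at \<open>S a\<close> after \<open>p c\<close>:
  the left side becomes \<open>\<mu> (R a) \<cdot> \<eta> (T (R a))\<close>, the right side
  \<open>p\<close> of \<open>c\<close> after \<open>u\<close>, and both are identities.\<close>

lemma p_unit:
  assumes "X \<in> Obj E"
  shows "comp_at \<tau> X \<cdot>\<^bsub>B\<^esub> T.\<eta> (fobj p X) = farr p (comp_at u X)"
proof -
  note E = E.category_axioms and B = T.category_axioms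
  have pId: "p \<circ>\<^sub>F IdF E = p" "IdF B \<circ>\<^sub>F p = p" by (simp_all add: compF_IdF[OF p_Fun] IdF_compF[OF p_Fun])
  have "munit T \<lhd>\<^sub>N p \<in> Nat p (T.t \<circ>\<^sub>F p)"
    using whiskerR_Nat[OF E p_Fun IdF_Fun[OF B] T.unit_Nat] by (simp add: pId)
  from vcomp_Nat[OF E B p_Fun this \<tau>_Nat]
  have "\<tau> \<bullet>\<^sub>N (munit T \<lhd>\<^sub>N p) = p \<rhd>\<^sub>N u"
  proof (rule ran_B_eqI[OF _ _ p_Fun])
    show "p \<rhd>\<^sub>N u \<in> Nat p (p \<circ>\<^sub>F G)"
      using whiskerL_Nat[OF E composite_Fun(6) u_Nat p_Fun] by (simp add: pId)
    fix a assume a: "a \<in> Obj \<A>"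
    have "farr p (comp_at c a) \<cdot>\<^bsub>B\<^esub> (comp_at \<tau> (fobj S a) \<cdot>\<^bsub>B\<^esub> T.\<eta> (fobj p (fobj S a)))
       = (farr p (comp_at c a) \<cdot>\<^bsub>B\<^esub> comp_at \<tau> (fobj S a)) \<cdot>\<^bsub>B\<^esub> T.\<eta> (fobj p (fobj S a))"
      using a by simp
    also have "\<dots> = T.\<mu> (fobj R a) \<cdot>\<^bsub>B\<^esub> T.\<eta> (fobj T.t (fobj R a))"
      using a by (simp add: c_\<tau>)
    also have "\<dots> = farr p (comp_at c a \<cdot>\<^bsub>E\<^esub> comp_at u (fobj S a))"
      using a by (subst T.mult_unitL) (simp_all add: c_u)
    finally show "comp_at (p \<rhd>\<^sub>N c) a \<cdot>\<^bsub>B\<^esub> comp_at (\<tau> \<bullet>\<^sub>N (munit T \<lhd>\<^sub>N p)) (fobj S a)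
       = comp_at (p \<rhd>\<^sub>N c) a \<cdot>\<^bsub>B\<^esub> comp_at (p \<rhd>\<^sub>N u) (fobj S a)"
      using a by simp
  qed
  from this[THEN arg_cong[where f = "\<lambda>\<gamma>. comp_at \<gamma> X"]] assms show ?thesis by simp
qed

lemma \<sigma>\<sigma>_Nat: "m \<bullet>\<^sub>N (\<sigma> \<lhd>\<^sub>N G) \<bullet>\<^sub>N (TT \<rhd>\<^sub>N \<sigma>) \<in> Nat (TT \<circ>\<^sub>F TT) G"
proof -
  note E = E.category_axioms
  note F = compF_Fun[OF E TT_Fun TT_Fun]
  from vcomp_Nat[OF E E F whiskerL_Nat[OF E TT_Fun \<sigma>_Nat TT_Fun] whiskerR_Nat[OF E G_Fun TT_Fun \<sigma>_Nat]]
  show ?thesis by (rule vcomp_Nat[OF E E F _ m_Nat])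
qed

lemma \<tau>_natural: "f \<in> Arr E \<Longrightarrow>
   farr p (farr G f) \<cdot>\<^bsub>B\<^esub> comp_at \<tau> (Dom E f) = comp_at \<tau> (Cod E f) \<cdot>\<^bsub>B\<^esub> farr T.t (farr p f)"
  using Nat_natural[OF \<tau>_Nat composite_Fun(5)] by simp

text \<open>The condition for lifting the multiplication, again checked at \<open>S a\<close> after
  \<open>p c\<close>. The two sides become the two bracketings of the triple multiplication at
  \<open>R a\<close>, so associativity of \<open>T\<close> closes the gap.\<close>

lemma p_mult:
  assumes "X \<in> Obj E"
  shows "comp_at \<tau> X \<cdot>\<^bsub>B\<^esub> T.\<mu> (fobj p X)
    = farr p (comp_at m X \<cdot>\<^bsub>E\<^esub> (comp_at \<sigma> (fobj G X) \<cdot>\<^bsub>E\<^esub> farr TT (comp_at \<sigma> X)))"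
proof -
  note E = E.category_axioms and B = T.category_axioms
  note F = compF_Fun[OF E compF_Fun[OF E TT_Fun TT_Fun] p_Fun]
  have "mmult T \<lhd>\<^sub>N p \<in> Nat (p \<circ>\<^sub>F (TT \<circ>\<^sub>F TT)) (T.t \<circ>\<^sub>F p)"
    using whiskerR_Nat[OF E p_Fun T.TT_Fun T.mult_Nat] by (simp add: p_TT_TT)
  from vcomp_Nat[OF E B F this \<tau>_Nat]
  have "\<tau> \<bullet>\<^sub>N (mmult T \<lhd>\<^sub>N p) = p \<rhd>\<^sub>N (m \<bullet>\<^sub>N (\<sigma> \<lhd>\<^sub>N G) \<bullet>\<^sub>N (TT \<rhd>\<^sub>N \<sigma>))"
  proof (rule ran_B_eqI[OF _ _ F])
    show "p \<rhd>\<^sub>N (m \<bullet>\<^sub>N (\<sigma> \<lhd>\<^sub>N G) \<bullet>\<^sub>N (TT \<rhd>\<^sub>N \<sigma>)) \<in> Nat (p \<circ>\<^sub>F (TT \<circ>\<^sub>F TT)) (p \<circ>\<^sub>F G)"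
      by (rule whiskerL_Nat[OF E compF_Fun[OF E TT_Fun TT_Fun] \<sigma>\<sigma>_Nat p_Fun])
    fix a assume a: "a \<in> Obj \<A>"
    let ?c = "comp_at c a" and ?s = "fobj S a"
    have "farr p ?c \<cdot>\<^bsub>B\<^esub> farr p (comp_at m ?s \<cdot>\<^bsub>E\<^esub> (comp_at \<sigma> (fobj G ?s) \<cdot>\<^bsub>E\<^esub> farr TT (comp_at \<sigma> ?s)))
       = farr p ((?c \<cdot>\<^bsub>E\<^esub> comp_at m ?s) \<cdot>\<^bsub>E\<^esub> (comp_at \<sigma> (fobj G ?s) \<cdot>\<^bsub>E\<^esub> farr TT (comp_at \<sigma> ?s)))"
      using a by (simp del: p_\<sigma>_comp_at p_TT_simps)
    also have "\<dots> = farr p ?c \<cdot>\<^bsub>B\<^esub> ((farr p (farr G ?c) \<cdot>\<^bsub>B\<^esub> comp_at \<tau> (fobj G ?s)) \<cdot>\<^bsub>B\<^esub> farr T.t (comp_at \<tau> ?s))"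
      using a by (simp add: c_m)
    \<comment> \<open>Naturality of \<tau> at \<open>c\<close> produces \<open>p c\<close> after
      \<tau> twice, once outside and once under \<open>T\<close>; both copies then collapse to
      \<open>\<mu> (R a)\<close>.\<close>
    also have "\<dots> = (farr p ?c \<cdot>\<^bsub>B\<^esub> comp_at \<tau> ?s) \<cdot>\<^bsub>B\<^esub> farr T.t (farr p ?c \<cdot>\<^bsub>B\<^esub> comp_at \<tau> ?s)"
      using a \<tau>_natural[of ?c] by simp
    also have "\<dots> = (T.\<mu> (fobj R a) \<cdot>\<^bsub>B\<^esub> farr T.t (T.\<mu> (fobj R a)))"
      using a by (simp only: c_\<tau>)
    also have "\<dots> = (farr p ?c \<cdot>\<^bsub>B\<^esub> comp_at \<tau> ?s) \<cdot>\<^bsub>B\<^esub> T.\<mu> (fobj p ?s)"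
      using a T.mult_assoc[of "fobj R a"] by (simp add: c_\<tau>)
    also have "\<dots> = farr p ?c \<cdot>\<^bsub>B\<^esub> (comp_at \<tau> ?s \<cdot>\<^bsub>B\<^esub> T.\<mu> (fobj p ?s))"
      using a by simp
    finally show "comp_at (p \<rhd>\<^sub>N c) a \<cdot>\<^bsub>B\<^esub> comp_at (\<tau> \<bullet>\<^sub>N (mmult T \<lhd>\<^sub>N p)) ?s
      = comp_at (p \<rhd>\<^sub>N c) a \<cdot>\<^bsub>B\<^esub> comp_at (p \<rhd>\<^sub>N (m \<bullet>\<^sub>N (\<sigma> \<lhd>\<^sub>N G) \<bullet>\<^sub>N (TT \<rhd>\<^sub>N \<sigma>))) ?s"
      using a by simp
  qed
  from this[THEN arg_cong[where f = "\<lambda>\<gamma>. comp_at \<gamma> X"]] assms show ?thesis by simp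
qed

lemma T'_unit:
  shows T'_unit_Nat: "munit T' \<in> Nat (IdF E) TT"
    and p_munit: "p \<rhd>\<^sub>N munit T' = munit T \<lhd>\<^sub>N p"
    and \<sigma>_munit: "\<sigma> \<bullet>\<^sub>N munit T' = u"
proof -
  have w: "munit T \<lhd>\<^sub>N p \<in> Nat (p \<circ>\<^sub>F IdF E) (p \<circ>\<^sub>F TT)"
    using whiskerR_Nat[OF E.category_axioms p_Fun IdF_Fun[OF T.category_axioms] T.unit_Nat]
    by (simp add: p_TT compF_IdF[OF p_Fun] IdF_compF[OF p_Fun])
  have "\<exists>!h. h \<in> Nat (IdF E) TT \<and> p \<rhd>\<^sub>N h = munit T \<lhd>\<^sub>N p \<and> \<sigma> \<bullet>\<^sub>N h = u"
    by (rule lift_ex1[OF composite_Fun(6) u_Nat w]) (simp add: p_unit)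
  from theI'[OF this]
  show "munit T' \<in> Nat (IdF E) TT" "p \<rhd>\<^sub>N munit T' = munit T \<lhd>\<^sub>N p" "\<sigma> \<bullet>\<^sub>N munit T' = u"
    by (simp_all add: codensity_lifting_def Let_def)
qed

lemma T'_mult:
  shows T'_mult_Nat: "mmult T' \<in> Nat (TT \<circ>\<^sub>F TT) TT"
    and p_mmult: "p \<rhd>\<^sub>N mmult T' = mmult T \<lhd>\<^sub>N p"
    and \<sigma>_mmult: "\<sigma> \<bullet>\<^sub>N mmult T' = m \<bullet>\<^sub>N (\<sigma> \<lhd>\<^sub>N G) \<bullet>\<^sub>N (TT \<rhd>\<^sub>N \<sigma>)"
proof -
  note E = E.category_axioms
  have w: "mmult T \<lhd>\<^sub>N p \<in> Nat (p \<circ>\<^sub>F (TT \<circ>\<^sub>F TT)) (p \<circ>\<^sub>F TT)"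
    using whiskerR_Nat[OF E p_Fun T.TT_Fun T.mult_Nat] by (simp add: p_TT_TT p_TT)
  have "\<exists>!h. h \<in> Nat (TT \<circ>\<^sub>F TT) TT \<and> p \<rhd>\<^sub>N h = mmult T \<lhd>\<^sub>N p \<and>
      \<sigma> \<bullet>\<^sub>N h = m \<bullet>\<^sub>N (\<sigma> \<lhd>\<^sub>N G) \<bullet>\<^sub>N (TT \<rhd>\<^sub>N \<sigma>)"
    by (rule lift_ex1[OF compF_Fun[OF E TT_Fun TT_Fun] \<sigma>\<sigma>_Nat w]) (simp add: p_mult)
  from theI'[OF this]
  show "mmult T' \<in> Nat (TT \<circ>\<^sub>F TT) TT" "p \<rhd>\<^sub>N mmult T' = mmult T \<lhd>\<^sub>N p"
    "\<sigma> \<bullet>\<^sub>N mmult T' = m \<bullet>\<^sub>N (\<sigma> \<lhd>\<^sub>N G) \<bullet>\<^sub>N (TT \<rhd>\<^sub>N \<sigma>)"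
    by (simp_all add: codensity_lifting_def Let_def)
qed

abbreviation "\<eta>' \<equiv> comp_at (munit T')"
abbreviation "\<mu>' \<equiv> comp_at (mmult T')"

lemma TTTT_Fun: "TT \<circ>\<^sub>F TT \<in> Fun E E"
  by (rule compF_Fun[OF E.category_axioms TT_Fun TT_Fun])

lemmas \<eta>'_simps [simp] = NatD_simps[OF T'_unit_Nat composite_Fun(6), simplified]
lemmas \<mu>'_simps [simp] = NatD_simps[OF T'_mult_Nat TTTT_Fun, simplified]

lemma T'_comp_at:
  assumes "X \<in> Obj E"
  shows "farr p (\<eta>' X) = T.\<eta> (fobj p X)" "farr p (\<mu>' X) = T.\<mu> (fobj p X)"
    and "comp_at \<sigma> X \<cdot>\<^bsub>E\<^esub> \<eta>' X = comp_at u X"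
    and "comp_at \<sigma> X \<cdot>\<^bsub>E\<^esub> \<mu>' X
      = comp_at m X \<cdot>\<^bsub>E\<^esub> (comp_at \<sigma> (fobj G X) \<cdot>\<^bsub>E\<^esub> farr TT (comp_at \<sigma> X))"
  using p_munit[THEN arg_cong[where f = "\<lambda>\<gamma>. comp_at \<gamma> X"]] p_mmult[THEN arg_cong[where f = "\<lambda>\<gamma>. comp_at \<gamma> X"]]
   \<sigma>_munit[THEN arg_cong[where f = "\<lambda>\<gamma>. comp_at \<gamma> X"]] \<sigma>_mmult[THEN arg_cong[where f = "\<lambda>\<gamma>. comp_at \<gamma> X"]] assms
  by simp_all

lemma \<sigma>_\<mu>'_comp:
  assumes "X \<in> Obj E" "f \<in> Arr E" "Cod E f = fobj TT (fobj TT X)"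
  shows "comp_at \<sigma> X \<cdot>\<^bsub>E\<^esub> (\<mu>' X \<cdot>\<^bsub>E\<^esub> f)
      = comp_at m X \<cdot>\<^bsub>E\<^esub> (comp_at \<sigma> (fobj G X) \<cdot>\<^bsub>E\<^esub> (farr TT (comp_at \<sigma> X) \<cdot>\<^bsub>E\<^esub> f))"
proof -
  have "comp_at \<sigma> X \<cdot>\<^bsub>E\<^esub> (\<mu>' X \<cdot>\<^bsub>E\<^esub> f) = (comp_at \<sigma> X \<cdot>\<^bsub>E\<^esub> \<mu>' X) \<cdot>\<^bsub>E\<^esub> f"
    using assms by simp
  then show ?thesis using assms by (simp add: T'_comp_at)
qed

lemma \<sigma>_natural: "f \<in> Arr E \<Longrightarrow>
   farr G f \<cdot>\<^bsub>E\<^esub> comp_at \<sigma> (Dom E f) = comp_at \<sigma> (Cod E f) \<cdot>\<^bsub>E\<^esub> farr TT f"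
  using Nat_natural[OF \<sigma>_Nat TT_Fun] by simp

text \<open>The defining equations of the lifted structure say that \<sigma> is a morphism of monads
  to the codensity monad. Composition with \<sigma> thus turns a law upstairs into the same law for
  \<open>G\<close>, once naturality has moved \<sigma> through the composite; under \<open>p\<close>
  it is the law for \<open>T\<close>.\<close>

lemma lifting_monad: "is_monad E T'"
proof -
  note E = E.category_axioms
  note TTT_Fun = compF_Fun[OF E TTTT_Fun TT_Fun]
  have uT: "munit T' \<lhd>\<^sub>N TT \<in> Nat TT (TT \<circ>\<^sub>F TT)"
    using whiskerR_Nat[OF E TT_Fun composite_Fun(6) T'_unit_Nat] by (simp add: IdF_compF[OF TT_Fun])
  have Tu: "TT \<rhd>\<^sub>N munit T' \<in> Nat TT (TT \<circ>\<^sub>F TT)"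
    using whiskerL_Nat[OF E composite_Fun(6) T'_unit_Nat TT_Fun] by (simp add: compF_IdF[OF TT_Fun])
  have mT: "mmult T' \<lhd>\<^sub>N TT \<in> Nat (TT \<circ>\<^sub>F (TT \<circ>\<^sub>F TT)) (TT \<circ>\<^sub>F TT)"
    using whiskerR_Nat[OF E TT_Fun TTTT_Fun T'_mult_Nat] by (simp add: compF_assoc[OF TT_Fun TT_Fun])
  have Tm: "TT \<rhd>\<^sub>N mmult T' \<in> Nat (TT \<circ>\<^sub>F (TT \<circ>\<^sub>F TT)) (TT \<circ>\<^sub>F TT)"
    using whiskerL_Nat[OF E TTTT_Fun T'_mult_Nat TT_Fun] by simp
  have "mmult T' \<bullet>\<^sub>N (munit T' \<lhd>\<^sub>N TT) = idN TT"
  proof (rule lift_eqI[OF TT_Fun vcomp_Nat[OF E E TT_Fun uT T'_mult_Nat] idN_Nat[OF E E TT_Fun]])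
    fix X assume X: "X \<in> Obj E"
    show "farr p (comp_at (mmult T' \<bullet>\<^sub>N (munit T' \<lhd>\<^sub>N TT)) X) = farr p (comp_at (idN TT) X)"
      using X by (simp add: T'_comp_at T.mult_unitL)
    have "comp_at \<sigma> X \<cdot>\<^bsub>E\<^esub> (\<mu>' X \<cdot>\<^bsub>E\<^esub> \<eta>' (fobj TT X))
       = comp_at m X \<cdot>\<^bsub>E\<^esub> (comp_at \<sigma> (fobj G X) \<cdot>\<^bsub>E\<^esub> (farr TT (comp_at \<sigma> X) \<cdot>\<^bsub>E\<^esub> \<eta>' (fobj TT X)))"
      using X by (simp add: \<sigma>_\<mu>'_comp)
    also have "\<dots> = comp_at m X \<cdot>\<^bsub>E\<^esub> ((comp_at \<sigma> (fobj G X) \<cdot>\<^bsub>E\<^esub> \<eta>' (fobj G X)) \<cdot>\<^bsub>E\<^esub> comp_at \<sigma> X)"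
      using X Nat_natural[OF T'_unit_Nat composite_Fun(6), of "comp_at \<sigma> X"] by simp
    also have "\<dots> = (comp_at m X \<cdot>\<^bsub>E\<^esub> comp_at u (fobj G X)) \<cdot>\<^bsub>E\<^esub> comp_at \<sigma> X"
      using X by (simp add: T'_comp_at)
    also have "\<dots> = comp_at \<sigma> X"
      using X G.mult_unitL[of X] by simp
    finally show "comp_at \<sigma> X \<cdot>\<^bsub>E\<^esub> comp_at (mmult T' \<bullet>\<^sub>N (munit T' \<lhd>\<^sub>N TT)) X
        = comp_at \<sigma> X \<cdot>\<^bsub>E\<^esub> comp_at (idN TT) X" using X by simp
  qed
  moreover have "mmult T' \<bullet>\<^sub>N (TT \<rhd>\<^sub>N munit T') = idN TT"
  proof (rule lift_eqI[OF TT_Fun vcomp_Nat[OF E E TT_Fun Tu T'_mult_Nat] idN_Nat[OF E E TT_Fun]])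
    fix X assume X: "X \<in> Obj E"
    show "farr p (comp_at (mmult T' \<bullet>\<^sub>N (TT \<rhd>\<^sub>N munit T')) X) = farr p (comp_at (idN TT) X)"
      using X by (simp add: T'_comp_at T.mult_unitR)
    have "comp_at \<sigma> X \<cdot>\<^bsub>E\<^esub> (\<mu>' X \<cdot>\<^bsub>E\<^esub> farr TT (\<eta>' X))
       = comp_at m X \<cdot>\<^bsub>E\<^esub> (comp_at \<sigma> (fobj G X) \<cdot>\<^bsub>E\<^esub> farr TT (comp_at \<sigma> X \<cdot>\<^bsub>E\<^esub> \<eta>' X))"
      using X by (simp add: \<sigma>_\<mu>'_comp)
    also have "\<dots> = comp_at m X \<cdot>\<^bsub>E\<^esub> (comp_at \<sigma> (fobj G X) \<cdot>\<^bsub>E\<^esub> farr TT (comp_at u X))"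
      using X by (simp only: T'_comp_at)
    also have "\<dots> = (comp_at m X \<cdot>\<^bsub>E\<^esub> farr G (comp_at u X)) \<cdot>\<^bsub>E\<^esub> comp_at \<sigma> X"
      using X \<sigma>_natural[of "comp_at u X"] by simp
    also have "\<dots> = comp_at \<sigma> X"
      using X G.mult_unitR[of X] by simp
    finally show "comp_at \<sigma> X \<cdot>\<^bsub>E\<^esub> comp_at (mmult T' \<bullet>\<^sub>N (TT \<rhd>\<^sub>N munit T')) X
        = comp_at \<sigma> X \<cdot>\<^bsub>E\<^esub> comp_at (idN TT) X" using X by simp
  qed
  moreover have "mmult T' \<bullet>\<^sub>N (mmult T' \<lhd>\<^sub>N TT) = mmult T' \<bullet>\<^sub>N (TT \<rhd>\<^sub>N mmult T')"
  proof (rule lift_eqI[OF TTT_Fun vcomp_Nat[OF E E TTT_Fun mT T'_mult_Nat] vcomp_Nat[OF E E TTT_Fun Tm T'_mult_Nat]])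
    fix X assume X: "X \<in> Obj E"
    show "farr p (comp_at (mmult T' \<bullet>\<^sub>N (mmult T' \<lhd>\<^sub>N TT)) X) = farr p (comp_at (mmult T' \<bullet>\<^sub>N (TT \<rhd>\<^sub>N mmult T')) X)"
      using X by (simp add: T'_comp_at T.mult_assoc)
    let ?s = "comp_at \<sigma>" and ?m = "comp_at m"
    let ?r = "?s (fobj G (fobj G X)) \<cdot>\<^bsub>E\<^esub> (farr TT (?s (fobj G X)) \<cdot>\<^bsub>E\<^esub> farr TT (farr TT (?s X)))"
    have "?s X \<cdot>\<^bsub>E\<^esub> (\<mu>' X \<cdot>\<^bsub>E\<^esub> \<mu>' (fobj TT X))
       = ?m X \<cdot>\<^bsub>E\<^esub> (?s (fobj G X) \<cdot>\<^bsub>E\<^esub> (farr TT (?s X) \<cdot>\<^bsub>E\<^esub> \<mu>' (fobj TT X)))"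
      using X by (simp add: \<sigma>_\<mu>'_comp)
    \<comment> \<open>Naturality of the lifted multiplication at \<open>\<sigma> X\<close>, which
      frees the inner multiplication to meet \<sigma> at \<open>G X\<close>.\<close>
    also have "\<dots> = ?m X \<cdot>\<^bsub>E\<^esub> (?s (fobj G X) \<cdot>\<^bsub>E\<^esub> (\<mu>' (fobj G X) \<cdot>\<^bsub>E\<^esub> farr TT (farr TT (?s X))))"
      using X Nat_natural[OF T'_mult_Nat TTTT_Fun, of "?s X"] by simp
    also have "\<dots> = (?m X \<cdot>\<^bsub>E\<^esub> ?m (fobj G X)) \<cdot>\<^bsub>E\<^esub> ?r"
      using X by (simp add: \<sigma>_\<mu>'_comp)
    also have "\<dots> = (?m X \<cdot>\<^bsub>E\<^esub> farr G (?m X)) \<cdot>\<^bsub>E\<^esub> ?r"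
      using X G.mult_assoc[of X] by simp
    also have "\<dots> = ?m X \<cdot>\<^bsub>E\<^esub> ((farr G (?m X) \<cdot>\<^bsub>E\<^esub> ?s (fobj G (fobj G X)))
        \<cdot>\<^bsub>E\<^esub> (farr TT (?s (fobj G X)) \<cdot>\<^bsub>E\<^esub> farr TT (farr TT (?s X))))"
      using X by simp
    \<comment> \<open>Naturality of \<sigma> at \<open>m X\<close> brings \<open>m\<close> under
      \<open>TT\<close>, where it completes the right-hand side of the equation defining the lifted
      multiplication.\<close>
    also have "\<dots> = ?m X \<cdot>\<^bsub>E\<^esub> ((?s (fobj G X) \<cdot>\<^bsub>E\<^esub> farr TT (?m X))
        \<cdot>\<^bsub>E\<^esub> (farr TT (?s (fobj G X)) \<cdot>\<^bsub>E\<^esub> farr TT (farr TT (?s X))))"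
      using X \<sigma>_natural[of "?m X"] by simp
    also have "\<dots> = ?m X \<cdot>\<^bsub>E\<^esub> (?s (fobj G X) \<cdot>\<^bsub>E\<^esub> farr TT (?m X \<cdot>\<^bsub>E\<^esub> (?s (fobj G X) \<cdot>\<^bsub>E\<^esub> farr TT (?s X))))"
      using X by simp
    also have "\<dots> = ?m X \<cdot>\<^bsub>E\<^esub> (?s (fobj G X) \<cdot>\<^bsub>E\<^esub> farr TT (?s X \<cdot>\<^bsub>E\<^esub> \<mu>' X))"
      using X by (simp only: T'_comp_at)
    also have "\<dots> = ?s X \<cdot>\<^bsub>E\<^esub> (\<mu>' X \<cdot>\<^bsub>E\<^esub> farr TT (\<mu>' X))"
      using X by (simp add: \<sigma>_\<mu>'_comp)
    finally show "?s X \<cdot>\<^bsub>E\<^esub> comp_at (mmult T' \<bullet>\<^sub>N (mmult T' \<lhd>\<^sub>N TT)) X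
        = ?s X \<cdot>\<^bsub>E\<^esub> comp_at (mmult T' \<bullet>\<^sub>N (TT \<rhd>\<^sub>N mmult T')) X" using X by simp
  qed
  ultimately show ?thesis
    using TT_Fun T'_unit_Nat T'_mult_Nat by (simp add: is_monad_def)
qed

sublocale monad_lifting B T E T' p
  by unfold_locales (simp_all add: lifting_monad p_Fun p_TT p_munit p_mmult)

end

section \<open>Lifting algebraic operations\<close>

locale codensity_with_powers = codensity \<A> E B T p R S G c \<sigma>
  for \<A> :: "('oa, 'ma) cat" and E :: "('oe, 'me) cat" and B :: "('ob, 'mb) cat"
    and T p R S G c \<sigma> +
  fixes A :: "'i set" and PE PB \<alpha>
  assumes E_powers: "has_powers E A PE" and B_powers: "has_powers B A PB"
    and \<alpha>: "\<alpha> \<in> Alg T A PB"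
begin

sublocale monad_lifting_with_powers B T E T' p A PB PE
  by unfold_locales (simp_all add: E_powers B_powers)

lemmas \<alpha>_simps [simp] = PB.Alg_simps[OF \<alpha>]

lemma WS_Fun: "PE.W \<circ>\<^sub>F S \<in> Fun \<A> E"
  by (rule compF_Fun[OF A.category_axioms S_Fun PE.W_Fun])

text \<open>The counterpart of \<open>Alg_over_iff\<close> for the lifting parameter; the domains
  and codomains now match because \<open>K R = p S\<close>.\<close>

lemma Nat_over_iff:
  "\<alpha>\<^sub>0 \<in> Nat_over p A PE PB \<alpha> R S \<longleftrightarrow> \<alpha>\<^sub>0 \<in> Nat (PE.W \<circ>\<^sub>F S) S \<and>
    (\<forall>a\<in>Obj \<A>. farr p (comp_at \<alpha>\<^sub>0 a) = comp_at \<alpha> (fobj R a) \<cdot>\<^bsub>B\<^esub> \<kappa> (fobj S a))"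
proof (cases "\<alpha>\<^sub>0 \<in> Nat (PE.W \<circ>\<^sub>F S) S")
  case True
  let ?r = "(\<alpha> \<lhd>\<^sub>N R) \<bullet>\<^sub>N (power_comparison p A PE PB \<lhd>\<^sub>N S)"
  note [simp] = NatD_simps[OF True WS_Fun]
  have eq: "comp_at ?r a = comp_at \<alpha> (fobj R a) \<cdot>\<^bsub>B\<^esub> \<kappa> (fobj S a)" if "a \<in> Obj \<A>" for a
    using that by simp
  have "p \<rhd>\<^sub>N \<alpha>\<^sub>0 = ?r \<longleftrightarrow> comp_at (p \<rhd>\<^sub>N \<alpha>\<^sub>0) = comp_at ?r"
  proof -
    have "NDom (p \<rhd>\<^sub>N \<alpha>\<^sub>0) = NDom ?r" "NCod (p \<rhd>\<^sub>N \<alpha>\<^sub>0) = NCod ?r"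
      by (simp_all add: compF_assoc[OF S_Fun PE.W_Fun] K_R)
    then show ?thesis by (metis ntrans.equality old.unit.exhaust)
  qed
  also have "\<dots> \<longleftrightarrow> (\<forall>a\<in>Obj \<A>. comp_at (p \<rhd>\<^sub>N \<alpha>\<^sub>0) a = comp_at ?r a)"
  proof -
    have "comp_at (p \<rhd>\<^sub>N \<alpha>\<^sub>0) \<in> extensional (Obj \<A>)" "comp_at ?r \<in> extensional (Obj \<A>)"
      by (simp_all add: whiskerL_def vcomp_def)
    then show ?thesis by (metis extensionalityI)
  qed
  finally show ?thesis
    using True by (simp add: Nat_over_def fpower_def eq del: comp_at_vcomp)
qed (auto simp: Nat_over_def fpower_def)

section \<open>Passage between \<open>\<alpha>\<^sub>0\<close> and the generic effect
  \<beta>\<close>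

abbreviation "beta \<equiv> phi_beta p T S G c \<sigma> A PE PB \<alpha>"

text \<open>Undoes the two steps of \<open>phi_beta\<close> in reverse order: composition with
  \<sigma> undoes the factorisation, restriction along \<open>S\<close> followed by \<open>c\<close>
  undoes the transpose.\<close>

definition beta_inv :: "('oe, 'me, 'oe, 'me) ntrans \<Rightarrow> ('oa, 'ma, 'oe, 'me) ntrans" where
  "beta_inv \<beta> = c \<bullet>\<^sub>N ((\<sigma> \<bullet>\<^sub>N \<beta>) \<lhd>\<^sub>N S)"

lemma beta_inv_comp_at:
  assumes "\<beta> \<in> Nat PE.W TT" "a \<in> Obj \<A>"
  shows "comp_at (beta_inv \<beta>) a
    = comp_at c a \<cdot>\<^bsub>E\<^esub> (comp_at \<sigma> (fobj S a) \<cdot>\<^bsub>E\<^esub> comp_at \<beta> (fobj S a))"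
  using assms(2) NatD_simps[OF assms(1) PE.W_Fun] by (simp add: beta_inv_def)

text \<open>Composing \<open>p c\<close> with \<tau> gives \<open>\<mu> (R a)\<close>, and since
  \<open>p (S a)\<close> is \<open>T (R a)\<close> the rest is the generic effect of \<alpha> at
  \<open>T (R a)\<close>; \<open>Alg_generic\<close> contracts the whole to \<alpha> at
  \<open>R a\<close>. This links the condition over \<open>\<alpha> R\<close> with the condition on
  \<beta>.\<close>

lemma c_\<tau>_generic:
  assumes "a \<in> Obj \<A>"
  shows "farr p (comp_at c a) \<cdot>\<^bsub>B\<^esub> (comp_at \<tau> (fobj S a) \<cdot>\<^bsub>B\<^esub> comp_at (generic_base \<alpha>) (fobj S a))
    = comp_at \<alpha> (fobj R a) \<cdot>\<^bsub>B\<^esub> \<kappa> (fobj S a)"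
proof -
  let ?Y = "fobj p (fobj S a)" and ?Z = "fobj R a"
  have "farr p (comp_at c a) \<cdot>\<^bsub>B\<^esub> (comp_at \<tau> (fobj S a) \<cdot>\<^bsub>B\<^esub> comp_at (generic_base \<alpha>) (fobj S a))
    = (farr p (comp_at c a) \<cdot>\<^bsub>B\<^esub> comp_at \<tau> (fobj S a)) \<cdot>\<^bsub>B\<^esub>
        (comp_at \<alpha> ?Y \<cdot>\<^bsub>B\<^esub> (farr PB.W (T.\<eta> ?Y) \<cdot>\<^bsub>B\<^esub> \<kappa> (fobj S a)))"
    using assms by (simp add: generic_base_comp_at)
  also have "\<dots> = T.\<mu> ?Z \<cdot>\<^bsub>B\<^esub> (comp_at \<alpha> ?Y \<cdot>\<^bsub>B\<^esub> (farr PB.W (T.\<eta> ?Y) \<cdot>\<^bsub>B\<^esub> \<kappa> (fobj S a)))"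
    using assms by (simp only: c_\<tau>)
  also have "\<dots> = (T.\<mu> ?Z \<cdot>\<^bsub>B\<^esub> (comp_at \<alpha> (fobj T.t ?Z) \<cdot>\<^bsub>B\<^esub> farr PB.W (T.\<eta> (fobj T.t ?Z)))) \<cdot>\<^bsub>B\<^esub> \<kappa> (fobj S a)"
    using assms by simp
  also have "\<dots> = comp_at \<alpha> (fobj R a) \<cdot>\<^bsub>B\<^esub> \<kappa> (fobj S a)"
    using assms by (subst PB.Alg_generic[OF \<alpha>]) simp_all
  finally show ?thesis .
qed

lemma
  assumes "\<alpha>\<^sub>0 \<in> Nat_over p A PE PB \<alpha> R S"
  shows beta_Nat: "beta \<alpha>\<^sub>0 \<in> Nat PE.W TT"
    and p_beta: "p \<rhd>\<^sub>N beta \<alpha>\<^sub>0 = generic_base \<alpha>"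
    and beta_inv_beta: "beta_inv (beta \<alpha>\<^sub>0) = \<alpha>\<^sub>0"
proof -
  note E = E.category_axioms and B = T.category_axioms
  have \<alpha>\<^sub>0: "\<alpha>\<^sub>0 \<in> Nat (PE.W \<circ>\<^sub>F S) S" and over: "a \<in> Obj \<A> \<Longrightarrow>
      farr p (comp_at \<alpha>\<^sub>0 a) = comp_at \<alpha> (fobj R a) \<cdot>\<^bsub>B\<^esub> \<kappa> (fobj S a)" for a
    using assms by (simp_all add: Nat_over_iff)
  let ?\<gamma> = "ran_transpose S G c PE.W \<alpha>\<^sub>0"
  have \<gamma>: "?\<gamma> \<in> Nat PE.W G" "c \<bullet>\<^sub>N (?\<gamma> \<lhd>\<^sub>N S) = \<alpha>\<^sub>0"
    using ran_transpose[OF ran(1) _ \<alpha>\<^sub>0] PE.W_Fun by simp_all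
  note [simp] = NatD_simps[OF \<gamma>(1) PE.W_Fun]
  have w: "generic_base \<alpha> \<in> Nat (p \<circ>\<^sub>F PE.W) (p \<circ>\<^sub>F TT)"
    using generic_base_Nat[OF \<alpha>] by simp
  note pW_Fun = compF_Fun[OF E PE.W_Fun p_Fun]
  have \<tau>w: "\<tau> \<bullet>\<^sub>N generic_base \<alpha> \<in> Nat (p \<circ>\<^sub>F PE.W) (p \<circ>\<^sub>F G)"
    using vcomp_Nat[OF E B pW_Fun w] \<tau>_Nat by (simp add: p_TT)
  \<comment> \<open>The equation is known only at \<open>S a\<close> after \<open>p c\<close>, where
    it is exactly the hypothesis that \<open>\<alpha>\<^sub>0\<close> lies over
    \<open>\<alpha> R\<close>. The Kan extension in the base spreads it to all of \<open>E\<close>,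
    as the factorisation through \<sigma> demands.\<close>
  have *: "\<tau> \<bullet>\<^sub>N generic_base \<alpha> = p \<rhd>\<^sub>N ?\<gamma>"
  proof (rule ran_B_eqI[OF \<tau>w whiskerL_Nat[OF E PE.W_Fun \<gamma>(1) p_Fun] pW_Fun])
    fix a assume a: "a \<in> Obj \<A>"
    have "farr p (comp_at c a \<cdot>\<^bsub>E\<^esub> comp_at ?\<gamma> (fobj S a)) = farr p (comp_at \<alpha>\<^sub>0 a)"
      using a \<gamma>(2)[THEN arg_cong[where f = "\<lambda>\<gamma>. comp_at \<gamma> a"]] by simp
    then show "comp_at (p \<rhd>\<^sub>N c) a \<cdot>\<^bsub>B\<^esub> comp_at (\<tau> \<bullet>\<^sub>N generic_base \<alpha>) (fobj S a)
       = comp_at (p \<rhd>\<^sub>N c) a \<cdot>\<^bsub>B\<^esub> comp_at (p \<rhd>\<^sub>N ?\<gamma>) (fobj S a)"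
      using a c_\<tau>_generic[OF a] by (simp add: over NatD_simps[OF w pW_Fun] FunD_simps[OF pW_Fun])
  qed
  have "comp_at \<tau> X \<cdot>\<^bsub>B\<^esub> comp_at (generic_base \<alpha>) X = farr p (comp_at ?\<gamma> X)" if "X \<in> Obj E" for X
    using that *[THEN arg_cong[where f = "\<lambda>\<gamma>. comp_at \<gamma> X"]]
    by (simp add: NatD_simps[OF w pW_Fun] FunD_simps[OF pW_Fun])
  from theI'[OF lift_ex1[OF PE.W_Fun \<gamma>(1) w this]]
  have b: "beta \<alpha>\<^sub>0 \<in> Nat PE.W TT \<and> p \<rhd>\<^sub>N beta \<alpha>\<^sub>0 = generic_base \<alpha> \<and> \<sigma> \<bullet>\<^sub>N beta \<alpha>\<^sub>0 = ?\<gamma>"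
    by (simp add: phi_beta_def fpower_def compF_IdF[OF PE.W_Fun] generic_base_def Let_def)
  then show "beta \<alpha>\<^sub>0 \<in> Nat PE.W TT" "p \<rhd>\<^sub>N beta \<alpha>\<^sub>0 = generic_base \<alpha>" by auto
  show "beta_inv (beta \<alpha>\<^sub>0) = \<alpha>\<^sub>0" using b \<gamma>(2) by (simp add: beta_inv_def)
qed

text \<open>Applying \<open>beta_inv\<close> to \<open>beta (beta_inv \<beta>)\<close> gives
  \<open>beta_inv \<beta>\<close> again, so this transformation and \<beta> have the same composite
  with \<sigma> by uniqueness of transposes. Their images under \<open>p\<close> are both
  \<open>generic_base \<alpha>\<close>, and \<sigma> is cartesian.\<close>

lemma
  assumes \<beta>: "\<beta> \<in> Nat PE.W TT" and over: "p \<rhd>\<^sub>N \<beta> = generic_base \<alpha>"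
  shows beta_inv_Nat_over: "beta_inv \<beta> \<in> Nat_over p A PE PB \<alpha> R S"
    and beta_beta_inv: "beta (beta_inv \<beta>) = \<beta>"
proof -
  note E = E.category_axioms and A = A.category_axioms
  note [simp] = NatD_simps[OF \<beta> PE.W_Fun]
  note \<sigma>\<beta> = vcomp_Nat[OF E E PE.W_Fun _ \<sigma>_Nat]
  have Nat: "beta_inv \<beta> \<in> Nat (PE.W \<circ>\<^sub>F S) S"
    unfolding beta_inv_def
    by (rule vcomp_Nat[OF A E WS_Fun whiskerR_Nat[OF A S_Fun PE.W_Fun \<sigma>\<beta>[OF \<beta>]] c_Nat])
  have p\<beta>: "farr p (comp_at \<beta> X) = comp_at (generic_base \<alpha>) X" if "X \<in> Obj E" for X
    using that over[THEN arg_cong[where f = "\<lambda>\<gamma>. comp_at \<gamma> X"]] by simp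
  have "farr p (comp_at (beta_inv \<beta>) a) = comp_at \<alpha> (fobj R a) \<cdot>\<^bsub>B\<^esub> \<kappa> (fobj S a)"
    if a: "a \<in> Obj \<A>" for a
    using a c_\<tau>_generic[OF a] by (simp add: beta_inv_comp_at[OF \<beta>] p\<beta>)
  with Nat show inv: "beta_inv \<beta> \<in> Nat_over p A PE PB \<alpha> R S" by (simp add: Nat_over_iff)
  let ?\<beta> = "beta (beta_inv \<beta>)"
  note b = beta_Nat[OF inv] p_beta[OF inv] beta_inv_beta[OF inv]
  note [simp] = NatD_simps[OF b(1) PE.W_Fun]
  have "\<sigma> \<bullet>\<^sub>N ?\<beta> = \<sigma> \<bullet>\<^sub>N \<beta>"
  proof (rule ran_E_eqI[OF \<sigma>\<beta>[OF b(1)] \<sigma>\<beta>[OF \<beta>] PE.W_Fun])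
    fix a assume "a \<in> Obj \<A>"
    then show "comp_at c a \<cdot>\<^bsub>E\<^esub> comp_at (\<sigma> \<bullet>\<^sub>N ?\<beta>) (fobj S a) = comp_at c a \<cdot>\<^bsub>E\<^esub> comp_at (\<sigma> \<bullet>\<^sub>N \<beta>) (fobj S a)"
      using b(3)[THEN arg_cong[where f = "\<lambda>\<gamma>. comp_at \<gamma> a"]] by (simp add: beta_inv_comp_at[OF \<beta>] beta_inv_comp_at[OF b(1)])
  qed
  note \<sigma>_eq = this[THEN arg_cong[where f = "\<lambda>\<gamma>. comp_at \<gamma> X" for X]]
  have p_eq: "p \<rhd>\<^sub>N ?\<beta> = p \<rhd>\<^sub>N \<beta>" using b(2) over by simp
  show "?\<beta> = \<beta>"
  proof (rule lift_eqI[OF PE.W_Fun b(1) \<beta>])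
    fix X assume X: "X \<in> Obj E"
    show "farr p (comp_at ?\<beta> X) = farr p (comp_at \<beta> X)"
      using X p_eq[THEN arg_cong[where f = "\<lambda>\<gamma>. comp_at \<gamma> X"]] by simp
    show "comp_at \<sigma> X \<cdot>\<^bsub>E\<^esub> comp_at ?\<beta> X = comp_at \<sigma> X \<cdot>\<^bsub>E\<^esub> comp_at \<beta> X"
      using X \<sigma>_eq[of X] by simp
  qed
qed

lemma bij_betw_beta:
  "bij_betw beta (Nat_over p A PE PB \<alpha> R S) {\<beta> \<in> Nat PE.W TT. p \<rhd>\<^sub>N \<beta> = generic_base \<alpha>}"
  by (rule bij_betwI[where g = beta_inv])
    (auto simp: beta_Nat p_beta beta_inv_beta beta_inv_Nat_over beta_beta_inv)

lemma bij_betw_phi: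
  "bij_betw (phi p T S G c \<sigma> A PE PB \<alpha>) (Nat_over p A PE PB \<alpha> R S) (Alg_over p T A PE PB \<alpha> T')"
proof -
  have "phi p T S G c \<sigma> A PE PB \<alpha> = T'.alg_of_generic \<circ> beta"
    by (simp add: fun_eq_iff phi_def T'.alg_of_generic_def Let_def)
  with bij_betw_trans[OF bij_betw_beta bij_betw_alg_of_generic[OF \<alpha>, simplified T'_mfun]]
  show ?thesis by simp
qed

end

theorem theorem6p5:
  fixes \<A> :: "('oa, 'ma) cat" and \<E> :: "('oe, 'me) cat" and \<B> :: "('ob, 'mb) cat"
    and p :: "('oe, 'me, 'ob, 'mb) func"
    and T :: "('ob, 'mb) monad"
    and R :: "('oa, 'ma, 'ob, 'ob \<times> 'mb \<times> 'ob) func"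
    and S :: "('oa, 'ma, 'oe, 'me) func"
    and G :: "('oe, 'me, 'oe, 'me) func" and c :: "('oa, 'ma, 'oe, 'me) ntrans"
    and \<sigma> :: "('oe, 'me, 'oe, 'me) ntrans"
    and A :: "'i set"
    and PE :: "('oe, 'i, 'me) powers" and PB :: "('ob, 'i, 'mb) powers"
    and \<alpha> :: "('ob, 'ob \<times> 'mb \<times> 'ob, 'ob, 'mb) ntrans"
  assumes "category \<A>" and "category \<E>" and "category \<B>"
    and "fibration \<E> \<B> p"
    and "is_monad \<B> T"
    and "lifting_parameter \<A> \<E> p T R S"
    and "codensity_condition p S G c"
    and "codensity_cartesian p T R S G c \<sigma>"
    and "has_powers \<E> A PE" and "has_powers \<B> A PB" and "preserves_powers p A"
    and "\<alpha> \<in> Alg T A PB"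
  shows "bij_betw (phi p T S G c \<sigma> A PE PB \<alpha>)
           (Nat_over p A PE PB \<alpha> R S)
           (Alg_over p T A PE PB \<alpha> (codensity_lifting p T S G c \<sigma>))"
proof -
  have "p \<in> Fun \<E> \<B>" using assms(4) by (simp add: fibration_def)
  then have "codensity_with_powers \<A> \<E> \<B> T p R S G c \<sigma> A PE PB \<alpha>"
    using assms by (simp add: codensity_with_powers_def codensity_with_powers_axioms_def
        codensity_def codensity_axioms_def monad_on_def monad_on_axioms_def)
  then show ?thesis by (rule codensity_with_powers.bij_betw_phi)
qed

end
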